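(* Let $m \geq 2$, let $\mu \in \mathbb{R}\setminus\{0\}$, let $D \subset \mathbb{R}^m$ be a bounded domain, and let $u \in C^0(D)$ be real-valued. Suppose that for every $x \in D$ there is $r(x) > 0$ with $\overline{B_{r(x)}(x)} \subset D$ such that \[ a^\circ(\mu r)\, M^\bullet(u,x,r) = a^\bullet(\mu r)\, M^\circ(u,x,r) \quad \text{for all } r \in (0, r(x)). \] Then $u$ is $\mu$-panharmonic in $D$.
   Context: A domain is a connected open set. A real-valued function $u$ is called $\mu$-panharmonic in $D$ if $u \in C^2(D)$ and $\nabla^2 u - \mu^2 u = 0$ in $D$. $B_r(x)$ is the open ball of radius $r$ centred at $x$ and $S_r(x)=\partial B_r(x)$. $M^\bullet(u,x,r) = |B_r|^{-1}\int_{B_r(x)} u(y)\,dy$ is the volume mean and $M^\circ(u,x,r) = |S_r|^{-1}\int_{S_r(x)} u(y)\,dS_y$ is the spherical mean, where $|B_r|$ and $|S_r|$ are the volume of the ball and the area of the sphere of radius $r$. Further, \[ a^\circ(t) = \Gamma\!\left(\tfrac m2\right)\frac{I_{(m-2)/2}(t)}{(t/2)^{(m-2)/2}}, \qquad a^\bullet(t) = \Gamma\!\left(\tfrac m2+1\right)\frac{I_{m/2}(t)}{(t/2)^{m/2}}, \] where $I_\nu$ is the modified Bessel function of the first kind of order $\nu$; both are understood as even entire functions given by their power series, with value $1$ at $t=0$. *)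

theory Defs
  imports "HOL-Analysis.Analysis"
begin

definition partial_derivative :: "'a::euclidean_space \<Rightarrow> ('a \<Rightarrow> real) \<Rightarrow> 'a \<Rightarrow> real" where
  "partial_derivative b f x = deriv (\<lambda>t. f (x + t *\<^sub>R b)) 0"

text \<open>The classes \<open>C\<^sup>k(D)\<close>, meant for open \<open>D\<close>: only the values of \<open>f\<close> on \<open>D\<close> matter then.\<close>

fun C_class_on :: "nat \<Rightarrow> ('a::euclidean_space \<Rightarrow> real) \<Rightarrow> 'a set \<Rightarrow> bool" where
  "C_class_on 0 f D \<longleftrightarrow> continuous_on D f"
| "C_class_on (Suc k) f D \<longleftrightarrow> continuous_on D f \<and>
     (\<forall>b\<in>Basis. (\<forall>x\<in>D. (\<lambda>t. f (x + t *\<^sub>R b)) differentiable (at 0)) \<and>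
        C_class_on k (partial_derivative b f) D)"

definition laplacian :: "('a::euclidean_space \<Rightarrow> real) \<Rightarrow> 'a \<Rightarrow> real" where
  "laplacian f x = (\<Sum>b\<in>Basis. partial_derivative b (partial_derivative b f) x)"

definition panharmonic_on :: "real \<Rightarrow> ('a::euclidean_space \<Rightarrow> real) \<Rightarrow> 'a set \<Rightarrow> bool" where
  "panharmonic_on \<mu> u D \<longleftrightarrow>
     C_class_on 2 u D \<and> (\<forall>x\<in>D. laplacian u x - \<mu>\<^sup>2 * u x = 0)"

text \<open>
  The surface measure of the sphere of radius \<open>r > 0\<close> about \<open>x\<close>, as it occurs in integration in
  polar coordinates: the surface measure of a subset of the unit sphere is the dimension times the
  volume of the cone from the origin over it, and a sphere of radius \<open>r\<close> carries the image of
  this measure, multiplied by \<open>r\<close> to the power of the dimension minus one. The centre of the unit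
  ball, where \<^const>\<open>sgn\<close> vanishes, is a null set.
\<close>

definition sphere_measure :: "'a::euclidean_space \<Rightarrow> real \<Rightarrow> 'a measure" where
  "sphere_measure x r =
     scale_measure (ennreal (real DIM('a) * r ^ (DIM('a) - 1)))
       (distr (restrict_space lborel (ball 0 1)) borel (\<lambda>y. x + r *\<^sub>R sgn y))"

definition volume_mean :: "('a::euclidean_space \<Rightarrow> real) \<Rightarrow> 'a \<Rightarrow> real \<Rightarrow> real" where
  "volume_mean u x r = (LINT y:ball x r|lborel. u y) / measure lborel (ball x r)"

definition spherical_mean :: "('a::euclidean_space \<Rightarrow> real) \<Rightarrow> 'a \<Rightarrow> real \<Rightarrow> real" where
  "spherical_mean u x r =
     (LINT y:sphere x r|sphere_measure x r. u y) / measure (sphere_measure x r) (sphere x r)"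

text \<open>The modified Bessel function of the first kind, for \<open>t > 0\<close>.\<close>

definition bessel_I :: "real \<Rightarrow> real \<Rightarrow> real" where
  "bessel_I \<nu> t = (\<Sum>k. (t / 2) powr (2 * real k + \<nu>) / (fact k * Gamma (\<nu> + real k + 1)))"

text \<open>The even entire function \<open>I\<^sub>\<nu>(t) / (t/2)\<^sup>\<nu>\<close>; see \<open>bessel_I_conv_entire\<close> below.\<close>

definition bessel_I_entire :: "real \<Rightarrow> real \<Rightarrow> real" where
  "bessel_I_entire \<nu> t = (\<Sum>k. (t / 2) ^ (2 * k) / (fact k * Gamma (\<nu> + real k + 1)))"

definition a_spherical :: "nat \<Rightarrow> real \<Rightarrow> real" where
  "a_spherical m t = Gamma (real m / 2) * bessel_I_entire ((real m - 2) / 2) t"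

definition a_volume :: "nat \<Rightarrow> real \<Rightarrow> real" where
  "a_volume m t = Gamma (real m / 2 + 1) * bessel_I_entire (real m / 2) t"

lemma summable_bessel_I_entire:
  assumes "\<nu> > -1"
  shows "summable (\<lambda>k. (t / 2) ^ (2 * k) / (fact k * Gamma (\<nu> + real k + 1)) :: real)"
proof -
  define c where "c = Gamma (\<nu> + 1)"
  have cpos: "c > 0" using assms by (simp add: c_def)
  define q where "q = min 1 (\<nu> + 1)"
  have q: "0 < q" "q \<le> 1" "q \<le> \<nu> + 1" using assms by (auto simp: q_def)
  have G: "Gamma (\<nu> + real k + 1) \<ge> c * q ^ k" for k
  proof (induction k)
    case 0
    show ?case by (simp add: c_def)
  next
    case (Suc k)
    have "Gamma (\<nu> + real (Suc k) + 1) = (\<nu> + real k + 1) * Gamma (\<nu> + real k + 1)"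
      using Gamma_plus1[of "\<nu> + real k + 1"] assms by (simp add: add_ac nonpos_Ints_def)
    also have "\<dots> \<ge> q * (c * q ^ k)"
      using Suc q cpos by (intro mult_mono) auto
    finally show ?case by (simp add: mult_ac)
  qed
  have "summable (\<lambda>k. (1 / c) * (((t / 2)\<^sup>2 / q) ^ k /\<^sub>R fact k))"
    by (intro summable_mult summable_exp_generic)
  moreover have "norm ((t / 2) ^ (2 * k) / (fact k * Gamma (\<nu> + real k + 1)))
      \<le> (1 / c) * (((t / 2)\<^sup>2 / q) ^ k /\<^sub>R fact k)" for k
  proof -
    have "norm ((t / 2) ^ (2 * k) / (fact k * Gamma (\<nu> + real k + 1)))
        = ((t / 2)\<^sup>2) ^ k / (fact k * Gamma (\<nu> + real k + 1))"
      using assms by (simp add: power_mult abs_of_pos)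
    also have "\<dots> \<le> ((t / 2)\<^sup>2) ^ k / (fact k * (c * q ^ k))"
      using G[of k] cpos q by (intro divide_left_mono mult_left_mono mult_pos_pos) auto
    also have "\<dots> = (1 / c) * (((t / 2)\<^sup>2 / q) ^ k /\<^sub>R fact k)"
      by (simp add: power_divide field_simps)
    finally show ?thesis .
  qed
  ultimately show ?thesis
    by (rule summable_comparison_test'[where N = 0])
qed

lemma bessel_I_conv_entire:
  assumes "\<nu> > -1" "t > 0"
  shows "bessel_I \<nu> t = (t / 2) powr \<nu> * bessel_I_entire \<nu> t"
proof -
  have "(t / 2) powr (2 * real k + \<nu>) = (t / 2) powr \<nu> * (t / 2) ^ (2 * k)" for k
    using assms powr_realpow[of "t / 2" "2 * k"] by (simp add: powr_add)
  then show ?thesis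
    unfolding bessel_I_def bessel_I_entire_def
    by (simp add: suminf_mult[OF summable_bessel_I_entire[OF assms(1)], symmetric])
qed

lemma a_spherical_conv_bessel_I:
  assumes "m \<ge> 1" "t > 0"
  shows "a_spherical m t =
    Gamma (real m / 2) * (bessel_I ((real m - 2) / 2) t / (t / 2) powr ((real m - 2) / 2))"
  using assms by (simp add: a_spherical_def bessel_I_conv_entire)

lemma a_volume_conv_bessel_I:
  assumes "t > 0"
  shows "a_volume m t =
    Gamma (real m / 2 + 1) * (bessel_I (real m / 2) t / (t / 2) powr (real m / 2))"
  using assms by (simp add: a_volume_def bessel_I_conv_entire)

lemma bessel_I_entire_0: "bessel_I_entire \<nu> 0 = 1 / Gamma (\<nu> + 1)"
proof -
  have "(\<lambda>k. (0 / 2) ^ (2 * k) / (fact k * Gamma (\<nu> + real k + 1)) :: real) sums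
      (\<Sum>k\<in>{0}. (0 / 2) ^ (2 * k) / (fact k * Gamma (\<nu> + real k + 1)))"
    by (intro sums_finite) auto
  then show ?thesis
    by (simp add: bessel_I_entire_def sums_iff)
qed

lemma a_spherical_0: "m \<ge> 1 \<Longrightarrow> a_spherical m 0 = 1"
  using Gamma_real_pos[of "real m / 2", THEN less_imp_neq]
  by (simp add: a_spherical_def bessel_I_entire_0 diff_divide_distrib)

lemma a_volume_0: "a_volume m 0 = 1"
  using Gamma_real_pos[of "real m / 2 + 1", THEN less_imp_neq]
  by (simp add: a_volume_def bessel_I_entire_0)

lemma emeasure_sphere_measure:
  fixes x :: "'a::euclidean_space"
  assumes "r > 0" "A \<in> sets borel"
  shows "emeasure (sphere_measure x r) A = ennreal (real DIM('a) * r ^ (DIM('a) - 1)) *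
    emeasure lborel {y \<in> ball 0 1. x + r *\<^sub>R sgn y \<in> A}"
proof -
  have sgn: "(sgn :: 'a \<Rightarrow> 'a) \<in> borel_measurable borel"
    by (simp add: sgn_div_norm[abs_def])
  have m: "(\<lambda>y. x + r *\<^sub>R sgn y) \<in> borel_measurable (restrict_space lborel (ball 0 1))"
    using sgn by (intro measurable_restrict_space1) auto
  have "(\<lambda>y. x + r *\<^sub>R sgn y) -` A \<inter> space (restrict_space lborel (ball 0 1))
      = {y \<in> ball 0 1. x + r *\<^sub>R sgn y \<in> A}"
    by (auto simp: space_restrict_space)
  moreover have "emeasure (restrict_space lborel (ball 0 1)) {y \<in> ball 0 1. x + r *\<^sub>R sgn y \<in> A}
      = emeasure lborel {y \<in> ball 0 1. x + r *\<^sub>R sgn y \<in> A}"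
    by (rule emeasure_restrict_space) auto
  ultimately show ?thesis
    using assms m by (simp add: sphere_measure_def emeasure_distr del: mem_ball)
qed

lemma measure_sphere_measure_sphere:
  fixes x :: "'a::euclidean_space"
  assumes "r > 0"
  shows "measure (sphere_measure x r) (sphere x r) =
    real DIM('a) * r ^ (DIM('a) - 1) * measure lborel (ball (0::'a) 1)"
proof -
  have "{y \<in> ball 0 1. x + r *\<^sub>R sgn y \<in> sphere x r} = ball (0::'a) 1 - {0}"
    using assms by (auto simp: dist_norm norm_sgn)
  moreover have "emeasure lborel (ball (0::'a) 1 - {0}) = emeasure lborel (ball (0::'a) 1)"
    by (intro emeasure_Diff_null_set) auto
  ultimately have "emeasure (sphere_measure x r) (sphere x r) =
      ennreal (real DIM('a) * r ^ (DIM('a) - 1)) * emeasure lborel (ball (0::'a) 1)"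
    using assms by (simp add: emeasure_sphere_measure)
  then show ?thesis
    using assms by (simp add: measure_def enn2real_mult)
qed

end

theory Submission
  imports Defs
begin

text \<open>
  Write \<open>m\<close> for the dimension, \<open>\<omega>\<close> for the volume of the unit ball and
  \<open>V(x, r)\<close> for the integral of \<open>u\<close> over the ball \<open>B\<^sub>r(x)\<close>.

  The hypothesis is a differential equation in the radius. The derivative of \<open>V(x, r)\<close> in \<open>r\<close> is
  the surface integral of \<open>u\<close>, and the derivative of \<open>r\<^sup>m a\<^sup>\<bullet>(\<mu>r)\<close> is \<open>m r\<^sup>m\<^sup>-\<^sup>1 a\<^sup>\<circ>(\<mu>r)\<close>; so the
  quotient identity says that \<open>V(x, r) / (r\<^sup>m a\<^sup>\<bullet>(\<mu>r))\<close> has derivative zero, and letting \<open>r\<close> tend to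
  zero identifies the constant: \<open>V(x, r) = \<omega> r\<^sup>m a\<^sup>\<bullet>(\<mu>r) u(x)\<close> for small \<open>r\<close>
  (\<open>volume_mean_from_quotient\<close>). Since \<open>a\<^sup>\<bullet>(\<mu>r) = 1 + \<mu>\<^sup>2 r\<^sup>2 / (2(m + 2)) + o(r\<^sup>2)\<close>, the function
  \<open>u\<close> satisfies the equation at each point in the sense of averages.

  The difficulty is that the admissible radii depend on the point, with no uniformity, so that this
  pointwise information cannot simply be integrated against a test function. The remedy is to
  replace \<open>u\<close> by its sup-convolution \<open>v(x) = sup\<^sub>y (u(y) - N|x - y|\<^sup>2)\<close>. Sliding the ball from \<open>x\<close> to a
  maximizer \<open>y\<close> transfers the mean value property of \<open>u\<close> at \<open>y\<close> to a pointwise subsolution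
  inequality for \<open>v\<close> at \<open>x\<close>; at the same time \<open>v\<close> is semiconvex, so that its ball averages lie
  below the central value by at most \<open>N r\<^sup>2\<close>, uniformly in the point. This lower bound allows
  dominated convergence (\<open>weak_subsolution\<close>): \<open>v\<close> is a weak subsolution. Letting \<open>N\<close> tend to infinity,
  and arguing in the same way for \<open>-u\<close>, one finds that \<open>u\<close> solves the equation weakly
  (\<open>weak_equation_of_mean_value\<close>).

  It suffices to test with translates of \<open>(s - |z|\<^sup>2)\<^sub>+\<^sup>3\<close>, which is of class \<open>C\<^sup>2\<close>. Let \<open>J\<^sub>p(x, s)\<close> be
  the integral of \<open>u(y) (s - |y - x|\<^sup>2)\<^sub>+\<^sup>p\<close> over \<open>y\<close>. The Laplacian of the test function is a
  combination of the truncated powers of order one and two, so the weak equation is a linear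
  second order ordinary differential equation for \<open>J\<^sub>3(x, s)\<close> as a function of \<open>s\<close>. For two points
  \<open>x\<close> and \<open>x'\<close> the combination \<open>J\<^sub>3(x, s) u(x') - J\<^sub>3(x', s) u(x)\<close> solves it as well, and it vanishes
  for small \<open>s\<close> by the local mean value property; hence it vanishes for all \<open>s\<close> up to a bound that
  is uniform in \<open>x\<close> and \<open>x'\<close> (\<open>cap_integral_of_mean_value\<close>).

  Near every point this gives \<open>u(x) = c J\<^sub>3(x, s)\<close> with a fixed \<open>c\<close> and a fixed \<open>s\<close>. The right-hand side
  is of class \<open>C\<^sup>2\<close> in \<open>x\<close>, and the weak equation says exactly that its Laplacian is \<open>\<mu>\<^sup>2\<close> times itself
  (\<open>panharmonic_near_center\<close>).
\<close>

section \<open>Integrals over balls and their derivative in the radius\<close>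

lemma set_integrable_ball_continuous:
  fixes f :: "'a::euclidean_space \<Rightarrow> real"
  assumes "continuous_on UNIV f"
  shows "set_integrable lborel (ball x r) f"
proof -
  have "set_integrable lborel (cball x r) f"
    unfolding set_integrable_def
    using assms by (intro borel_integrable_compact) (auto intro: continuous_on_subset)
  then show ?thesis
    by (rule set_integrable_subset) (auto simp: ball_subset_cball)
qed

lemma lborel_integral_affine:
  fixes f :: "'a::euclidean_space \<Rightarrow> real"
  assumes [measurable]: "f \<in> borel_measurable borel" and "c \<noteq> 0"
  shows "(LINT y|lborel. f y) = \<bar>c\<bar> ^ DIM('a) * (LINT y|lborel. f (t + c *\<^sub>R y))"
  by (subst lborel_affine[OF assms(2), of t])
     (simp add: integral_density integral_distr)

lemma set_integral_ball_affine:
  fixes f :: "'a::euclidean_space \<Rightarrow> real"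
  assumes [measurable]: "f \<in> borel_measurable borel" and "c > 0"
  shows "(LINT y:ball x (c * r)|lborel. f y) =
    c ^ DIM('a) * (LINT y:ball 0 r|lborel. f (x + c *\<^sub>R y))"
proof -
  have ind: "indicator (ball x (c * r)) (x + c *\<^sub>R y) = (indicator (ball 0 r) y :: real)" for y
    using assms(2) by (simp add: indicator_def dist_norm)
  have "(LINT y:ball x (c * r)|lborel. f y) =
      \<bar>c\<bar> ^ DIM('a) * (LINT y|lborel. indicator (ball x (c * r)) (x + c *\<^sub>R y) *\<^sub>R f (x + c *\<^sub>R y))"
    unfolding set_lebesgue_integral_def
    using assms(2) by (intro lborel_integral_affine) (measurable, auto)
  then show ?thesis
    using assms(2) by (simp add: set_lebesgue_integral_def ind)
qed

lemma set_integral_ball_odd: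
  fixes f :: "'a::euclidean_space \<Rightarrow> real"
  assumes [measurable]: "f \<in> borel_measurable borel" and odd: "\<And>y. f (- y) = - f y"
  shows "(LINT y:ball 0 r|lborel. f y) = 0"
proof -
  have ind: "indicator (ball 0 r) (- y) = (indicator (ball 0 r) y :: real)" for y :: 'a
    by (simp add: indicator_def)
  have "(LINT y:ball 0 r|lborel. f y) =
      \<bar>-1\<bar> ^ DIM('a) * (LINT y|lborel. indicator (ball 0 r) (0 + (-1) *\<^sub>R y) *\<^sub>R f (0 + (-1) *\<^sub>R y))"
    unfolding set_lebesgue_integral_def
    by (intro lborel_integral_affine) (measurable, auto)
  also have "\<dots> = - (LINT y:ball 0 r|lborel. f y)"
    by (simp add: set_lebesgue_integral_def ind odd)
  finally show ?thesis by simp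
qed

lemma measure_ball_scale:
  fixes x :: "'a::euclidean_space"
  assumes "r > 0"
  shows "measure lborel (ball x r) = r ^ DIM('a) * measure lborel (ball (0::'a) 1)"
  using set_integral_ball_affine[of "\<lambda>_. 1" r x 1] assms
  by (simp add: set_lebesgue_integral_def)

lemma measure_unit_ball_pos: "measure lborel (ball (0::'a::euclidean_space) 1) > 0"
  using content_ball_pos[of 1 "0::'a"] by simp

lemma sgn_borel_measurable: "(sgn :: 'a::euclidean_space \<Rightarrow> 'a) \<in> borel_measurable borel"
  by (simp add: sgn_div_norm[abs_def])

lemma set_integral_abs_bound:
  fixes f :: "'a::euclidean_space \<Rightarrow> real"
  assumes "set_integrable lborel S f" "S \<in> sets lborel" "emeasure lborel S < \<infinity>"
    and "\<And>y. y \<in> S \<Longrightarrow> \<bar>f y\<bar> \<le> C"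
  shows "\<bar>LINT y:S|lborel. f y\<bar> \<le> C * measure lborel S"
proof -
  have C: "integrable lborel (\<lambda>y. indicat_real S y * C)"
    using assms by (intro integrable_mult_left integrable_real_indicator) auto
  have "\<bar>LINT y:S|lborel. f y\<bar> \<le> (LINT y|lborel. \<bar>indicator S y *\<^sub>R f y\<bar>)"
    unfolding set_lebesgue_integral_def by (rule integral_abs_bound)
  also have "\<dots> \<le> (LINT y|lborel. indicat_real S y * C)"
    using assms(1,4) C by (intro integral_mono integrable_abs) (auto simp: set_integrable_def indicator_def)
  also have "\<dots> = C * measure lborel S"
    using assms(2,3) by simp
  finally show ?thesis .
qed

text \<open>
  The surface integral is written as an integral over the unit ball of the values of \<open>u\<close> at radial
  projections, which is how the surface measure is built from cones. On a thin shell \<open>u\<close> differs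
  little from the function that is constant along rays with the same values on the sphere, and the
  integral of such a function over a ball is a multiple of the \<open>m\<close>-th power of the radius.
\<close>

lemma has_derivative_ball_integral:
  fixes u :: "'a::euclidean_space \<Rightarrow> real"
  assumes u: "continuous_on UNIV u" and r: "r > 0"
  shows "((\<lambda>r. LINT y:ball x r|lborel. u y) has_real_derivative
      real DIM('a) * r ^ (DIM('a) - 1) * (LINT y:ball 0 1|lborel. u (x + r *\<^sub>R sgn y))) (at r)"
proof -
  define m where "m = DIM('a)"
  define V where "V r = (LINT y:ball x r|lborel. u y)" for r
  define S where "S = (LINT y:ball 0 1|lborel. u (x + r *\<^sub>R sgn y))"
  define \<omega> where "\<omega> = measure lborel (ball (0::'a) 1)"
  define w where "w y = u (x + r *\<^sub>R sgn (y - x))" for y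
  have w0: "w (x + y) = u (x + r *\<^sub>R sgn y)" for y by (simp add: w_def)
  have um [measurable]: "u \<in> borel_measurable borel"
    using u by (rule borel_measurable_continuous_onI)
  note sgn_borel_measurable[measurable]
  have wm [measurable]: "w \<in> borel_measurable borel"
    unfolding w_def by measurable
  have "compact (u ` cball x r)"
    using u by (intro compact_continuous_image) (auto intro: continuous_on_subset)
  then obtain C where C: "\<And>y. y \<in> cball x r \<Longrightarrow> \<bar>u y\<bar> \<le> C"
    by (force dest!: compact_imp_bounded simp: bounded_iff)
  have wC: "\<bar>w y\<bar> \<le> C" for y
    using C[of "x + r *\<^sub>R sgn (y - x)"] r by (auto simp: w_def dist_norm norm_sgn)
  have wint: "set_integrable lborel (ball x t) w" for t
    unfolding set_integrable_def
    by (rule integrableI_bounded_set_indicator[where B = C])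
       (use emeasure_lborel_ball_finite[of x t] in \<open>auto simp: wC less_top\<close>)
  have uint: "set_integrable lborel (ball x t) u" for t
    using u by (rule set_integrable_ball_continuous)
  have wscale: "(LINT y:ball x t|lborel. w y) = t ^ m * S" if "t > 0" for t
    using set_integral_ball_affine[of w t x 1] that
    by (simp add: m_def S_def w0 sgn_scaleR)
  have shell: "\<bar>V b - V a - (b ^ m - a ^ m) * S\<bar> \<le> e * (\<omega> * (b ^ m - a ^ m))"
    if "0 < a" "a \<le> b" and e: "\<And>y. y \<in> ball x b - ball x a \<Longrightarrow> \<bar>u y - w y\<bar> \<le> e" for a b e
  proof -
    have sub: "ball x a \<subseteq> ball x b" using that by auto
    have diff: "(LINT y:ball x b|lborel. f y) - (LINT y:ball x a|lborel. f y) =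
        (LINT y:ball x b - ball x a|lborel. f y)" if "\<And>t. set_integrable lborel (ball x t) f" for f :: "'a \<Rightarrow> real"
      using set_integral_Un[of "ball x a" "ball x b - ball x a" lborel f] sub
        set_integrable_subset[OF that[of b], of "ball x b - ball x a"] that[of a]
      by (simp add: Un_absorb1 Un_Diff_cancel)
    have int: "set_integrable lborel (ball x b - ball x a) u" "set_integrable lborel (ball x b - ball x a) w"
      using set_integrable_subset[OF uint[of b], of "ball x b - ball x a"]
        set_integrable_subset[OF wint[of b], of "ball x b - ball x a"] by auto
    have "V b - V a - (b ^ m - a ^ m) * S = (LINT y:ball x b - ball x a|lborel. u y - w y)"
      using diff[of u] diff[of w] wscale[of a] wscale[of b] uint wint that int
      by (simp add: V_def algebra_simps)
    moreover have "\<bar>LINT y:ball x b - ball x a|lborel. u y - w y\<bar> \<le> e * measure lborel (ball x b - ball x a)"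
      using int e emeasure_mono[of "ball x b - ball x a" "ball x b" lborel] emeasure_lborel_ball_finite[of x b]
      by (intro set_integral_abs_bound set_integral_diff) (auto simp: order_le_less_trans)
    moreover have "measure lborel (ball x b - ball x a) = \<omega> * (b ^ m - a ^ m)"
      using measure_Diff[of lborel "ball x b" "ball x a"] sub measure_ball_scale[of a x] measure_ball_scale[of b x] that
        emeasure_lborel_ball_finite[of x b] emeasure_lborel_ball_finite[of x a]
      by (simp add: \<omega>_def m_def algebra_simps less_top)
    ultimately show ?thesis by simp
  qed
  have pder: "((\<lambda>t. t ^ m) has_real_derivative real m * r ^ (m - 1)) (at r)"
    by (auto intro!: derivative_eq_intros)
  have \<omega>: "\<omega> > 0" unfolding \<omega>_def by (rule measure_unit_ball_pos)
  have "((\<lambda>t. V t - t ^ m * S) has_real_derivative 0) (at r)"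
    unfolding has_field_derivative_def has_derivative_at_alt
  proof (intro conjI allI impI)
    show "bounded_linear (\<lambda>x. 0 * x :: real)" by simp
    fix e :: real assume e: "e > 0"
    define L where "L = real m * r ^ (m - 1) + 1"
    have L: "L > 0" using r by (simp add: L_def add_nonneg_pos)
    from pder have "\<forall>e>0. \<exists>d>0. \<forall>t. norm (t - r) < d \<longrightarrow> norm (t ^ m - r ^ m - real m * r ^ (m - 1) * (t - r)) \<le> e * norm (t - r)"
      unfolding has_field_derivative_def has_derivative_at_alt by blast
    from this[rule_format, of 1]
    have "\<exists>d>0. \<forall>t. norm (t - r) < d \<longrightarrow> norm (t ^ m - r ^ m - real m * r ^ (m - 1) * (t - r)) \<le> 1 * norm (t - r)"
      by simp
    then obtain d1 where d1: "d1 > 0" "\<And>t. \<bar>t - r\<bar> < d1 \<Longrightarrow> \<bar>t ^ m - r ^ m - real m * r ^ (m - 1) * (t - r)\<bar> \<le> \<bar>t - r\<bar>"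
      by auto
    have L1: "\<bar>t ^ m - r ^ m\<bar> \<le> L * \<bar>t - r\<bar>" if "\<bar>t - r\<bar> < d1" for t
    proof -
      have "\<bar>t ^ m - r ^ m\<bar> \<le> \<bar>t - r\<bar> + \<bar>real m * r ^ (m - 1) * (t - r)\<bar>" using d1(2)[OF that] by linarith
      also have "\<dots> = L * \<bar>t - r\<bar>" using r by (simp add: L_def abs_mult distrib_right)
      finally show ?thesis .
    qed
    define e' where "e' = e / (\<omega> * L)"
    have e': "e' > 0" using e \<omega> L by (simp add: e'_def)
    have "uniformly_continuous_on (cball x (2 * r)) u"
      using u by (intro compact_uniformly_continuous) (auto intro: continuous_on_subset)
    then obtain d2 where d2: "d2 > 0" "\<And>y z. y \<in> cball x (2 * r) \<Longrightarrow> z \<in> cball x (2 * r) \<Longrightarrow> dist z y < d2 \<Longrightarrow> dist (u z) (u y) < e'"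
      unfolding uniformly_continuous_on_def using e' by metis
    define d where "d = min (min d1 d2) (r / 2)"
    have d: "d > 0" using d1 d2 r by (simp add: d_def)
    have "norm (V t - t ^ m * S - (V r - r ^ m * S) - 0 * (t - r)) \<le> e * norm (t - r)" if t: "norm (t - r) < d" for t
    proof -
      have tr: "\<bar>t - r\<bar> < d" "\<bar>t - r\<bar> < d1" "\<bar>t - r\<bar> < d2" "t > r / 2" "t < 2 * r" using t r unfolding d_def by (simp_all add: abs_if split: if_splits)
      have close: "\<bar>u y - w y\<bar> \<le> e'" if y: "\<bar>dist x y - r\<bar> \<le> \<bar>t - r\<bar>" for y
      proof -
        have ydist: "0 < dist x y" "dist x y < 2 * r" using y tr by linarith+
        then have nz: "norm (y - x) > 0" by (simp add: dist_norm norm_minus_commute)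
        have "dist (x + r *\<^sub>R sgn (y - x)) y = norm ((r / norm (y - x)) *\<^sub>R (y - x) - (y - x))"
          by (simp add: dist_norm sgn_div_norm algebra_simps divide_inverse)
        also have "\<dots> = norm ((r / norm (y - x) - 1) *\<^sub>R (y - x))" by (simp add: algebra_simps)
        also have "\<dots> = \<bar>(r / norm (y - x) - 1) * norm (y - x)\<bar>" by (simp add: abs_mult)
        also have "(r / norm (y - x) - 1) * norm (y - x) = r - dist x y"
          using nz by (simp add: field_simps dist_norm norm_minus_commute)
        finally have "dist (x + r *\<^sub>R sgn (y - x)) y < d2" using y tr by linarith
        moreover have "x + r *\<^sub>R sgn (y - x) \<in> cball x (2 * r)" using r by (auto simp: dist_norm norm_sgn)
        ultimately show ?thesis using d2(2)[of y "x + r *\<^sub>R sgn (y - x)"] ydist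
          by (auto simp: w_def dist_real_def abs_minus_commute)
      qed
      have "\<bar>V t - V r - (t ^ m - r ^ m) * S\<bar> \<le> e' * (\<omega> * \<bar>t ^ m - r ^ m\<bar>)"
      proof (cases "r \<le> t")
        case True
        then have "r ^ m \<le> t ^ m" using r by (intro power_mono) auto
        then show ?thesis using shell[of r t e'] close True r by simp
      next
        case False
        then have "t ^ m \<le> r ^ m" using tr r by (intro power_mono) auto
        moreover have "\<bar>V r - V t - (r ^ m - t ^ m) * S\<bar> \<le> e' * (\<omega> * (r ^ m - t ^ m))"
          using False tr r by (intro shell close) auto
        moreover have "\<bar>V t - V r - (t ^ m - r ^ m) * S\<bar> = \<bar>V r - V t - (r ^ m - t ^ m) * S\<bar>"
          by (subst abs_minus_cancel[symmetric], rule arg_cong[where f = abs]) (simp add: algebra_simps)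
        moreover have "\<bar>t ^ m - r ^ m\<bar> = r ^ m - t ^ m"
          using calculation(1) by simp
        ultimately show ?thesis by metis
      qed
      also have "\<dots> \<le> e' * (\<omega> * (L * \<bar>t - r\<bar>))"
        using L1[OF tr(2)] e' \<omega> by (intro mult_left_mono) auto
      also have "\<dots> = e * \<bar>t - r\<bar>" using \<omega> L by (simp add: e'_def)
      finally have "\<bar>V t - V r - (t ^ m - r ^ m) * S\<bar> \<le> e * \<bar>t - r\<bar>" .
      moreover have "V t - t ^ m * S - (V r - r ^ m * S) - 0 * (t - r) = V t - V r - (t ^ m - r ^ m) * S"
        by (simp add: left_diff_distrib)
      ultimately show ?thesis by (simp only: real_norm_def)
    qed
    with d show "\<exists>d>0. \<forall>t. norm (t - r) < d \<longrightarrow> norm (V t - t ^ m * S - (V r - r ^ m * S) - 0 * (t - r)) \<le> e * norm (t - r)"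
      by blast
  qed
  from DERIV_add[OF this DERIV_cmult_right[OF pder, of S]]
  have "(V has_real_derivative real m * r ^ (m - 1) * S) (at r)" by simp
  then show ?thesis unfolding V_def S_def m_def .
qed

section \<open>Second moments of the unit ball\<close>

lemma set_integral_ball_isometry:
  fixes f :: "'a::euclidean_space \<Rightarrow> real"
  assumes [measurable]: "f \<in> borel_measurable borel" "T \<in> borel_measurable borel"
    and T: "distr lborel borel T = lborel" "\<And>y. norm (T y) = norm y"
  shows "(LINT y:ball 0 r|lborel. f (T y)) = (LINT y:ball 0 r|lborel. f y)"
proof -
  have "(LINT y:ball 0 r|lborel. f y) = (LINT y:ball 0 r|distr lborel borel T. f y)"
    by (simp add: T)
  also have "\<dots> = (LINT y|lborel. indicator (ball 0 r) (T y) *\<^sub>R f (T y))"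
    unfolding set_lebesgue_integral_def by (intro integral_distr) (measurable, auto)
  also have "\<dots> = (LINT y:ball 0 r|lborel. f (T y))"
    unfolding set_lebesgue_integral_def using T(2)
    by (intro Bochner_Integration.integral_cong) (auto simp: indicator_def)
  finally show ?thesis by simp
qed

text \<open>
  Exchanging two coordinates maps boxes to boxes of the same volume.
\<close>

lemma distr_lborel_swap:
  fixes i j :: "'a::euclidean_space"
  assumes "i \<in> Basis" "j \<in> Basis"
  shows "distr lborel borel (\<lambda>y. y + (y \<bullet> j - y \<bullet> i) *\<^sub>R (i - j)) = lborel"
proof -
  define T :: "'a \<Rightarrow> 'a" where "T y = y + (y \<bullet> j - y \<bullet> i) *\<^sub>R (i - j)" for y
  have Tb: "T y \<bullet> b = y \<bullet> Transposition.transpose i j b" if "b \<in> Basis" for y b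
    using assms that by (auto simp: T_def inner_simps inner_Basis Transposition.transpose_def)
  have trB: "Transposition.transpose i j b \<in> Basis" if "b \<in> Basis" for b
    using assms that by (auto simp: Transposition.transpose_def)
  have bij: "bij_betw (Transposition.transpose i j) Basis Basis"
    by (rule bij_betw_byWitness[where f' = "Transposition.transpose i j"]) (auto simp: trB)
  have [measurable]: "T \<in> borel_measurable borel"
    unfolding T_def by measurable
  have vim: "T -` box l u = box (T l) (T u)" for l u
  proof -
    have "(\<forall>b\<in>Basis. l \<bullet> b < y \<bullet> Transposition.transpose i j b \<and> y \<bullet> Transposition.transpose i j b < u \<bullet> b) \<longleftrightarrow>
        (\<forall>b\<in>Basis. l \<bullet> Transposition.transpose i j b < y \<bullet> b \<and> y \<bullet> b < u \<bullet> Transposition.transpose i j b)" for y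
      using trB by (metis transpose_involutory)
    then show ?thesis by (auto simp: box_def Tb)
  qed
  have "lborel = distr lborel borel T"
  proof (rule lborel_eqI)
    fix l u :: 'a
    assume le: "\<And>b. b \<in> Basis \<Longrightarrow> l \<bullet> b \<le> u \<bullet> b"
    have "emeasure (distr lborel borel T) (box l u) = emeasure lborel (box (T l) (T u))"
      by (simp add: emeasure_distr vim)
    also have "\<dots> = (\<Prod>b\<in>Basis. (T u - T l) \<bullet> b)"
      using le trB by (intro emeasure_lborel_box) (auto simp: Tb)
    also have "(\<Prod>b\<in>Basis. (T u - T l) \<bullet> b) = (\<Prod>b\<in>Basis. (u - l) \<bullet> Transposition.transpose i j b)"
      by (intro prod.cong) (auto simp: inner_diff_left Tb)
    also have "\<dots> = (\<Prod>b\<in>Basis. (u - l) \<bullet> b)"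
      using prod.reindex_bij_betw[OF bij, of "\<lambda>b. (u - l) \<bullet> b"] by simp
    finally show "emeasure (distr lborel borel T) (box l u) = ennreal (\<Prod>b\<in>Basis. (u - l) \<bullet> b)" .
  qed simp
  then show ?thesis by (simp add: T_def[abs_def])
qed

lemma distr_lborel_reflect:
  fixes i :: "'a::euclidean_space"
  assumes "i \<in> Basis"
  shows "distr lborel borel (\<lambda>y. y - (2 * (y \<bullet> i)) *\<^sub>R i) = lborel"
proof -
  define c where "c b = (if b = i then -1 else 1 :: real)" for b
  have "0 + (\<Sum>b\<in>Basis. (c b * (y \<bullet> b)) *\<^sub>R b) = y - (2 * (y \<bullet> i)) *\<^sub>R i" for y
  proof -
    have "(\<Sum>b\<in>Basis. (c b * (y \<bullet> b)) *\<^sub>R b) =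
        (\<Sum>b\<in>Basis. (y \<bullet> b) *\<^sub>R b - (if b = i then (2 * (y \<bullet> i)) *\<^sub>R i else 0))"
      by (intro sum.cong) (auto simp: c_def algebra_simps scaleR_2 simp flip: scaleR_scaleR)
    then show ?thesis using assms by (simp add: sum_subtractf euclidean_representation)
  qed
  moreover have "(\<Prod>b\<in>Basis. \<bar>c b\<bar>) = 1" by (intro prod.neutral) (simp add: c_def)
  ultimately show ?thesis
    using lborel_affine_euclidean[of c 0] by (simp add: c_def density_1)
qed

text \<open>
  Differentiate the integral over the ball of radius \<open>r\<close> at \<open>r = 1\<close> in two ways: by homogeneity, and
  as a surface integral, where the integrand equals one.
\<close>

lemma integral_ball_norm_square:
  "(LINT y:ball (0::'a::euclidean_space) 1|lborel. (norm y)\<^sup>2) =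
    real DIM('a) * measure lborel (ball (0::'a) 1) / (real DIM('a) + 2)"
proof -
  define m where "m = DIM('a)"
  define K where "K = (LINT y:ball (0::'a) 1|lborel. (norm y)\<^sup>2)"
  have scale: "(LINT y:ball (0::'a) r|lborel. (norm y)\<^sup>2) = r ^ (m + 2) * K" if "r > 0" for r
    using set_integral_ball_affine[of "\<lambda>y::'a. (norm y)\<^sup>2" r 0 1] that
    by (simp add: m_def K_def power_mult_distrib power_add mult.assoc) (simp add: power2_eq_square)
  have "((\<lambda>r. LINT y:ball (0::'a) r|lborel. (norm y)\<^sup>2) has_real_derivative
      real m * 1 ^ (m - 1) * (LINT y:ball (0::'a) 1|lborel. (norm (0 + 1 *\<^sub>R sgn y))\<^sup>2)) (at 1)"
    unfolding m_def by (intro has_derivative_ball_integral continuous_intros) auto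
  moreover have "(LINT y:ball (0::'a) 1|lborel. (norm (0 + 1 *\<^sub>R sgn y))\<^sup>2) =
      (LINT y:ball (0::'a) 1|lborel. 1)"
    unfolding set_lebesgue_integral_def
  proof (rule integral_cong_AE)
    show "AE y in lborel. indicat_real (ball 0 1) y *\<^sub>R (norm (0 + 1 *\<^sub>R sgn y :: 'a))\<^sup>2 = indicat_real (ball 0 1) y *\<^sub>R 1"
      using AE_lborel_singleton[of "0::'a"] by eventually_elim (simp add: norm_sgn)
  qed (use sgn_borel_measurable[measurable] in \<open>measurable; simp\<close>)+
  ultimately have "((\<lambda>r. LINT y:ball (0::'a) r|lborel. (norm y)\<^sup>2) has_real_derivative
      real m * measure lborel (ball (0::'a) 1)) (at 1)"
    by (simp add: set_lebesgue_integral_def)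
  then have "((\<lambda>r. r ^ (m + 2) * K) has_real_derivative real m * measure lborel (ball (0::'a) 1)) (at 1)"
    by (rule has_field_derivative_transform_within_open[where S = "{0<..}"]) (auto simp: scale)
  moreover have "((\<lambda>r. r ^ (m + 2) * K) has_real_derivative real (m + 2) * K) (at 1)"
    by (auto intro!: derivative_eq_intros)
  ultimately have "real m * measure lborel (ball (0::'a) 1) = real (m + 2) * K"
    by (rule DERIV_unique)
  then show ?thesis by (simp add: K_def m_def field_simps)
qed

lemma set_integral_sum:
  fixes f :: "'i \<Rightarrow> 'a \<Rightarrow> real"
  assumes "\<And>i. i \<in> I \<Longrightarrow> set_integrable M S (f i)"
  shows "(LINT x:S|M. (\<Sum>i\<in>I. f i x)) = (\<Sum>i\<in>I. LINT x:S|M. f i x)"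
  using assms unfolding set_integrable_def set_lebesgue_integral_def
  by (simp add: scaleR_sum_right sum_distrib_left Bochner_Integration.integral_sum)

text \<open>
  By symmetry the second moment matrix of the ball is a multiple of the identity: reflections kill the
  off-diagonal entries and swaps make the diagonal ones equal. The trace is known.
\<close>

lemma integral_ball_inner_square:
  fixes e :: "'a::euclidean_space"
  shows "(LINT y:ball 0 1|lborel. (e \<bullet> y)\<^sup>2) =
    (norm e)\<^sup>2 * measure lborel (ball (0::'a) 1) / (real DIM('a) + 2)"
proof -
  define q where "q i j = (LINT y:ball (0::'a) 1|lborel. (y \<bullet> i) * (y \<bullet> j))" for i j
  have int: "set_integrable lborel (ball (0::'a) 1) (\<lambda>y. (y \<bullet> i) * (y \<bullet> j))" for i j
    by (intro set_integrable_ball_continuous continuous_intros)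
  have offdiag: "q i j = 0" if "i \<in> Basis" "j \<in> Basis" "i \<noteq> j" for i j
  proof -
    have "norm (y - (2 * (y \<bullet> i)) *\<^sub>R i) = norm y" for y
      using that by (simp add: norm_eq inner_simps power2_eq_square algebra_simps inner_commute)
    then have "q i j = (LINT y:ball (0::'a) 1|lborel. ((y - (2 * (y \<bullet> i)) *\<^sub>R i) \<bullet> i) * ((y - (2 * (y \<bullet> i)) *\<^sub>R i) \<bullet> j))"
      unfolding q_def
      by (intro set_integral_ball_isometry[symmetric, where T = "\<lambda>y. y - (2 * (y \<bullet> i)) *\<^sub>R i"]
          distr_lborel_reflect that) auto
    also have "\<dots> = (LINT y:ball (0::'a) 1|lborel. - ((y \<bullet> i) * (y \<bullet> j)))"
      using that by (simp add: inner_simps inner_Basis)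
    also have "\<dots> = - q i j"
      unfolding q_def by (simp add: set_lebesgue_integral_def)
    finally show ?thesis by simp
  qed
  have diag: "q i i = q j j" if "i \<in> Basis" "j \<in> Basis" for i j
  proof -
    have "norm (y + (y \<bullet> j - y \<bullet> i) *\<^sub>R (i - j)) = norm y" for y
      using that by (cases "i = j") (auto simp: norm_eq inner_simps inner_Basis power2_eq_square algebra_simps inner_commute)
    then have "q i i = (LINT y:ball (0::'a) 1|lborel. ((y + (y \<bullet> j - y \<bullet> i) *\<^sub>R (i - j)) \<bullet> i) * ((y + (y \<bullet> j - y \<bullet> i) *\<^sub>R (i - j)) \<bullet> i))"
      unfolding q_def
      by (intro set_integral_ball_isometry[symmetric, where T = "\<lambda>y. y + (y \<bullet> j - y \<bullet> i) *\<^sub>R (i - j)"]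
          distr_lborel_swap that) auto
    also have "\<dots> = q j j"
      using that by (cases "i = j") (simp_all add: q_def inner_simps inner_Basis)
    finally show ?thesis .
  qed
  obtain i0 :: 'a where i0: "i0 \<in> Basis" using nonempty_Basis by blast
  have "(LINT y:ball (0::'a) 1|lborel. (norm y)\<^sup>2) = (\<Sum>i\<in>Basis. q i i)"
    unfolding q_def using int
    by (simp add: power2_norm_eq_inner euclidean_inner[of y y for y] set_integral_sum)
  also have "\<dots> = real DIM('a) * q i0 i0"
    using diag[OF _ i0] by simp
  finally have "real DIM('a) * q i0 i0 = real DIM('a) * (measure lborel (ball (0::'a) 1) / (real DIM('a) + 2))"
    by (simp add: integral_ball_norm_square)
  then have q0: "q i0 i0 = measure lborel (ball (0::'a) 1) / (real DIM('a) + 2)"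
    by (simp only: mult_cancel_left) simp
  have "(e \<bullet> y)\<^sup>2 = (\<Sum>i\<in>Basis. \<Sum>j\<in>Basis. (e \<bullet> i) * (e \<bullet> j) * ((y \<bullet> i) * (y \<bullet> j)))" for y
    unfolding power2_eq_square
    by (subst (1 2) euclidean_inner) (simp add: sum_product algebra_simps)
  moreover have "set_integrable lborel (ball (0::'a) 1) (\<lambda>y. \<Sum>j\<in>Basis. (e \<bullet> i) * (e \<bullet> j) * ((y \<bullet> i) * (y \<bullet> j)))" for i
    by (intro set_integrable_ball_continuous continuous_intros)
  ultimately have "(LINT y:ball (0::'a) 1|lborel. (e \<bullet> y)\<^sup>2) = (\<Sum>i\<in>Basis. \<Sum>j\<in>Basis. (e \<bullet> i) * (e \<bullet> j) * q i j)"
    using int by (simp add: set_integral_sum set_integrable_mult_right q_def)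
  also have "\<dots> = (\<Sum>i\<in>Basis. \<Sum>j\<in>Basis. if j = i then (e \<bullet> i)\<^sup>2 * q i0 i0 else 0)"
    using offdiag diag[OF _ i0] by (intro sum.cong) (auto simp: power2_eq_square)
  also have "\<dots> = (norm e)\<^sup>2 * q i0 i0"
    unfolding power2_norm_eq_inner euclidean_inner[of e e]
    by (simp add: power2_eq_square sum_distrib_right)
  finally show ?thesis by (simp add: q0)
qed

section \<open>The normalized Bessel series\<close>

text \<open>
  The function \<open>I\<^sub>\<nu>(t) / (t/2)\<^sup>\<nu>\<close> in the variable \<open>q = (t/2)\<^sup>2\<close>, in which it is a power series and
  differentiation raises the order by one.
\<close>

definition bessel_series :: "real \<Rightarrow> real \<Rightarrow> real" where
  "bessel_series \<nu> q = (\<Sum>k. inverse (fact k * Gamma (\<nu> + real k + 1)) * q ^ k)"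

lemma bessel_I_entire_eq_series: "bessel_I_entire \<nu> t = bessel_series \<nu> ((t / 2)\<^sup>2)"
  unfolding bessel_I_entire_def bessel_series_def power_mult divide_inverse_commute[of "_ ^ _"] ..

lemma summable_bessel_series:
  assumes "\<nu> > -1"
  shows "summable (\<lambda>k. inverse (fact k * Gamma (\<nu> + real k + 1)) * q ^ k)"
proof (rule summable_norm_cancel)
  have "norm (inverse (fact k * Gamma (\<nu> + real k + 1)) * q ^ k) =
      (2 * sqrt \<bar>q\<bar> / 2) ^ (2 * k) / (fact k * Gamma (\<nu> + real k + 1))" for k
    using assms unfolding power_mult divide_inverse_commute[of "_ ^ _"]
    by (simp add: abs_mult power_abs)
  then show "summable (\<lambda>k. norm (inverse (fact k * Gamma (\<nu> + real k + 1)) * q ^ k))"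
    using summable_bessel_I_entire[OF assms, of "2 * sqrt \<bar>q\<bar>"] by simp
qed

lemma has_derivative_bessel_series:
  assumes "\<nu> > -1"
  shows "(bessel_series \<nu> has_real_derivative bessel_series (\<nu> + 1) q) (at q)"
proof -
  define c where "c k = inverse (fact k * Gamma (\<nu> + real k + 1))" for k
  have "diffs c k = inverse (fact k * Gamma (\<nu> + 1 + real k + 1))" for k
    by (simp add: diffs_def c_def add_ac)
  then show ?thesis
    using termdiffs_strong_converges_everywhere[of c q] summable_bessel_series[OF assms]
    by (simp add: bessel_series_def[abs_def] c_def)
qed

text \<open>
  The recurrence \<open>I\<^sub>\<nu>\<^sub>-\<^sub>1 - I\<^sub>\<nu>\<^sub>+\<^sub>1 = (2\<nu>/t) I\<^sub>\<nu>\<close> of the modified Bessel functions, in the variable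
  \<open>q = (t/2)\<^sup>2\<close>.
\<close>

lemma bessel_series_recurrence:
  assumes "\<nu> > 0"
  shows "bessel_series (\<nu> - 1) q = \<nu> * bessel_series \<nu> q + q * bessel_series (\<nu> + 1) q"
proof -
  define c where "c k = inverse (fact k * Gamma (\<nu> + real k + 1))" for k
  have G: "inverse (fact k * Gamma (\<nu> - 1 + real k + 1)) = (\<nu> + real k) * c k" for k
  proof -
    have "Gamma (\<nu> + real k + 1) = (\<nu> + real k) * Gamma (\<nu> + real k)"
      using assms by (intro Gamma_plus1) (simp add: nonpos_Ints_def)
    then show ?thesis
      using assms by (simp add: c_def)
  qed
  have s: "summable (\<lambda>k. c k * q ^ k)"
    using summable_bessel_series[of \<nu> q] assms by (simp add: c_def)
  have cS: "inverse (fact k * Gamma (\<nu> + 1 + real k + 1)) = c (Suc k) * real (Suc k)" for k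
    by (simp add: c_def add_ac)
  have s1: "summable (\<lambda>k. c (Suc k) * real (Suc k) * q ^ k)"
    using summable_bessel_series[of "\<nu> + 1" q] assms unfolding cS by simp
  have e1: "bessel_series (\<nu> + 1) q = (\<Sum>k. c (Suc k) * real (Suc k) * q ^ k)"
    unfolding bessel_series_def cS ..
  have "(\<lambda>k. q * (c (Suc k) * real (Suc k) * q ^ k)) sums (q * bessel_series (\<nu> + 1) q)"
    unfolding e1 using s1 by (intro sums_mult summable_sums)
  then have "(\<lambda>k. real (Suc k) * c (Suc k) * q ^ Suc k) sums (q * bessel_series (\<nu> + 1) q)"
    by (simp add: mult_ac)
  then have "(\<lambda>k. real k * c k * q ^ k) sums (q * bessel_series (\<nu> + 1) q)"
    by (subst (asm) sums_Suc_iff) simp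
  moreover have "(\<lambda>k. \<nu> * (c k * q ^ k)) sums (\<nu> * bessel_series \<nu> q)"
    using summable_sums[OF s] unfolding bessel_series_def c_def by (rule sums_mult)
  ultimately have "(\<lambda>k. \<nu> * (c k * q ^ k) + real k * c k * q ^ k) sums
      (\<nu> * bessel_series \<nu> q + q * bessel_series (\<nu> + 1) q)"
    by (intro sums_add)
  then show ?thesis
    unfolding bessel_series_def G by (simp add: sums_iff algebra_simps)
qed

text \<open>
  The analogue, for the two coefficients, of the fact that the derivative of a ball integral is the
  sphere integral. Both sides reduce to the recurrence with \<open>\<nu> = m/2\<close>.
\<close>

lemma has_derivative_power_a_volume:
  assumes "m \<ge> 1" "r > 0"
  shows "((\<lambda>r. r ^ m * a_volume m (\<mu> * r)) has_real_derivative
    real m * r ^ (m - 1) * a_spherical m (\<mu> * r)) (at r)"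
proof -
  define \<nu> where "\<nu> = real m / 2"
  have \<nu>: "\<nu> > 0" "real m = 2 * \<nu>" using assms by (auto simp: \<nu>_def)
  define q where "q = (\<mu> * r / 2)\<^sup>2"
  have G: "Gamma (\<nu> + 1) = \<nu> * Gamma \<nu>"
    using \<nu> by (intro Gamma_plus1) (auto simp: nonpos_Ints_def)
  have "((\<lambda>r. bessel_series \<nu> ((\<mu> * r / 2)\<^sup>2)) has_real_derivative
      bessel_series (\<nu> + 1) q * (\<mu>\<^sup>2 * r / 2)) (at r)"
    unfolding q_def using \<nu>
    by (intro DERIV_chain2[OF has_derivative_bessel_series])
       (auto intro!: derivative_eq_intros simp: power2_eq_square)
  then have "((\<lambda>r. r ^ m * (Gamma (\<nu> + 1) * bessel_series \<nu> ((\<mu> * r / 2)\<^sup>2))) has_real_derivative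
      real m * r ^ (m - 1) * (Gamma (\<nu> + 1) * bessel_series \<nu> q) +
      r ^ m * (Gamma (\<nu> + 1) * (bessel_series (\<nu> + 1) q * (\<mu>\<^sup>2 * r / 2)))) (at r)"
    unfolding q_def by (auto intro!: derivative_eq_intros)
  moreover have "real m * r ^ (m - 1) * (Gamma (\<nu> + 1) * bessel_series \<nu> q) +
      r ^ m * (Gamma (\<nu> + 1) * (bessel_series (\<nu> + 1) q * (\<mu>\<^sup>2 * r / 2))) =
      real m * r ^ (m - 1) * (Gamma \<nu> * bessel_series (\<nu> - 1) q)"
  proof -
    have "r ^ m = r * r ^ (m - 1)" using assms by (simp add: power_eq_if)
    then show ?thesis
      unfolding bessel_series_recurrence[OF \<nu>(1)] G \<nu>(2) q_def
      by (simp add: power2_eq_square algebra_simps)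
  qed
  moreover have idx: "(real m - 2) / 2 = \<nu> - 1" by (simp add: \<nu>_def field_simps)
  ultimately show ?thesis
    unfolding a_volume_def a_spherical_def bessel_I_entire_eq_series idx
    by (simp only: \<nu>_def[symmetric] q_def[symmetric])
qed

lemma a_volume_pos: "a_volume m t > 0"
proof -
  have "bessel_series (real m / 2) ((t / 2)\<^sup>2) > 0"
    unfolding bessel_series_def
  proof (rule suminf_pos2[where i = 0])
    show "summable (\<lambda>k. inverse (fact k * Gamma (real m / 2 + real k + 1)) * ((t / 2)\<^sup>2) ^ k)"
      by (rule summable_bessel_series) (rule less_le_trans[of _ 0]; simp)
  qed (simp_all add: less_imp_le[OF Gamma_real_pos] Gamma_real_pos add_nonneg_pos)
  then show ?thesis
    by (simp add: a_volume_def bessel_I_entire_eq_series Gamma_real_pos add_nonneg_pos)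
qed

text \<open>
  This constant decides that the equation is the one with \<open>\<mu>\<^sup>2\<close>: for a \<open>C\<^sup>2\<close> function the same quotient
  of ball means tends to the Laplacian divided by \<open>2(m + 2)\<close>.
\<close>

lemma a_volume_second_order:
  assumes "m \<ge> 1"
  shows "((\<lambda>r. (a_volume m (\<mu> * r) - 1) / r\<^sup>2) \<longlongrightarrow> \<mu>\<^sup>2 / (2 * (real m + 2))) (at_right 0)"
proof (cases "\<mu> = 0")
  case True
  then show ?thesis by (simp add: a_volume_0)
next
  case False
  define \<nu> where "\<nu> = real m / 2"
  have \<nu>: "\<nu> > 0" "real m = 2 * \<nu>" using assms by (auto simp: \<nu>_def)
  have G: "Gamma (\<nu> + 2) = (\<nu> + 1) * Gamma (\<nu> + 1)" "Gamma (\<nu> + 1) > 0"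
    using \<nu> Gamma_plus1[of "\<nu> + 1"] by (simp_all add: nonpos_Ints_def add_ac Gamma_real_pos)
  have z: "bessel_series \<nu> 0 = inverse (Gamma (\<nu> + 1))" for \<nu>
    unfolding bessel_series_def by (subst suminf_finite[of "{0}"]) auto
  have "((\<lambda>q. (bessel_series \<nu> q - bessel_series \<nu> 0) / (q - 0)) \<longlongrightarrow> bessel_series (\<nu> + 1) 0) (at 0)"
    using has_derivative_bessel_series[of \<nu> 0] \<nu> unfolding has_field_derivative_iff by simp
  moreover have "filterlim (\<lambda>r. (\<mu> * r / 2)\<^sup>2) (at 0) (at_right 0)"
    unfolding filterlim_at
  proof
    show "\<forall>\<^sub>F r in at_right 0. (\<mu> * r / 2)\<^sup>2 \<in> UNIV \<and> (\<mu> * r / 2)\<^sup>2 \<noteq> 0"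
      using False by (auto simp: eventually_at_filter)
    show "((\<lambda>r. (\<mu> * r / 2)\<^sup>2) \<longlongrightarrow> 0) (at_right 0)"
      by (auto intro!: tendsto_eq_intros)
  qed
  ultimately have "((\<lambda>r. (bessel_series \<nu> ((\<mu> * r / 2)\<^sup>2) - bessel_series \<nu> 0) / (\<mu> * r / 2)\<^sup>2)
      \<longlongrightarrow> bessel_series (\<nu> + 1) 0) (at_right 0)"
    by (auto dest: filterlim_compose)
  then have "((\<lambda>r. Gamma (\<nu> + 1) * \<mu>\<^sup>2 / 4 *
      ((bessel_series \<nu> ((\<mu> * r / 2)\<^sup>2) - bessel_series \<nu> 0) / (\<mu> * r / 2)\<^sup>2))
      \<longlongrightarrow> Gamma (\<nu> + 1) * \<mu>\<^sup>2 / 4 * bessel_series (\<nu> + 1) 0) (at_right 0)"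
    by (rule tendsto_mult_left)
  moreover have "Gamma (\<nu> + 1) * \<mu>\<^sup>2 / 4 * bessel_series (\<nu> + 1) 0 = \<mu>\<^sup>2 / (2 * (real m + 2))"
  proof -
    have "g * \<mu>\<^sup>2 / 4 * inverse ((\<nu> + 1) * g) = \<mu>\<^sup>2 / (2 * (2 * \<nu> + 2))" if "g > 0" for g
      using that \<nu>(1) by (simp add: divide_simps)
    from this[OF G(2)] show ?thesis
      by (simp only: z \<nu>(2) add.assoc one_add_one G(1))
  qed
  moreover have "Gamma (\<nu> + 1) * \<mu>\<^sup>2 / 4 *
      ((bessel_series \<nu> ((\<mu> * r / 2)\<^sup>2) - bessel_series \<nu> 0) / (\<mu> * r / 2)\<^sup>2) = (a_volume m (\<mu> * r) - 1) / r\<^sup>2" for r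
  proof -
    have "g * \<mu>\<^sup>2 / 4 * ((b - inverse g) / (\<mu> * r / 2)\<^sup>2) = (g * b - 1) / r\<^sup>2" if "g > 0" for g b
      using that False by (cases "r = 0") (auto simp: power_mult_distrib power_divide divide_simps algebra_simps)
    from this[OF G(2)] show ?thesis
      unfolding a_volume_def bessel_I_entire_eq_series z by (simp only: \<nu>_def[symmetric])
  qed
  ultimately show ?thesis by (simp only:)
qed

section \<open>From the quotient of the means to the volume mean\<close>

text \<open>
  The centre of the unit ball, which \<open>sgn\<close> does not send to the sphere, is a null set.
\<close>

lemma set_integral_sphere_measure:
  fixes f :: "'a::euclidean_space \<Rightarrow> real"
  assumes [measurable]: "f \<in> borel_measurable borel" and r: "r > 0"
  shows "(LINT y:sphere x r|sphere_measure x r. f y) =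
    real DIM('a) * r ^ (DIM('a) - 1) * (LINT y:ball 0 1|lborel. f (x + r *\<^sub>R sgn y))"
proof -
  define c where "c = real DIM('a) * r ^ (DIM('a) - 1)"
  have c: "c \<ge> 0" using r by (simp add: c_def)
  note sgn_borel_measurable[measurable]
  define g where "g y = x + r *\<^sub>R sgn y" for y :: 'a
  have [measurable]: "g \<in> borel_measurable borel" unfolding g_def by measurable
  define N where "N = distr (restrict_space lborel (ball (0::'a) 1)) borel g"
  have g': "g \<in> borel_measurable (restrict_space lborel (ball 0 1))"
    by (intro measurable_restrict_space1) simp
  define h where "h y = indicator (sphere x r) y *\<^sub>R f y" for y
  have hb: "h \<in> borel_measurable borel"
    unfolding h_def by (intro borel_measurable_scaleR borel_measurable_indicator) auto
  then have hN: "h \<in> borel_measurable N" by (simp add: N_def)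
  have "sphere_measure x r = density N (\<lambda>_. ennreal c)"
    unfolding sphere_measure_def N_def g_def[abs_def] c_def
    by (rule measure_eqI) (auto simp: emeasure_density_const)
  then have "(LINT y:sphere x r|sphere_measure x r. f y) = (LINT y|N. c *\<^sub>R h y)"
    using c hN by (simp only: set_lebesgue_integral_def h_def[symmetric]) (intro integral_density; simp)
  also have "\<dots> = (LINT y|restrict_space lborel (ball 0 1). c *\<^sub>R h (g y))"
    unfolding N_def using hb by (intro integral_distr g') simp
  also have "\<dots> = (LINT y|lborel. indicator (ball 0 1) y *\<^sub>R (c *\<^sub>R h (g y)))"
    by (rule integral_restrict_space) auto
  also have "\<dots> = (LINT y|lborel. c *\<^sub>R (indicator (ball 0 1) y *\<^sub>R f (g y)))"
  proof (rule integral_cong_AE)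
    show "AE y in lborel. indicat_real (ball 0 1) y *\<^sub>R c *\<^sub>R h (g y) =
        c *\<^sub>R indicat_real (ball 0 1) y *\<^sub>R f (g y)"
      using AE_lborel_singleton[of "0::'a"]
      by eventually_elim (use r in \<open>simp add: h_def g_def dist_norm norm_sgn indicator_def\<close>)
    note hb[measurable]
    show "(\<lambda>y. indicat_real (ball 0 1) y *\<^sub>R c *\<^sub>R h (g y)) \<in> borel_measurable lborel"
      by (measurable, auto)
    show "(\<lambda>y. c *\<^sub>R indicat_real (ball 0 1) y *\<^sub>R f (g y)) \<in> borel_measurable lborel"
      by (measurable, auto)
  qed
  also have "\<dots> = c * (LINT y:ball 0 1|lborel. f (x + r *\<^sub>R sgn y))"
    by (simp add: set_lebesgue_integral_def g_def)
  finally show ?thesis by (simp add: c_def)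
qed

lemma set_integrable_const_ball: "set_integrable lborel (ball (x::'a::euclidean_space) r) (\<lambda>_. c::real)"
  by (intro set_integrable_ball_continuous) auto

lemma tendsto_ball_average:
  fixes u :: "'a::euclidean_space \<Rightarrow> real"
  assumes u: "continuous_on UNIV u"
  shows "((\<lambda>r. (LINT y:ball x r|lborel. u y) / r ^ DIM('a)) \<longlongrightarrow>
    measure lborel (ball (0::'a) 1) * u x) (at_right 0)"
proof (rule tendstoI)
  fix e :: real assume e: "e > 0"
  define \<omega> where "\<omega> = measure lborel (ball (0::'a) 1)"
  have \<omega>: "\<omega> > 0" unfolding \<omega>_def by (rule measure_unit_ball_pos)
  have "isCont u x" using u by (simp add: continuous_on_eq_continuous_at)
  moreover have "e / (2 * \<omega>) > 0" using e \<omega> by simp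
  ultimately obtain d where d: "d > 0" "\<And>y. dist y x < d \<Longrightarrow> dist (u y) (u x) < e / (2 * \<omega>)"
    unfolding continuous_at_eps_delta by blast
  have "dist ((LINT y:ball x r|lborel. u y) / r ^ DIM('a)) (\<omega> * u x) < e" if r: "0 < r" "r < d" for r
  proof -
    have "\<bar>LINT y:ball x r|lborel. u y - u x\<bar> \<le> e / (2 * \<omega>) * measure lborel (ball x r)"
    proof (rule set_integral_abs_bound)
      show "set_integrable lborel (ball x r) (\<lambda>y. u y - u x)"
        using u by (intro set_integrable_ball_continuous continuous_intros)
      show "\<bar>u y - u x\<bar> \<le> e / (2 * \<omega>)" if "y \<in> ball x r" for y
        using d(2)[of y] that r by (simp add: dist_commute dist_real_def)
    qed (use emeasure_lborel_ball_finite[of x r] in auto)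
    moreover have "(LINT y:ball x r|lborel. u y - u x) =
        (LINT y:ball x r|lborel. u y) - \<omega> * r ^ DIM('a) * u x"
      using set_integrable_ball_continuous[OF u, of x r] set_integrable_const_ball[of x r "u x"]
        measure_ball_scale[OF r(1), of x] emeasure_lborel_ball_finite[of x r]
      by (simp add: set_integral_diff set_lebesgue_integral_def[of lborel "ball x r" "\<lambda>_. u x"] \<omega>_def less_top)
    ultimately have "\<bar>(LINT y:ball x r|lborel. u y) - \<omega> * r ^ DIM('a) * u x\<bar> \<le> e / 2 * r ^ DIM('a)"
      using \<omega> measure_ball_scale[OF r(1), of x] by (simp add: \<omega>_def mult.commute)
    then have "\<bar>(LINT y:ball x r|lborel. u y) - \<omega> * r ^ DIM('a) * u x\<bar> / r ^ DIM('a) \<le> e / 2"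
      using r by (simp add: divide_le_eq)
    moreover have "\<bar>(LINT y:ball x r|lborel. u y) - \<omega> * r ^ DIM('a) * u x\<bar> / r ^ DIM('a) =
        dist ((LINT y:ball x r|lborel. u y) / r ^ DIM('a)) (\<omega> * u x)"
    proof -
      have "\<bar>a - \<omega> * p * b\<bar> / p = \<bar>a / p - \<omega> * b\<bar>" if "p > 0" for a b p :: real
      proof -
        have "a / p - \<omega> * b = (a - \<omega> * p * b) / p" using that by (simp add: field_simps)
        then show ?thesis using that by simp
      qed
      from this[of "r ^ DIM('a)"] show ?thesis using r by (simp add: dist_real_def)
    qed
    ultimately show ?thesis using e by linarith
  qed
  then show "\<forall>\<^sub>F r in at_right 0. dist ((LINT y:ball x r|lborel. u y) / r ^ DIM('a))
      (measure lborel (ball (0::'a) 1) * u x) < e"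
    using d(1) unfolding eventually_at_right_field \<omega>_def by auto
qed

lemma a_volume_tendsto_1:
  assumes "m \<ge> 1"
  shows "((\<lambda>r. a_volume m (\<mu> * r)) \<longlongrightarrow> 1) (at_right 0)"
proof -
  have "((\<lambda>r. (a_volume m (\<mu> * r) - 1) / r\<^sup>2 * r\<^sup>2 + 1) \<longlongrightarrow> \<mu>\<^sup>2 / (2 * (real m + 2)) * 0\<^sup>2 + 1) (at_right 0)"
    using assms by (intro tendsto_intros a_volume_second_order)
  moreover have "\<forall>\<^sub>F r in at_right 0. (a_volume m (\<mu> * r) - 1) / r\<^sup>2 * r\<^sup>2 + 1 = a_volume m (\<mu> * r)"
    by (auto simp: eventually_at_filter)
  ultimately show ?thesis by (simp add: tendsto_cong)
qed

text \<open>
  Both \<open>V\<close> and \<open>G(r) = r\<^sup>m a\<^sup>\<bullet>(\<mu>r)\<close> have their sphere counterparts as derivatives, so the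
  hypothesis reads \<open>V' G = V G'\<close>. Hence \<open>V / G\<close> is constant, and its limit at zero is \<open>\<omega> u(x)\<close>.
\<close>

lemma volume_mean_from_quotient:
  fixes u :: "'a::euclidean_space \<Rightarrow> real"
  assumes u: "continuous_on UNIV u"
    and id: "\<And>r. 0 < r \<Longrightarrow> r < \<rho> \<Longrightarrow>
      a_spherical DIM('a) (\<mu> * r) * volume_mean u x r = a_volume DIM('a) (\<mu> * r) * spherical_mean u x r"
    and R: "0 < R" "R < \<rho>"
  shows "(LINT y:ball x R|lborel. u y) =
    measure lborel (ball (0::'a) 1) * R ^ DIM('a) * a_volume DIM('a) (\<mu> * R) * u x"
proof -
  define m where "m = DIM('a)"
  have m: "m \<ge> 1" by (simp add: m_def Suc_leI)
  define \<omega> where "\<omega> = measure lborel (ball (0::'a) 1)"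
  have \<omega>: "\<omega> > 0" unfolding \<omega>_def by (rule measure_unit_ball_pos)
  define V where "V r = (LINT y:ball x r|lborel. u y)" for r
  define S where "S r = (LINT y:ball 0 1|lborel. u (x + r *\<^sub>R sgn y))" for r
  define G where "G r = r ^ m * a_volume m (\<mu> * r)" for r
  have um: "u \<in> borel_measurable borel"
    using u by (rule borel_measurable_continuous_onI)
  have Gpos: "G r > 0" if "r > 0" for r using that by (simp add: G_def a_volume_pos)
  have cancel: "A * v = p * B * s" if "A * (v / (p * \<omega>)) = B * (s / \<omega>)" "p > 0" for A v p B s
  proof -
    have "A * (v / (p * \<omega>)) * (p * \<omega>) = B * (s / \<omega>) * (p * \<omega>)" by (simp only: that(1))
    then show ?thesis using that(2) \<omega> by simp
  qed
  have "((\<lambda>r. V r / G r) has_real_derivative 0) (at r)" if r: "0 < r" "r < \<rho>" for r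
  proof -
    have V': "(V has_real_derivative real m * r ^ (m - 1) * S r) (at r)"
      unfolding V_def[abs_def] S_def m_def using u r(1) by (rule has_derivative_ball_integral)
    have G': "(G has_real_derivative real m * r ^ (m - 1) * a_spherical m (\<mu> * r)) (at r)"
      unfolding G_def[abs_def] using m r(1) by (rule has_derivative_power_a_volume)
    have "spherical_mean u x r = S r / \<omega>"
      unfolding spherical_mean_def set_integral_sphere_measure[OF um r(1)] measure_sphere_measure_sphere[OF r(1)]
        S_def \<omega>_def m_def using r by simp
    moreover have "volume_mean u x r = V r / (r ^ m * \<omega>)"
      unfolding volume_mean_def V_def measure_ball_scale[OF r(1)] \<omega>_def m_def ..
    ultimately have "a_spherical m (\<mu> * r) * (V r / (r ^ m * \<omega>)) = a_volume m (\<mu> * r) * (S r / \<omega>)"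
      using id[OF r] \<omega> r by (simp only: m_def[symmetric])
    then have AV: "a_spherical m (\<mu> * r) * V r = G r * S r"
      unfolding G_def by (rule cancel) (use r in simp)
    have "real m * r ^ (m - 1) * S r * G r - V r * (real m * r ^ (m - 1) * a_spherical m (\<mu> * r)) =
        real m * r ^ (m - 1) * (G r * S r - a_spherical m (\<mu> * r) * V r)"
      by (simp add: algebra_simps)
    also have "\<dots> = 0" by (simp only: AV) simp
    finally have "real m * r ^ (m - 1) * S r * G r - V r * (real m * r ^ (m - 1) * a_spherical m (\<mu> * r)) = 0" .
    note num = this
    have "G r \<noteq> 0" using Gpos[OF r(1)] by simp
    from DERIV_divide[OF V' G' this] show ?thesis
      unfolding num by (simp only: div_0)
  qed
  then have "\<exists>c. \<forall>r\<in>{0<..<\<rho>}. V r / G r = c"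
    by (intro has_field_derivative_zero_constant) (auto intro: has_field_derivative_at_within)
  then obtain c where c: "\<And>r. 0 < r \<Longrightarrow> r < \<rho> \<Longrightarrow> V r / G r = c" by auto
  have "((\<lambda>r. V r / r ^ m / a_volume m (\<mu> * r)) \<longlongrightarrow> \<omega> * u x / 1) (at_right 0)"
    unfolding V_def \<omega>_def m_def using u m
    by (intro tendsto_divide tendsto_ball_average a_volume_tendsto_1) (auto simp: m_def)
  then have "((\<lambda>r. V r / G r) \<longlongrightarrow> \<omega> * u x) (at_right 0)"
    by (simp add: G_def divide_divide_eq_left)
  moreover have "\<forall>\<^sub>F r in at_right 0. V r / G r = c"
    unfolding eventually_at_right_field using c R by (intro exI[of _ \<rho>]) auto
  then have "((\<lambda>r. V r / G r) \<longlongrightarrow> c) (at_right 0)"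
    by (simp add: tendsto_cong)
  ultimately have "c = \<omega> * u x"
    by (intro tendsto_unique[OF trivial_limit_at_right_real])
  then have "V R = \<omega> * u x * G R"
    using c[OF R] Gpos[OF R(1)] by (auto simp: divide_eq_eq)
  then show ?thesis
    by (simp add: V_def G_def \<omega>_def m_def)
qed

section \<open>Truncated powers and their ball means\<close>

text \<open>
  Powers of the positive part of \<open>s - |z|\<^sup>2\<close>. The order \<open>p = 3\<close> is the lowest one that is of class \<open>C\<^sup>2\<close>.
\<close>

definition cap :: "nat \<Rightarrow> real \<Rightarrow> 'a::euclidean_space \<Rightarrow> real" where
  "cap p s z = (max 0 (s - (norm z)\<^sup>2)) ^ p"

text \<open>
  The Laplacian of \<open>cap 3 s\<close>, see \<open>cap_hessian_trace\<close> below.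
\<close>

definition cap_laplacian :: "real \<Rightarrow> 'a::euclidean_space \<Rightarrow> real" where
  "cap_laplacian s z = 24 * (norm z)\<^sup>2 * cap 1 s z - 6 * real DIM('a) * cap 2 s z"

lemma continuous_on_cap [continuous_intros]:
  assumes "continuous_on S f" "continuous_on S g"
  shows "continuous_on S (\<lambda>x. cap p (f x) (g x))"
  unfolding cap_def using assms by (intro continuous_intros)

lemma continuous_on_cap_laplacian [continuous_intros]:
  assumes "continuous_on S f" "continuous_on S g"
  shows "continuous_on S (\<lambda>x. cap_laplacian (f x) (g x))"
  unfolding cap_laplacian_def using assms by (intro continuous_intros)

lemma cap_nonneg: "cap p s z \<ge> 0"
  by (simp add: cap_def)

lemma cap_eq_0: "p > 0 \<Longrightarrow> (norm z)\<^sup>2 \<ge> s \<Longrightarrow> cap p s z = 0"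
  by (simp add: cap_def max_def)

lemma cap_laplacian_eq_0: "(norm z)\<^sup>2 \<ge> s \<Longrightarrow> cap_laplacian s z = 0"
  by (simp add: cap_laplacian_def cap_eq_0)

text \<open>
  In this form the Laplacian acts on integrals against truncated powers as a differential operator in
  the parameter \<open>s\<close>, since differentiation in \<open>s\<close> lowers the order of a truncated power.
\<close>

lemma cap_laplacian_alt:
  fixes z :: "'a::euclidean_space"
  shows "cap_laplacian s z = 24 * s * cap 1 s z - (6 * real DIM('a) + 24) * cap 2 s z"
proof -
  have "(norm z)\<^sup>2 * cap 1 s z = s * cap 1 s z - cap 2 s z"
    by (auto simp: cap_def max_def power2_eq_square algebra_simps)
  then have "24 * ((norm z)\<^sup>2 * cap 1 s z) = 24 * (s * cap 1 s z - cap 2 s z)"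
    by (simp only:)
  then show ?thesis
    unfolding cap_laplacian_def by (simp add: distrib_right)
qed

text \<open>
  The second derivative \<open>6 t\<^sub>+\<close> of the truncated cube is Lipschitz with constant six.
\<close>

lemma positive_part_cube_taylor:
  fixes t \<tau> :: real
  shows "\<bar>(max 0 (t + \<tau>)) ^ 3 - (max 0 t) ^ 3 - 3 * (max 0 t)\<^sup>2 * \<tau> - 3 * max 0 t * \<tau>\<^sup>2\<bar> \<le> \<bar>\<tau>\<bar> ^ 3"
proof -
  consider "t \<ge> 0" "t + \<tau> \<ge> 0" | "t \<ge> 0" "t + \<tau> < 0" | "t < 0" "t + \<tau> \<ge> 0" | "t < 0" "t + \<tau> < 0"
    by linarith
  then show ?thesis
  proof cases
    case 1
    then have "(max 0 (t + \<tau>)) ^ 3 - (max 0 t) ^ 3 - 3 * (max 0 t)\<^sup>2 * \<tau> - 3 * max 0 t * \<tau>\<^sup>2 = \<tau> ^ 3"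
      by (simp add: power2_eq_square power3_eq_cube algebra_simps)
    then show ?thesis by (simp only: power_abs)
  next
    case 2
    then have "(max 0 (t + \<tau>)) ^ 3 - (max 0 t) ^ 3 - 3 * (max 0 t)\<^sup>2 * \<tau> - 3 * max 0 t * \<tau>\<^sup>2 = (- (t + \<tau>)) ^ 3 - (- \<tau>) ^ 3"
      by (simp add: power2_eq_square power3_eq_cube algebra_simps)
    moreover have "0 \<le> (- (t + \<tau>)) ^ 3"
      by (rule zero_le_power) (use 2 in simp)
    moreover have "(- (t + \<tau>)) ^ 3 \<le> (- \<tau>) ^ 3"
      by (rule power_mono) (use 2 in simp_all)
    moreover have "\<bar>\<tau>\<bar> = - \<tau>"
      using 2 by simp
    ultimately show ?thesis by simp
  next
    case 3
    then have "(t + \<tau>) ^ 3 \<le> \<tau> ^ 3" "0 \<le> (t + \<tau>) ^ 3" "\<bar>\<tau>\<bar> = \<tau>"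
      by (auto intro!: power_mono)
    then show ?thesis using 3 by simp
  qed simp_all
qed

lemma integral_ball_scaled:
  fixes f :: "'a::euclidean_space \<Rightarrow> real"
  assumes f: "continuous_on UNIV f" and r: "r > 0" and hom: "\<And>y. f (r *\<^sub>R y) = r ^ k * f y"
  shows "(LINT y:ball 0 r|lborel. f y) = r ^ (DIM('a) + k) * (LINT y:ball 0 1|lborel. f y)"
proof -
  have "f \<in> borel_measurable borel" using f by (rule borel_measurable_continuous_onI)
  from set_integral_ball_affine[OF this r, of 0 1] show ?thesis
    by (simp add: hom power_add)
qed

text \<open>
  Expand the truncated cube to second order in the increment \<open>\<tau>\<close> of \<open>s - |z|\<^sup>2\<close> and integrate: the odd
  moments vanish and the second moments of the ball produce the Laplacian. The error bound is
  locally uniform in \<open>z\<close>, as dominated convergence requires.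
\<close>

lemma cap_ball_mean_expansion:
  fixes z :: "'a::euclidean_space"
  assumes r: "0 < r" "r \<le> 1"
  defines "\<omega> \<equiv> measure lborel (ball (0::'a) 1)"
  shows "\<bar>((LINT h:ball 0 r|lborel. cap 3 s (z + h)) - \<omega> * r ^ DIM('a) * cap 3 s z) / (\<omega> * r ^ (DIM('a) + 2))
      - cap_laplacian s z / (2 * (real DIM('a) + 2))\<bar> \<le> ((2 * norm z + 1) ^ 3 + 3 * cap 1 s z) * r"
proof -
  define m where "m = DIM('a)"
  have \<omega>: "\<omega> > 0" unfolding \<omega>_def by (rule measure_unit_ball_pos)
  define P where "P = cap 1 s z"
  have P: "P \<ge> 0" "cap 2 s z = P\<^sup>2" "cap 3 s z = P ^ 3" by (simp_all add: P_def cap_def)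
  define \<tau> where "\<tau> h = - (2 * (z \<bullet> h) + (norm h)\<^sup>2)" for h
  \<comment> \<open>The term \<open>3P|h|\<^sup>4\<close> of the quadratic part is of order \<open>r\<^sup>4\<close> and goes into the remainder.\<close>
  define E where "E h = cap 3 s (z + h) - P ^ 3 - 3 * P\<^sup>2 * \<tau> h - 3 * P * (\<tau> h)\<^sup>2
    + 3 * P * (norm h) ^ 4" for h
  note int = set_integrable_ball_continuous
  have vol: "(LINT h:ball (0::'a) r|lborel. c) = \<omega> * r ^ m * c" for c :: real
    using measure_ball_scale[OF r(1), of "0::'a"] emeasure_lborel_ball_finite[of "0::'a" r]
    by (simp add: set_lebesgue_integral_def \<omega>_def m_def less_top)
  have mom1: "(LINT h:ball 0 r|lborel. z \<bullet> h) = 0"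
    by (intro set_integral_ball_odd) auto
  have mom3: "(LINT h:ball 0 r|lborel. (z \<bullet> h) * (norm h)\<^sup>2) = 0"
    by (intro set_integral_ball_odd) auto
  have mom2: "(LINT h:ball (0::'a) r|lborel. (norm h)\<^sup>2) = r ^ (m + 2) * (real m * \<omega> / (real m + 2))"
    using integral_ball_scaled[of "\<lambda>h::'a. (norm h)\<^sup>2" r 2] r integral_ball_norm_square[where 'a = 'a]
    by (simp add: m_def \<omega>_def power_mult_distrib continuous_intros)
  have mom2z: "(LINT h:ball 0 r|lborel. (z \<bullet> h)\<^sup>2) = r ^ (m + 2) * ((norm z)\<^sup>2 * \<omega> / (real m + 2))"
    using integral_ball_scaled[of "\<lambda>h. (z \<bullet> h)\<^sup>2" r 2] r integral_ball_inner_square[of z]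
    by (simp add: m_def \<omega>_def power_mult_distrib continuous_intros)
  have split: "cap 3 s (z + h) = P ^ 3 + E h + (- 6 * P\<^sup>2) * (z \<bullet> h) + (- 3 * P\<^sup>2) * (norm h)\<^sup>2
      + (12 * P) * (z \<bullet> h)\<^sup>2 + (12 * P) * ((z \<bullet> h) * (norm h)\<^sup>2)" for h
    by (simp add: E_def \<tau>_def power2_eq_square power4_eq_xxxx algebra_simps)
  have Econt: "continuous_on UNIV E"
    unfolding E_def \<tau>_def by (intro continuous_intros)
  have Eb: "\<bar>E h\<bar> \<le> ((2 * norm z + 1) ^ 3 + 3 * P) * r ^ 3" if h: "h \<in> ball 0 r" for h
  proof -
    have hr: "norm h \<le> r" "norm h \<le> 1" using h r by auto
    have arg: "s - (norm (z + h))\<^sup>2 = (s - (norm z)\<^sup>2) + \<tau> h"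
      by (simp add: \<tau>_def power2_norm_eq_inner inner_simps inner_commute)
    have "\<bar>cap 3 s (z + h) - P ^ 3 - 3 * P\<^sup>2 * \<tau> h - 3 * P * (\<tau> h)\<^sup>2\<bar> \<le> \<bar>\<tau> h\<bar> ^ 3"
      using positive_part_cube_taylor[of "s - (norm z)\<^sup>2" "\<tau> h"]
      unfolding cap_def arg P_def by simp
    also have "\<dots> \<le> ((2 * norm z + 1) * r) ^ 3"
    proof (rule power_mono)
      have "\<bar>\<tau> h\<bar> \<le> 2 * (norm z * norm h) + norm h * norm h"
        using Cauchy_Schwarz_ineq2[of z h] unfolding \<tau>_def power2_eq_square abs_minus_cancel
        by (intro order_trans[OF abs_triangle_ineq]) simp
      also have "\<dots> \<le> 2 * (norm z * r) + 1 * r"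
        using hr r by (intro add_mono mult_mono mult_left_mono) auto
      finally show "\<bar>\<tau> h\<bar> \<le> (2 * norm z + 1) * r" by (simp add: algebra_simps)
    qed simp
    also have "\<dots> = (2 * norm z + 1) ^ 3 * r ^ 3" by (simp add: power_mult_distrib)
    finally have 1: "\<bar>cap 3 s (z + h) - P ^ 3 - 3 * P\<^sup>2 * \<tau> h - 3 * P * (\<tau> h)\<^sup>2\<bar> \<le> (2 * norm z + 1) ^ 3 * r ^ 3" .
    have "(norm h) ^ 4 = (norm h) ^ 3 * norm h" by (simp add: power_Suc2[symmetric] numeral_eq_Suc)
    also have "\<dots> \<le> r ^ 3 * 1" using hr r by (intro mult_mono power_mono) auto
    finally have "\<bar>3 * P * (norm h) ^ 4\<bar> \<le> 3 * P * r ^ 3" using P(1) by (simp add: mult_left_mono abs_mult)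
    with 1 have "\<bar>(cap 3 s (z + h) - P ^ 3 - 3 * P\<^sup>2 * \<tau> h - 3 * P * (\<tau> h)\<^sup>2) + 3 * P * (norm h) ^ 4\<bar>
        \<le> (2 * norm z + 1) ^ 3 * r ^ 3 + 3 * P * r ^ 3" by (intro order_trans[OF abs_triangle_ineq] add_mono)
    then show ?thesis unfolding E_def by (simp add: distrib_right)
  qed
  define I where "I = (LINT h:ball 0 r|lborel. E h)"
  have Ib: "\<bar>I\<bar> \<le> ((2 * norm z + 1) ^ 3 + 3 * P) * r ^ 3 * (\<omega> * r ^ m)"
  proof -
    have "\<bar>I\<bar> \<le> ((2 * norm z + 1) ^ 3 + 3 * P) * r ^ 3 * measure lborel (ball (0::'a) r)"
      unfolding I_def
      using Econt Eb emeasure_lborel_ball_finite[of "0::'a" r]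
      by (intro set_integral_abs_bound int) auto
    then show ?thesis unfolding measure_ball_scale[OF r(1)] \<omega>_def m_def by (simp only: mult_ac)
  qed
  have "(LINT h:ball 0 r|lborel. cap 3 s (z + h)) = \<omega> * r ^ m * P ^ 3 + I
      + (- 6 * P\<^sup>2) * (LINT h:ball 0 r|lborel. z \<bullet> h) + (- 3 * P\<^sup>2) * (LINT h:ball (0::'a) r|lborel. (norm h)\<^sup>2)
      + (12 * P) * (LINT h:ball 0 r|lborel. (z \<bullet> h)\<^sup>2) + (12 * P) * (LINT h:ball 0 r|lborel. (z \<bullet> h) * (norm h)\<^sup>2)"
    unfolding split I_def vol[symmetric] set_integral_mult_right[symmetric]
    using Econt by (simp only: set_integral_add int continuous_intros)
  also have "\<dots> = \<omega> * r ^ m * P ^ 3 + I + \<omega> * r ^ (m + 2) * (cap_laplacian s z / (2 * (real m + 2)))"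
  proof -
    have "(- 3 * Q) * (K * (n * \<omega> * c)) + (12 * P) * (K * (N * \<omega> * c)) =
        \<omega> * K * ((24 * N * P - 6 * n * Q) * (c / 2))" for Q K n N c :: real
      by (simp add: algebra_simps)
    from this[of "P\<^sup>2" "r ^ (m + 2)" "real m" "inverse (real m + 2)" "(norm z)\<^sup>2"]
    moreover have "a / (real m + 2) = a * inverse (real m + 2)"
      "a / (2 * (real m + 2)) = a * (inverse (real m + 2) / 2)" for a
      by (simp_all only: divide_inverse inverse_mult_distrib mult_ac)
    ultimately show ?thesis
      unfolding mom1 mom2 mom2z mom3 cap_laplacian_def P(2) P_def[symmetric] m_def[symmetric]
      by (simp only: mult_zero_right add_0_right add.assoc)
  qed
  finally have "((LINT h:ball 0 r|lborel. cap 3 s (z + h)) - \<omega> * r ^ m * P ^ 3) / (\<omega> * r ^ (m + 2))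
      - cap_laplacian s z / (2 * (real m + 2)) = I / (\<omega> * r ^ (m + 2))"
    using \<omega> r by (simp add: add_divide_distrib diff_divide_distrib)
  moreover have "\<bar>I / (\<omega> * r ^ (m + 2))\<bar> \<le> ((2 * norm z + 1) ^ 3 + 3 * P) * r"
  proof -
    have "\<bar>I\<bar> \<le> ((2 * norm z + 1) ^ 3 + 3 * P) * r * (\<omega> * r ^ (m + 2))"
      using Ib by (simp add: power_add power2_eq_square power3_eq_cube mult_ac)
    moreover have "\<omega> * r ^ (m + 2) > 0" using \<omega> r by simp
    ultimately show ?thesis by (simp only: abs_divide abs_of_pos divide_le_eq) simp
  qed
  ultimately show ?thesis by (simp only: m_def P(3) P_def)
qed

section \<open>Testing a pointwise subsolution\<close>

lemma integrable_continuous_compact_support: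
  fixes f :: "'a::euclidean_space \<Rightarrow> real"
  assumes "continuous_on UNIV f" and "\<And>y. y \<notin> cball x R \<Longrightarrow> f y = 0"
  shows "integrable lborel f"
proof -
  have "integrable lborel (\<lambda>y. indicator (cball x R) y *\<^sub>R f y)"
    using assms(1) by (intro borel_integrable_compact) (auto intro: continuous_on_subset)
  moreover have "(\<lambda>y. indicator (cball x R) y *\<^sub>R f y) = f"
    using assms(2) by (auto simp: indicator_def fun_eq_iff)
  ultimately show ?thesis by simp
qed

text \<open>
  Averaging over balls is self-adjoint, because \<open>w\<close> lies in the ball about \<open>y\<close> exactly if \<open>y\<close> lies in
  the ball of the same radius about \<open>w\<close>.
\<close>

lemma ball_integral_symmetric:
  fixes \<phi> v :: "'a::euclidean_space \<Rightarrow> real"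
  assumes \<phi>: "continuous_on UNIV \<phi>" "\<And>y. y \<notin> cball x R \<Longrightarrow> \<phi> y = 0" and v: "continuous_on UNIV v"
  shows "integrable lborel (\<lambda>y. \<phi> y * (LINT w:ball y r|lborel. v w))" (is ?P)
    and "integrable lborel (\<lambda>y. v y * (LINT w:ball y r|lborel. \<phi> w))" (is ?Q)
    and "(LINT y|lborel. \<phi> y * (LINT w:ball y r|lborel. v w)) =
      (LINT y|lborel. v y * (LINT w:ball y r|lborel. \<phi> w))" (is ?R)
proof -
  define K where "K y w = \<phi> y * (indicator (ball y r) w * v w)" for y w
  define C where "C = cball x R \<times> cball x (R + r)"
  define S where "S = {p :: 'a \<times> 'a. dist (fst p) (snd p) < r}"
  have "integrable (lborel :: ('a \<times> 'a) measure) (\<lambda>p. indicator C p *\<^sub>R (\<phi> (fst p) * v (snd p)))"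
  proof (rule borel_integrable_compact)
    show "compact C" unfolding C_def by (intro compact_Times) auto
    show "continuous_on C (\<lambda>p. \<phi> (fst p) * v (snd p))"
      by (intro continuous_on_mult continuous_on_compose2[OF \<phi>(1)] continuous_on_compose2[OF v] continuous_intros) auto
  qed
  moreover have "open S"
    unfolding S_def by (intro open_Collect_less continuous_intros)
  then have "S \<in> sets (lborel :: ('a \<times> 'a) measure)" by simp
  ultimately have "integrable (lborel :: ('a \<times> 'a) measure)
      (\<lambda>p. indicator S p *\<^sub>R (indicator C p *\<^sub>R (\<phi> (fst p) * v (snd p))))"
    by (rule integrable_mult_indicator[rotated])
  also have "(\<lambda>p. indicator S p *\<^sub>R (indicator C p *\<^sub>R (\<phi> (fst p) * v (snd p)))) = case_prod K"
  proof
    fix p :: "'a \<times> 'a"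
    obtain y w where p: "p = (y, w)" by (cases p)
    show "indicator S p *\<^sub>R (indicator C p *\<^sub>R (\<phi> (fst p) * v (snd p))) = case_prod K p"
    proof (cases "y \<in> cball x R \<and> dist y w < r")
      case True
      then have "w \<in> cball x (R + r)"
        using dist_triangle[of x w y] by auto
      then show ?thesis using True by (simp add: p S_def C_def K_def)
    next
      case False
      then show ?thesis using \<phi>(2)[of y] by (auto simp: p S_def C_def K_def)
    qed
  qed
  finally have K: "integrable (lborel \<Otimes>\<^sub>M lborel) (case_prod K)"
    by (simp add: lborel_prod)
  have 1: "(LINT w|lborel. K y w) = \<phi> y * (LINT w:ball y r|lborel. v w)" for y
    by (simp add: K_def set_lebesgue_integral_def)
  have "K y w = v w * (indicator (ball w r) y * \<phi> y)" for y w
    by (simp add: K_def indicator_def dist_commute)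
  then have 2: "(LINT y|lborel. K y w) = v w * (LINT y:ball w r|lborel. \<phi> y)" for w
    by (simp add: set_lebesgue_integral_def)
  show ?P using lborel_pair.integrable_fst[OF K] by (simp add: 1)
  show ?Q using lborel_pair.integrable_snd[OF K] by (simp add: 2)
  show ?R using lborel_pair.Fubini_integral[OF K] by (simp add: 1 2)
qed

text \<open>
  The difference quotients of ball means of \<open>v\<close>, tested against the truncated cube \<open>\<phi>\<close>, equal those of
  \<open>\<phi>\<close> tested against \<open>v\<close>, and the latter converge to the integral of \<open>v\<close> against the Laplacian of \<open>\<phi>\<close>.
  The former are only bounded below: uniformly by \<open>lower\<close>, and by the desired limit, but only for
  radii that depend on the point, by \<open>sub\<close>. Truncating them from above by the desired limit makes
  them dominated and does not increase the integral.
\<close>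

lemma weak_subsolution:
  fixes v :: "'a::euclidean_space \<Rightarrow> real" and A :: "real \<Rightarrow> real"
  defines "\<omega> \<equiv> measure lborel (ball (0::'a) 1)"
  assumes v: "continuous_on UNIV v" and s: "s > 0" and N: "N \<ge> 0"
    and lower: "\<And>y r. r > 0 \<Longrightarrow> \<omega> * r ^ DIM('a) * v y - N * (\<omega> * r ^ (DIM('a) + 2)) \<le> (LINT w:ball y r|lborel. v w)"
    and sub: "\<And>y. (norm (y - x))\<^sup>2 < s \<Longrightarrow>
      \<exists>\<rho>>0. \<forall>r. 0 < r \<and> r < \<rho> \<longrightarrow> \<omega> * r ^ DIM('a) * (v y + (A r - 1) * v y) \<le> (LINT w:ball y r|lborel. v w)"
    and A: "((\<lambda>r. (A r - 1) / r\<^sup>2) \<longlongrightarrow> \<kappa> / (2 * (real DIM('a) + 2))) (at_right 0)"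
  shows "(LINT y|lborel. v y * (cap_laplacian s (y - x) - \<kappa> * cap 3 s (y - x))) \<ge> 0"
proof -
  define m where "m = DIM('a)"
  have \<omega>: "\<omega> > 0" unfolding \<omega>_def by (rule measure_unit_ball_pos)
  define \<phi> where "\<phi> y = cap 3 s (y - x)" for y
  define R where "R = sqrt s"
  have Rs: "R\<^sup>2 = s" "R > 0" using s by (auto simp: R_def)
  have \<phi>c: "continuous_on UNIV \<phi>" unfolding \<phi>_def by (intro continuous_intros)
  have outside: "s \<le> (norm (y - x))\<^sup>2" if "y \<notin> ball x R" for y
    using power_mono[of R "norm (y - x)" 2] that Rs by (simp add: dist_norm norm_minus_commute)
  have \<phi>0: "\<phi> y = 0" if "y \<notin> ball x R" for y
    using outside[OF that] by (simp add: \<phi>_def cap_eq_0)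
  have \<phi>supp: "\<phi> y = 0" if "y \<notin> cball x R" for y
    using \<phi>0[of y] that by auto
  have \<phi>nn: "\<phi> y \<ge> 0" for y by (simp add: \<phi>_def cap_nonneg)
  have \<phi>v: "integrable lborel (\<lambda>y. \<phi> y * v y)"
    using \<phi>c v \<phi>supp by (intro integrable_continuous_compact_support[where x = x and R = R] continuous_intros) auto
  define r where "r n = 1 / real (n + 1)" for n
  have r: "0 < r n" "r n \<le> 1" for n by (auto simp: r_def)
  have r0: "r \<longlonglongrightarrow> 0" unfolding r_def using LIMSEQ_inverse_real_of_nat by (simp add: inverse_eq_divide)
  have rlim: "filterlim r (at_right 0) sequentially"
    unfolding filterlim_at 
  proof
    have "r n \<in> {0<..} \<and> r n \<noteq> 0" for n using r(1)[of n] by simp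
    then show "\<forall>\<^sub>F n in sequentially. r n \<in> {0<..} \<and> r n \<noteq> 0" by (intro always_eventually allI)
  qed (rule r0)
  define c where "c n = (A (r n) - 1) / (r n)\<^sup>2" for n
  have clim: "c \<longlonglongrightarrow> \<kappa> / (2 * (real m + 2))"
    unfolding c_def m_def by (rule filterlim_compose[OF A rlim])
  then obtain Cc where Cc: "\<And>n. \<bar>c n\<bar> \<le> Cc"
    using convergent_imp_Bseq[of c] unfolding convergent_def Bseq_def by auto
  define q where "q n = \<omega> * (r n) ^ (m + 2)" for n
  have q: "q n > 0" for n using \<omega> r by (simp add: q_def)
  define V where "V f y n = (LINT w:ball y (r n)|lborel. f w)" for f :: "'a \<Rightarrow> real" and y n
  define F where "F n y = (\<phi> y * V v y n - \<omega> * (r n) ^ m * (\<phi> y * v y)) / q n" for n y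
  define G where "G n y = (v y * V \<phi> y n - \<omega> * (r n) ^ m * (\<phi> y * v y)) / q n" for n y
  note sym = ball_integral_symmetric[where x = x and R = R, OF \<phi>c \<phi>supp v]
  have Fint: "integrable lborel (F n)" for n
    unfolding F_def V_def using sym(1) \<phi>v by auto
  have FG: "(LINT y|lborel. F n y) = (LINT y|lborel. G n y)" for n
  proof -
    have "(LINT y|lborel. F n y) = ((LINT y|lborel. \<phi> y * V v y n) - \<omega> * (r n) ^ m * (LINT y|lborel. \<phi> y * v y)) / q n"
      unfolding F_def V_def using sym(1)[where r = "r n"] \<phi>v by simp
    also have "\<dots> = (LINT y|lborel. G n y)"
      unfolding G_def V_def using sym(2)[where r = "r n"] sym(3)[where r = "r n"] \<phi>v by simp
    finally show ?thesis .
  qed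
  have Flow: "F n y \<ge> - N * \<phi> y" for n y
  proof -
    have "\<phi> y * (\<omega> * (r n) ^ m * v y - N * q n) \<le> \<phi> y * V v y n"
      unfolding V_def q_def m_def by (intro mult_left_mono lower r \<phi>nn)
    then show ?thesis using q[of n] by (simp add: F_def le_divide_eq algebra_simps)
  qed
  \<comment> \<open>The truncation that makes the difference quotients dominated.\<close>
  define H where "H n y = min (F n y) (c n * (\<phi> y * v y))" for n y
  have Fm: "F n \<in> borel_measurable lborel" for n using Fint[of n] by auto
  have \<phi>vm: "(\<lambda>y. \<phi> y * v y) \<in> borel_measurable lborel" using \<phi>v by auto
  have HL: "(\<lambda>n. LINT y|lborel. H n y) \<longlonglongrightarrow> (LINT y|lborel. \<kappa> / (2 * (real m + 2)) * (\<phi> y * v y))"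
    and Hint: "\<And>n. integrable lborel (H n)"
  proof -
    let ?w = "\<lambda>y. N * \<phi> y + Cc * (\<phi> y * \<bar>v y\<bar>)"
    have w: "integrable lborel ?w"
      using \<phi>c v \<phi>supp by (intro integrable_continuous_compact_support[where x = x and R = R] continuous_intros) auto
    have Hm: "H n \<in> borel_measurable lborel" for n
      unfolding H_def using Fm[of n] \<phi>vm by measurable
    have bound: "norm (H n y) \<le> ?w y" for n y
    proof -
      have "\<bar>c n * (\<phi> y * v y)\<bar> \<le> Cc * (\<phi> y * \<bar>v y\<bar>)"
        unfolding abs_mult using Cc[of n] \<phi>nn[of y] by (intro mult_mono) auto
      moreover have "N * \<phi> y \<ge> 0" using N \<phi>nn by simp
      ultimately show ?thesis using Flow[of y n] unfolding H_def real_norm_def by linarith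
    qed
    have lim: "(\<lambda>n. H n y) \<longlonglongrightarrow> \<kappa> / (2 * (real m + 2)) * (\<phi> y * v y)" for y
    proof (cases "y \<in> ball x R")
      case False
      then show ?thesis by (simp add: \<phi>0 H_def F_def)
    next
      case True
      then have "norm (y - x) < R" by (simp add: dist_norm norm_minus_commute)
      then have "(norm (y - x))\<^sup>2 < R\<^sup>2" by (intro power_strict_mono) auto
      then obtain \<rho> where \<rho>: "\<rho> > 0" "\<And>r. 0 < r \<Longrightarrow> r < \<rho> \<Longrightarrow>
          \<omega> * r ^ DIM('a) * (v y + (A r - 1) * v y) \<le> (LINT w:ball y r|lborel. v w)"
        using sub[of y] Rs by auto
      have "\<forall>\<^sub>F n in sequentially. r n < \<rho>"
        using order_tendstoD(2)[OF r0 \<rho>(1)] .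
      then have "\<forall>\<^sub>F n in sequentially. c n * (\<phi> y * v y) = H n y"
      proof eventually_elim
        case (elim n)
        have Ac: "(A (r n) - 1) = c n * (r n)\<^sup>2" using r(1)[of n] by (simp add: c_def)
        have "\<phi> y * (\<omega> * (r n) ^ m * (v y + c n * (r n)\<^sup>2 * v y)) \<le> \<phi> y * V v y n"
          unfolding V_def m_def Ac[symmetric] by (intro mult_left_mono \<rho>(2) r elim \<phi>nn)
        moreover have qn: "q n = \<omega> * (r n) ^ m * (r n)\<^sup>2" by (simp only: q_def power_add mult.assoc)
        have "\<phi> y * (\<omega> * (r n) ^ m * (v y + c n * (r n)\<^sup>2 * v y)) =
            \<omega> * (r n) ^ m * (\<phi> y * v y) + c n * (\<phi> y * v y) * q n"
          unfolding qn by (simp add: algebra_simps)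
        ultimately have "c n * (\<phi> y * v y) * q n \<le> \<phi> y * V v y n - \<omega> * (r n) ^ m * (\<phi> y * v y)"
          by linarith
        then have "c n * (\<phi> y * v y) \<le> F n y"
          using q[of n] by (simp add: F_def le_divide_eq)
        then show ?case by (simp add: H_def)
      qed
      moreover have "(\<lambda>n. c n * (\<phi> y * v y)) \<longlonglongrightarrow> \<kappa> / (2 * (real m + 2)) * (\<phi> y * v y)"
        by (intro tendsto_mult_right clim)
      ultimately show ?thesis by (rule Lim_transform_eventually[rotated])
    qed
    show "(\<lambda>n. LINT y|lborel. H n y) \<longlonglongrightarrow> (LINT y|lborel. \<kappa> / (2 * (real m + 2)) * (\<phi> y * v y))"
      by (rule integral_dominated_convergence[where w = ?w])
         (use \<phi>vm Hm w lim bound in auto)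
    show "integrable lborel (H n)" for n
    proof (rule Bochner_Integration.integrable_bound[OF w Hm])
      have "norm (H n y) \<le> norm (?w y)" for y using bound[of n y] by simp
      then show "AE y in lborel. norm (H n y) \<le> norm (?w y)" by simp
    qed
  qed
  have GL: "(\<lambda>n. LINT y|lborel. G n y) \<longlonglongrightarrow>
      (LINT y|lborel. v y * (cap_laplacian s (y - x) / (2 * (real m + 2))))"
  proof -
    define L where "L y = cap_laplacian s (y - x) / (2 * (real m + 2))" for y
    define D where "D y = (2 * norm (y - x) + 1) ^ 3 + 3 * cap 1 s (y - x)" for y
    define g where "g n y = (V \<phi> y n - \<omega> * (r n) ^ m * \<phi> y) / q n" for n y
    have Gg: "G n y = v y * g n y" for n y by (simp add: G_def g_def right_diff_distrib mult_ac)
    have D0: "D y \<ge> 0" for y by (simp add: D_def cap_nonneg)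
    have Lc: "continuous_on UNIV L" unfolding L_def by (intro continuous_intros) auto
    have Dc: "continuous_on UNIV D" unfolding D_def by (intro continuous_intros)
    have g: "\<bar>g n y - L y\<bar> \<le> D y * r n" for n y
    proof -
      have "\<phi> \<in> borel_measurable borel" using \<phi>c by (rule borel_measurable_continuous_onI)
      then have V\<phi>: "V \<phi> y n = (LINT h:ball 0 (r n)|lborel. cap 3 s ((y - x) + h))"
        using set_integral_ball_affine[of \<phi> 1 y "r n"]
        unfolding V_def \<phi>_def[abs_def] by (simp add: algebra_simps)
      show ?thesis
        using cap_ball_mean_expansion[OF r[of n], where s = s and z = "y - x"]
        unfolding g_def V\<phi> L_def D_def q_def \<omega>_def m_def \<phi>_def .
    qed
    \<comment> \<open>Radii are at most one, so nothing beyond distance \<open>R + 1\<close> is reached.\<close>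
    define Q where "Q = cball x (R + 1)"
    have g0: "g n y = 0" if "y \<notin> Q" for n y
    proof -
      have *: "\<phi> w = 0" if "w \<in> ball y (r n)" for w
      proof (rule \<phi>0)
        show "w \<notin> ball x R"
          using dist_triangle[of x y w] that \<open>y \<notin> Q\<close> r(2)[of n] by (auto simp: Q_def dist_commute)
      qed
      have "V \<phi> y n = (LINT w|(lborel :: 'a measure). 0)"
        unfolding V_def set_lebesgue_integral_def using * by (intro Bochner_Integration.integral_cong) (auto simp: indicator_def)
      moreover have "\<phi> y = 0" using that by (intro \<phi>0) (auto simp: Q_def)
      ultimately show ?thesis by (simp add: g_def)
    qed
    let ?w = "\<lambda>y. indicator Q y *\<^sub>R (\<bar>v y\<bar> * (\<bar>L y\<bar> + D y))"
    have w: "integrable lborel ?w"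
    proof (rule borel_integrable_compact)
      show "continuous_on Q (\<lambda>y. \<bar>v y\<bar> * (\<bar>L y\<bar> + D y))"
        using continuous_on_subset[OF v] continuous_on_subset[OF Lc] continuous_on_subset[OF Dc]
        by (intro continuous_intros) auto
    qed (simp add: Q_def)
    have "(\<lambda>n. LINT y|lborel. G n y) \<longlonglongrightarrow> (LINT y|lborel. v y * L y)"
    proof (rule integral_dominated_convergence[where w = ?w])
      show "(\<lambda>y. v y * L y) \<in> borel_measurable lborel"
      proof -
        have "continuous_on UNIV (\<lambda>y. v y * L y)" using v Lc by (intro continuous_intros)
        from borel_measurable_continuous_onI[OF this] show ?thesis by simp
      qed
      show "G n \<in> borel_measurable lborel" for n
      proof -
        have "integrable lborel (G n)"
          unfolding G_def V_def using sym(2) \<phi>v by auto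
        then show ?thesis by auto
      qed
      have "(\<lambda>n. G n y) \<longlonglongrightarrow> v y * L y" for y
      proof -
        have "\<forall>\<^sub>F n in sequentially. norm (g n y - L y) \<le> D y * r n"
          by (intro always_eventually allI) (simp only: real_norm_def g)
        moreover have "(\<lambda>n. D y * r n) \<longlonglongrightarrow> 0"
          using tendsto_mult_left[OF r0, of "D y"] by (simp only: mult_zero_right)
        ultimately have "(\<lambda>n. g n y - L y) \<longlonglongrightarrow> 0"
          by (rule Lim_null_comparison)
        then have "(\<lambda>n. g n y) \<longlonglongrightarrow> L y" by (rule LIM_zero_cancel)
        then show ?thesis unfolding Gg by (rule tendsto_mult_left)
      qed
      then show "AE y in lborel. (\<lambda>n. G n y) \<longlonglongrightarrow> v y * L y" by simp
      have "norm (G n y) \<le> ?w y" for n y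
      proof (cases "y \<in> Q")
        case True
        have "\<bar>g n y\<bar> \<le> \<bar>L y\<bar> + D y * r n" using g[of n y] by linarith
        also have "D y * r n \<le> D y * 1" using D0[of y] r[of n] by (intro mult_left_mono) auto
        finally have "\<bar>v y\<bar> * \<bar>g n y\<bar> \<le> \<bar>v y\<bar> * (\<bar>L y\<bar> + D y)" by (intro mult_left_mono) auto
        then show ?thesis using True by (simp add: Gg abs_mult)
      qed (simp add: Gg g0)
      then show "\<And>n. AE y in lborel. norm (G n y) \<le> ?w y" by simp
    qed (rule w)
    then show ?thesis by (simp add: L_def)
  qed
  have "(LINT y|lborel. H n y) \<le> (LINT y|lborel. G n y)" for n
    unfolding FG[symmetric] by (intro integral_mono Hint Fint) (simp add: H_def)
  then have le: "(LINT y|lborel. \<kappa> / (2 * (real m + 2)) * (\<phi> y * v y)) \<le>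
      (LINT y|lborel. v y * (cap_laplacian s (y - x) / (2 * (real m + 2))))"
    by (intro LIMSEQ_le[OF HL GL]) auto
  have Lint: "integrable lborel (\<lambda>y. v y * cap_laplacian s (y - x))"
    using v outside by (intro integrable_continuous_compact_support[where x = x and R = R] continuous_intros)
      (auto simp: cap_laplacian_eq_0 less_imp_le)
  define d where "d = 2 * (real m + 2)"
  have d: "d > 0" by (simp add: d_def add_nonneg_pos)
  have "(LINT y|lborel. v y * (cap_laplacian s (y - x) / d)) = (LINT y|lborel. v y * cap_laplacian s (y - x) / d)"
    by (simp only: times_divide_eq_right)
  also have "\<dots> = (LINT y|lborel. v y * cap_laplacian s (y - x)) / d"
    by (rule integral_divide_zero)
  finally have "\<kappa> / d * (LINT y|lborel. \<phi> y * v y) \<le> (LINT y|lborel. v y * cap_laplacian s (y - x)) / d"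
    using le unfolding d_def[symmetric] integral_mult_right_zero by (simp only:)
  then have "\<kappa> / d * (LINT y|lborel. \<phi> y * v y) * d \<le> (LINT y|lborel. v y * cap_laplacian s (y - x)) / d * d"
    using d by (intro mult_right_mono) auto
  then have "\<kappa> * (LINT y|lborel. \<phi> y * v y) \<le> (LINT y|lborel. v y * cap_laplacian s (y - x))"
    using d by simp
  moreover have "(LINT y|lborel. v y * (cap_laplacian s (y - x) - \<kappa> * cap 3 s (y - x))) =
      (LINT y|lborel. v y * cap_laplacian s (y - x) - \<kappa> * (\<phi> y * v y))"
    by (intro Bochner_Integration.integral_cong) (auto simp: \<phi>_def algebra_simps)
  ultimately show ?thesis using Lint \<phi>v by simp
qed

section \<open>Sup-convolution and the weak equation\<close>

definition sup_conv :: "real \<Rightarrow> 'a::euclidean_space set \<Rightarrow> ('a \<Rightarrow> real) \<Rightarrow> 'a \<Rightarrow> real" where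
  "sup_conv N K u x = (SUP y\<in>K. u y - N * (dist x y)\<^sup>2)"

lemma sup_conv_attained:
  assumes "compact K" "K \<noteq> {}" "continuous_on K u"
  obtains y where "y \<in> K" "sup_conv N K u x = u y - N * (dist x y)\<^sup>2"
proof -
  have "continuous_on K (\<lambda>y. u y - N * (dist x y)\<^sup>2)"
    using assms(3) by (intro continuous_intros)
  then obtain y where y: "y \<in> K" "\<And>z. z \<in> K \<Longrightarrow> u z - N * (dist x z)\<^sup>2 \<le> u y - N * (dist x y)\<^sup>2"
    using continuous_attains_sup[OF assms(1,2)] by blast
  then have "sup_conv N K u x = u y - N * (dist x y)\<^sup>2"
    unfolding sup_conv_def by (intro cSup_eq_maximum) auto
  with y(1) show ?thesis by (rule that)
qed

lemma sup_conv_upper: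
  assumes "compact K" "continuous_on K u" "z \<in> K"
  shows "u z - N * (dist x z)\<^sup>2 \<le> sup_conv N K u x"
  unfolding sup_conv_def
proof (rule cSUP_upper[OF assms(3)])
  have "compact ((\<lambda>y. u y - N * (dist x y)\<^sup>2) ` K)"
    using assms(1,2) by (intro compact_continuous_image continuous_intros)
  then show "bdd_above ((\<lambda>y. u y - N * (dist x y)\<^sup>2) ` K)"
    by (intro bounded_imp_bdd_above compact_imp_bounded)
qed

text \<open>
  On bounded sets the functions in the supremum are Lipschitz with a common constant.
\<close>

lemma continuous_on_sup_conv:
  fixes K :: "'a::euclidean_space set"
  assumes K: "compact K" "K \<noteq> {}" and u: "continuous_on K u" and N: "N \<ge> 0"
  shows "continuous_on UNIV (sup_conv N K u)"
proof -
  have "isCont (sup_conv N K u) x" for x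
  proof -
    obtain B where B: "\<And>y. y \<in> K \<Longrightarrow> dist x y \<le> B"
      using compact_imp_bounded[OF K(1)] unfolding bounded_any_center[where a = x] by auto
    have low: "sup_conv N K u a - N * (2 * B + 1) * dist a b \<le> sup_conv N K u b"
      if "dist x a \<le> 1" "dist x b \<le> 1" "a = x \<or> b = x" for a b
    proof -
      obtain y where y: "y \<in> K" "sup_conv N K u a = u y - N * (dist a y)\<^sup>2"
        using sup_conv_attained[OF K u] by blast
      have "(dist b y)\<^sup>2 - (dist a y)\<^sup>2 = (dist b y - dist a y) * (dist b y + dist a y)"
        by (simp add: power2_eq_square algebra_simps)
      also have "\<dots> \<le> dist a b * (2 * B + 1)"
      proof (rule mult_mono)
        show "dist b y - dist a y \<le> dist a b"
          using dist_triangle[of b y a] by (simp add: dist_commute)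
        show "dist b y + dist a y \<le> 2 * B + 1"
          using that B[OF y(1)] dist_triangle[of b y x] dist_triangle[of a y x] by (auto simp: dist_commute)
      qed auto
      finally have "N * ((dist b y)\<^sup>2 - (dist a y)\<^sup>2) \<le> N * (dist a b * (2 * B + 1))"
        using N by (intro mult_left_mono)
      then have "sup_conv N K u a - N * (2 * B + 1) * dist a b \<le> u y - N * (dist b y)\<^sup>2"
        unfolding y(2) by (simp add: algebra_simps)
      also have "\<dots> \<le> sup_conv N K u b"
        by (rule sup_conv_upper[OF K(1) u y(1)])
      finally show ?thesis .
    qed
    have bound: "norm (sup_conv N K u z - sup_conv N K u x) \<le> N * (2 * B + 1) * dist x z" if "dist z x \<le> 1" for z
      using low[of x z] low[of z x] that by (simp add: dist_commute abs_le_iff)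
    have "((\<lambda>z. sup_conv N K u z - sup_conv N K u x) \<longlongrightarrow> 0) (at x)"
    proof (rule Lim_null_comparison)
      show "\<forall>\<^sub>F z in at x. norm (sup_conv N K u z - sup_conv N K u x) \<le> N * (2 * B + 1) * dist x z"
        unfolding eventually_at using bound by (intro exI[of _ 1]) auto
      have "((\<lambda>z. N * (2 * B + 1) * dist x z) \<longlongrightarrow> N * (2 * B + 1) * dist x x) (at x)"
        by (intro tendsto_intros)
      then show "((\<lambda>z. N * (2 * B + 1) * dist x z) \<longlongrightarrow> 0) (at x)" by simp
    qed
    then show ?thesis unfolding isCont_def by (rule LIM_zero_cancel)
  qed
  then show ?thesis by (simp add: continuous_at_imp_continuous_on)
qed

lemma set_integral_ball_translate:
  fixes f :: "'a::euclidean_space \<Rightarrow> real"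
  assumes "continuous_on UNIV f"
  shows "(LINT w:ball x r|lborel. f w) = (LINT h:ball 0 r|lborel. f (x + h))"
  using set_integral_ball_affine[OF borel_measurable_continuous_onI[OF assms], of 1 x r] by simp

lemma set_integral_ball_const:
  assumes "r > 0"
  shows "(LINT h:ball (x::'a::euclidean_space) r|lborel. c) = measure lborel (ball (0::'a) 1) * r ^ DIM('a) * c"
  using measure_ball_scale[OF assms, of x] emeasure_lborel_ball_finite[of x r]
  by (simp add: set_lebesgue_integral_def less_top)

text \<open>
  Keep the maximizer \<open>y\<close> of the centre as a competitor at the other points of the ball. The resulting
  lower bound is quadratic, its linear part is odd and integrates to zero, and the quadratic part
  costs at most \<open>N r\<^sup>2\<close>.
\<close>

lemma sup_conv_ball_lower:
  fixes K :: "'a::euclidean_space set"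
  assumes K: "compact K" "K \<noteq> {}" and u: "continuous_on K u" and N: "N \<ge> 0" and r: "r > 0"
  defines "\<omega> \<equiv> measure lborel (ball (0::'a) 1)"
  shows "\<omega> * r ^ DIM('a) * sup_conv N K u x - N * (\<omega> * r ^ (DIM('a) + 2)) \<le>
    (LINT w:ball x r|lborel. sup_conv N K u w)"
proof -
  define v where "v = sup_conv N K u"
  have v: "continuous_on UNIV v" unfolding v_def using K u N by (rule continuous_on_sup_conv)
  obtain y where y: "y \<in> K" "v x = u y - N * (dist x y)\<^sup>2"
    using sup_conv_attained[OF K u] unfolding v_def by blast
  define e where "e = (2 * N) *\<^sub>R (x - y)"
  define c where "c = v x - N * r\<^sup>2"
  have low: "c - e \<bullet> h \<le> v (x + h)" if "h \<in> ball 0 r" for h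
  proof -
    have sq: "(dist (x + h) y)\<^sup>2 = (dist x y)\<^sup>2 + 2 * ((x - y) \<bullet> h) + (norm h)\<^sup>2"
      by (simp add: dist_norm power2_norm_eq_inner inner_simps inner_commute)
    have "u y - N * (dist (x + h) y)\<^sup>2 = v x - e \<bullet> h - N * (norm h)\<^sup>2"
      unfolding sq by (simp add: y(2) e_def algebra_simps)
    moreover have "N * (norm h)\<^sup>2 \<le> N * r\<^sup>2"
      using that N by (intro mult_left_mono power_mono) auto
    moreover have "u y - N * (dist (x + h) y)\<^sup>2 \<le> v (x + h)"
      unfolding v_def by (rule sup_conv_upper[OF K(1) u y(1)])
    ultimately show ?thesis unfolding c_def by linarith
  qed
  have int: "set_integrable lborel (ball 0 r) (\<lambda>h. v (x + h))" "set_integrable lborel (ball 0 r) (\<lambda>h. e \<bullet> h)"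
    by (intro set_integrable_ball_continuous continuous_intros continuous_on_compose2[OF v] subset_UNIV)+
  have "\<omega> * r ^ DIM('a) * c = (LINT h:ball 0 r|lborel. c - e \<bullet> h)"
    using set_integral_ball_odd[of "\<lambda>h. e \<bullet> h" r] set_integral_ball_const[OF r, of "0::'a" c]
    by (simp add: set_integral_diff(2)[OF set_integrable_const_ball int(2)] \<omega>_def)
  also have "\<dots> \<le> (LINT h:ball 0 r|lborel. v (x + h))"
    using low int by (intro set_integral_mono set_integral_diff set_integrable_const_ball)
  also have "\<dots> = (LINT w:ball x r|lborel. v w)"
    by (rule set_integral_ball_translate[OF v, symmetric])
  finally show ?thesis
    unfolding c_def v_def[symmetric] power_add by (simp add: algebra_simps)
qed

text \<open>
  Use the competitor \<open>y + h\<close> at the point \<open>x + h\<close>: the penalty is the same for all \<open>h\<close>, so ball means of the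
  sup-convolution about \<open>x\<close> dominate those of \<open>u\<close> about the maximizer \<open>y\<close>.
\<close>

lemma sup_conv_ball_lower_shift:
  fixes K :: "'a::euclidean_space set"
  assumes K: "compact K" and u: "continuous_on UNIV u" and N: "N \<ge> 0" and r: "r > 0"
    and y: "ball y r \<subseteq> K" "sup_conv N K u x = u y - N * (dist x y)\<^sup>2"
  defines "\<omega> \<equiv> measure lborel (ball (0::'a) 1)"
  shows "(LINT w:ball y r|lborel. u w) + \<omega> * r ^ DIM('a) * (sup_conv N K u x - u y) \<le>
    (LINT w:ball x r|lborel. sup_conv N K u w)"
proof -
  define v where "v = sup_conv N K u"
  have uK: "continuous_on K u" using u by (rule continuous_on_subset) auto
  have "y \<in> K" using y(1) r by auto
  then have v: "continuous_on UNIV v" unfolding v_def using K uK N by (intro continuous_on_sup_conv) auto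
  define c where "c = v x - u y"
  have low: "u (y + h) + c \<le> v (x + h)" if "h \<in> ball 0 r" for h
  proof -
    have "y + h \<in> K" using that y(1) by (auto simp: dist_norm)
    from sup_conv_upper[OF K uK this, of N "x + h"] show ?thesis
      by (simp add: c_def v_def y(2))
  qed
  have int: "set_integrable lborel (ball 0 r) (\<lambda>h. v (x + h))" "set_integrable lborel (ball 0 r) (\<lambda>h. u (y + h))"
    by (intro set_integrable_ball_continuous continuous_intros continuous_on_compose2[OF v] continuous_on_compose2[OF u] subset_UNIV)+
  have "(LINT w:ball y r|lborel. u w) + \<omega> * r ^ DIM('a) * c = (LINT h:ball 0 r|lborel. u (y + h) + c)"
    using set_integral_ball_const[OF r, of "0::'a" c]
    by (simp add: set_integral_add(2)[OF int(2) set_integrable_const_ball] \<omega>_def set_integral_ball_translate[OF u])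
  also have "\<dots> \<le> (LINT h:ball 0 r|lborel. v (x + h))"
    using low int by (intro set_integral_mono set_integral_add set_integrable_const_ball)
  also have "\<dots> = (LINT w:ball x r|lborel. v w)"
    by (rule set_integral_ball_translate[OF v, symmetric])
  finally show ?thesis unfolding c_def v_def .
qed

text \<open>
  The sup-convolutions over the ball of radius \<open>3R\<close> are weak subsolutions and decrease to \<open>u\<close> as the
  penalty grows. Three radii leave room for the support of the test function, which reaches
  distance \<open>2R\<close> from the centre, and for maximizers, which are less than \<open>R\<close> away.
\<close>

lemma weak_inequality_of_mean_value:
  fixes u :: "'a::euclidean_space \<Rightarrow> real" and A :: "real \<Rightarrow> real"
  defines "\<omega> \<equiv> measure lborel (ball (0::'a) 1)"
  assumes u: "continuous_on UNIV u" and M: "\<And>y. \<bar>u y\<bar> \<le> M"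
    and mv: "\<And>y. y \<in> ball x0 (3 * R) \<Longrightarrow>
      \<exists>\<rho>>0. \<forall>r. 0 < r \<and> r < \<rho> \<longrightarrow> (LINT w:ball y r|lborel. u w) = \<omega> * r ^ DIM('a) * A r * u y"
    and A: "((\<lambda>r. (A r - 1) / r\<^sup>2) \<longlongrightarrow> \<kappa> / (2 * (real DIM('a) + 2))) (at_right 0)" and \<kappa>: "\<kappa> > 0"
    and R: "R > 0" and x: "x \<in> ball x0 R" and s: "0 < s" "s \<le> R\<^sup>2"
  shows "(LINT y|lborel. u y * (cap_laplacian s (y - x) - \<kappa> * cap 3 s (y - x))) \<ge> 0"
proof -
  define m where "m = DIM('a)"
  have \<omega>: "\<omega> > 0" unfolding \<omega>_def by (rule measure_unit_ball_pos)
  define K where "K = cball x0 (3 * R)"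
  have K: "compact K" "K \<noteq> {}" using R by (auto simp: K_def)
  have uK: "continuous_on K u" using u by (rule continuous_on_subset) auto
  have M0: "M \<ge> 0" using M[of x0] by linarith
  define N0 where "N0 = (2 * M + 1) / R\<^sup>2"
  have N0: "N0 > 0" using M0 R by (simp add: N0_def add_nonneg_pos)
  define N where "N n = N0 + real n" for n
  have N: "N n > 0" "N n \<ge> N0" for n using N0 by (auto simp: N_def add_pos_nonneg)
  define v where "v n = sup_conv (N n) K u" for n
  have vc: "continuous_on UNIV (v n)" for n
    unfolding v_def using K uK N(1)[of n] by (intro continuous_on_sup_conv) auto
  have above: "u y \<le> v n y" if "y \<in> K" for y n
    using sup_conv_upper[OF K(1) uK that, of "N n" y] by (simp add: v_def)
  \<comment> \<open>A maximizer pays at most the oscillation \<open>2M\<close> in penalty; \<open>N0\<close> is chosen so that it is closer than \<open>R\<close>.\<close>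
  have maxi: "\<exists>z\<in>K. v n y = u z - N n * (dist y z)\<^sup>2 \<and> v n y \<le> u z \<and> N n * (dist y z)\<^sup>2 \<le> 2 * M \<and> dist y z < R"
    if y: "y \<in> K" for y n
  proof -
    obtain z where z: "z \<in> K" "v n y = u z - N n * (dist y z)\<^sup>2"
      using sup_conv_attained[OF K uK] unfolding v_def by blast
    have nn: "N n * (dist y z)\<^sup>2 \<ge> 0" using N(1)[of n] by simp
    have le: "N n * (dist y z)\<^sup>2 \<le> 2 * M"
      using above[OF y, of n] z(2) M[of y] M[of z] by linarith
    have "(dist y z)\<^sup>2 * N0 \<le> 2 * M"
      using le mult_right_mono[OF N(2)[of n], of "(dist y z)\<^sup>2"] by (simp add: mult.commute)
    also have "\<dots> < R\<^sup>2 * N0" using R by (simp add: N0_def)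
    finally have "(dist y z)\<^sup>2 < R\<^sup>2" using N0 by simp
    then have "dist y z < R" using R by (intro power_less_imp_less_base[of _ 2 R]) auto
    with z le nn show ?thesis by auto
  qed
  have vM: "\<bar>v n y\<bar> \<le> M" if y: "y \<in> K" for y n
    using maxi[OF y, of n] above[OF y, of n] M[of y] M by (smt (verit, ccfv_threshold) abs_le_iff)
  \<comment> \<open>Here \<open>\<kappa> > 0\<close> enters: \<open>A r \<ge> 1\<close> lets the value at the maximizer be replaced by the smaller one of the sup-convolution.\<close>
  have "\<forall>\<^sub>F r in at_right 0. (A r - 1) / r\<^sup>2 > 0"
    using \<kappa> by (intro order_tendstoD(1)[OF A] divide_pos_pos) (auto simp: add_nonneg_pos)
  then obtain \<rho>A where \<rho>A: "\<rho>A > 0" "\<And>r. 0 < r \<Longrightarrow> r < \<rho>A \<Longrightarrow> (A r - 1) / r\<^sup>2 > 0"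
    unfolding eventually_at_right_field by auto
  have A1: "A r - 1 > 0" if "0 < r" "r < \<rho>A" for r
    using \<rho>A(2)[OF that] that by (simp add: zero_less_divide_iff)
  define k where "k y = cap_laplacian s (y - x) - \<kappa> * cap 3 s (y - x)" for y
  have kc: "continuous_on UNIV k" unfolding k_def by (intro continuous_intros)
  have inR: "dist y x < R" if "(norm (y - x))\<^sup>2 < s" for y
    using that s R by (intro power_less_imp_less_base[of _ 2 R]) (auto simp: dist_norm)
  have k0: "k y = 0" if "y \<notin> ball x R" for y
  proof -
    have "s \<le> (norm (y - x))\<^sup>2" using inR[of y] that by (auto simp: dist_commute not_less[symmetric])
    then show ?thesis by (simp add: k_def cap_laplacian_eq_0 cap_eq_0)
  qed
  have near: "y \<in> ball x0 (2 * R)" if "y \<in> ball x R" for y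
    using that x dist_triangle[of x0 y x] by auto
  have weak: "(LINT y|lborel. v n y * k y) \<ge> 0" for n
    unfolding k_def
  proof (rule weak_subsolution[where N = "N n" and A = A, OF vc s(1)])
    show "0 \<le> N n" using N(1)[of n] by simp
    show "measure lborel (ball (0::'a) 1) * r ^ DIM('a) * v n y - N n * (measure lborel (ball (0::'a) 1) * r ^ (DIM('a) + 2))
        \<le> (LINT w:ball y r|lborel. v n w)" if "r > 0" for y r
      unfolding v_def using K uK N(1)[of n] that by (intro sup_conv_ball_lower) auto
    show "\<exists>\<rho>>0. \<forall>r. 0 < r \<and> r < \<rho> \<longrightarrow> measure lborel (ball (0::'a) 1) * r ^ DIM('a) * (v n y + (A r - 1) * v n y)
        \<le> (LINT w:ball y r|lborel. v n w)" if "(norm (y - x))\<^sup>2 < s" for y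
    proof -
      have y2: "y \<in> ball x0 (2 * R)" using near[of y] inR[OF that] by (simp add: dist_commute)
      then have yK: "y \<in> K" using R by (auto simp: K_def)
      obtain z where z: "z \<in> K" "v n y = u z - N n * (dist y z)\<^sup>2" "v n y \<le> u z" "dist y z < R"
        using maxi[OF yK, of n] by auto
      have z3: "z \<in> ball x0 (3 * R)" using y2 z(4) dist_triangle[of x0 z y] by auto
      then obtain d where d: "d > 0" "ball z d \<subseteq> ball x0 (3 * R)"
        using openE[OF open_ball z3] by blast
      obtain \<rho> where \<rho>: "\<rho> > 0" "\<And>r. 0 < r \<Longrightarrow> r < \<rho> \<Longrightarrow> (LINT w:ball z r|lborel. u w) = \<omega> * r ^ DIM('a) * A r * u z"
        using mv[OF z3] by auto
      show ?thesis
      proof (intro exI[of _ "min d (min \<rho> \<rho>A)"] conjI allI impI)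
        show "min d (min \<rho> \<rho>A) > 0" using d \<rho> \<rho>A by simp
        fix r assume r: "0 < r \<and> r < min d (min \<rho> \<rho>A)"
        have "ball z r \<subseteq> ball z d" using r by (intro subset_ball) simp
        with d(2) ball_subset_cball[of x0 "3 * R"] have "ball z r \<subseteq> K" unfolding K_def by blast
        then have "(LINT w:ball z r|lborel. u w) + \<omega> * r ^ DIM('a) * (v n y - u z) \<le> (LINT w:ball y r|lborel. v n w)"
          unfolding v_def \<omega>_def using K(1) u N(1)[of n] r z(2)
          by (intro sup_conv_ball_lower_shift) (auto simp: v_def)
        moreover have "(LINT w:ball z r|lborel. u w) + \<omega> * r ^ DIM('a) * (v n y - u z) =
            \<omega> * r ^ DIM('a) * (v n y + (A r - 1) * u z)"
          using \<rho>(2)[of r] r by (simp add: algebra_simps)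
        moreover have "\<omega> * r ^ DIM('a) * (v n y + (A r - 1) * v n y) \<le> \<omega> * r ^ DIM('a) * (v n y + (A r - 1) * u z)"
          using \<omega> r A1[of r] z(3) by (intro mult_left_mono add_left_mono) auto
        ultimately show "measure lborel (ball (0::'a) 1) * r ^ DIM('a) * (v n y + (A r - 1) * v n y)
            \<le> (LINT w:ball y r|lborel. v n w)"
          unfolding \<omega>_def by linarith
      qed
    qed
    show "((\<lambda>r. (A r - 1) / r\<^sup>2) \<longlongrightarrow> \<kappa> / (2 * (real DIM('a) + 2))) (at_right 0)" by (rule A)
  qed
  have vlim: "(\<lambda>n. v n y) \<longlonglongrightarrow> u y" if y: "y \<in> K" for y
  proof (rule LIMSEQ_I)
    fix e :: real assume e: "e > 0"
    have "isCont u y" using u by (simp add: continuous_on_eq_continuous_at)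
    then obtain d where d: "d > 0" "\<And>z. dist z y < d \<Longrightarrow> dist (u z) (u y) < e"
      using e unfolding continuous_at_eps_delta by blast
    obtain n0 where n0: "real n0 > 2 * M / d\<^sup>2" using reals_Archimedean2 by blast
    have "norm (v n y - u y) < e" if n: "n \<ge> n0" for n
    proof -
      obtain z where z: "v n y \<le> u z" "N n * (dist y z)\<^sup>2 \<le> 2 * M"
        using maxi[OF y, of n] by auto
      have "2 * M / d\<^sup>2 < N n" using n0 n N0 unfolding N_def by linarith
      then have "2 * M < N n * d\<^sup>2" using d(1) by (simp add: divide_less_eq)
      with z(2) have "N n * (dist y z)\<^sup>2 < N n * d\<^sup>2" by linarith
      then have "(dist y z)\<^sup>2 < d\<^sup>2" using N(1)[of n] by simp
      then have "dist y z < d" using d(1) by (intro power_less_imp_less_base[of _ 2 d]) auto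
      then have "\<bar>u z - u y\<bar> < e" using d(2)[of z] by (simp add: dist_commute dist_real_def)
      then show ?thesis using above[OF y, of n] z(1) by simp
    qed
    then show "\<exists>no. \<forall>n\<ge>no. norm (v n y - u y) < e" by blast
  qed
  have inK: "y \<in> K" if "k y \<noteq> 0" for y
  proof -
    have "y \<in> ball x R" using k0[of y] that by blast
    from near[OF this] show ?thesis using R by (auto simp: K_def)
  qed
  have "(\<lambda>n. LINT y|lborel. v n y * k y) \<longlonglongrightarrow> (LINT y|lborel. u y * k y)"
  proof (rule integral_dominated_convergence[where w = "\<lambda>y. M * \<bar>k y\<bar>"])
    show "integrable lborel (\<lambda>y. M * \<bar>k y\<bar>)"
    proof (rule integrable_continuous_compact_support[where x = x and R = R])
      show "continuous_on UNIV (\<lambda>y. M * \<bar>k y\<bar>)" using kc by (intro continuous_intros)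
      show "M * \<bar>k y\<bar> = 0" if "y \<notin> cball x R" for y using k0[of y] that by simp
    qed
    have "continuous_on UNIV (\<lambda>y. u y * k y)" using u kc by (intro continuous_intros)
    from borel_measurable_continuous_onI[OF this] show "(\<lambda>y. u y * k y) \<in> borel_measurable lborel" by simp
    have "continuous_on UNIV (\<lambda>y. v n y * k y)" for n using vc kc by (intro continuous_intros)
    from borel_measurable_continuous_onI[OF this] show "(\<lambda>y. v n y * k y) \<in> borel_measurable lborel" for n by simp
    have "(\<lambda>n. v n y * k y) \<longlonglongrightarrow> u y * k y" for y
      using vlim[of y] inK[of y] by (cases "k y = 0") (auto intro: tendsto_mult_right)
    then show "AE y in lborel. (\<lambda>n. v n y * k y) \<longlonglongrightarrow> u y * k y" by simp
    have "norm (v n y * k y) \<le> M * \<bar>k y\<bar>" for n y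
      using vM[of y n] inK[of y] by (cases "k y = 0") (auto simp: abs_mult intro: mult_right_mono)
    then show "\<And>n. AE y in lborel. norm (v n y * k y) \<le> M * \<bar>k y\<bar>" by simp
  qed
  then have "(LINT y|lborel. u y * k y) \<ge> 0"
    by (rule LIMSEQ_le_const) (use weak in auto)
  then show ?thesis by (simp add: k_def)
qed

lemma weak_equation_of_mean_value:
  fixes u :: "'a::euclidean_space \<Rightarrow> real" and A :: "real \<Rightarrow> real"
  defines "\<omega> \<equiv> measure lborel (ball (0::'a) 1)"
  assumes u: "continuous_on UNIV u" and M: "\<And>y. \<bar>u y\<bar> \<le> M"
    and mv: "\<And>y. y \<in> ball x0 (3 * R) \<Longrightarrow>
      \<exists>\<rho>>0. \<forall>r. 0 < r \<and> r < \<rho> \<longrightarrow> (LINT w:ball y r|lborel. u w) = \<omega> * r ^ DIM('a) * A r * u y"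
    and A: "((\<lambda>r. (A r - 1) / r\<^sup>2) \<longlongrightarrow> \<kappa> / (2 * (real DIM('a) + 2))) (at_right 0)" and \<kappa>: "\<kappa> > 0"
    and R: "R > 0" and x: "x \<in> ball x0 R" and s: "0 < s" "s \<le> R\<^sup>2"
  shows "(LINT y|lborel. u y * (cap_laplacian s (y - x) - \<kappa> * cap 3 s (y - x))) = 0"
proof (rule antisym)
  show "(LINT y|lborel. u y * (cap_laplacian s (y - x) - \<kappa> * cap 3 s (y - x))) \<ge> 0"
    using weak_inequality_of_mean_value[OF u M mv[unfolded \<omega>_def] A \<kappa> R x s] by blast
  have "(LINT y|lborel. - u y * (cap_laplacian s (y - x) - \<kappa> * cap 3 s (y - x))) \<ge> 0"
  proof (rule weak_inequality_of_mean_value[OF _ _ _ A \<kappa> R x s])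
    show "continuous_on UNIV (\<lambda>y. - u y)" using u by (intro continuous_intros)
    show "\<bar>- u y\<bar> \<le> M" for y using M[of y] by simp
    show "\<exists>\<rho>>0. \<forall>r. 0 < r \<and> r < \<rho> \<longrightarrow> (LINT w:ball y r|lborel. - u w) =
        measure lborel (ball (0::'a) 1) * r ^ DIM('a) * A r * - u y" if "y \<in> ball x0 (3 * R)" for y
      using mv[OF that] by (auto simp: set_lebesgue_integral_def \<omega>_def)
  qed
  then show "(LINT y|lborel. u y * (cap_laplacian s (y - x) - \<kappa> * cap 3 s (y - x))) \<le> 0"
    by simp
qed

section \<open>Uniqueness tools in the radial variable\<close>

text \<open>
  The energy \<open>y\<^sup>2 + z\<^sup>2\<close> grows at most exponentially, hence stays zero.
\<close>

lemma second_order_ode_unique: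
  fixes y z z' :: "real \<Rightarrow> real"
  assumes y: "\<And>s. start \<le> s \<Longrightarrow> s \<le> S \<Longrightarrow> (y has_real_derivative z s) (at s)"
    and z: "\<And>s. start \<le> s \<Longrightarrow> s \<le> S \<Longrightarrow> (z has_real_derivative z' s) (at s)"
    and bound: "\<And>s. start \<le> s \<Longrightarrow> s \<le> S \<Longrightarrow> \<bar>z' s\<bar> \<le> a * (\<bar>y s\<bar> + \<bar>z s\<bar>)"
    and init: "y start = 0" "z start = 0" and "start \<le> S" "a \<ge> 0"
  shows "y S = 0"
proof -
  \<comment> \<open>Since \<open>2|yz| \<le> y\<^sup>2 + z\<^sup>2\<close>, the energy has derivative at most \<open>1 + 3a\<close> times itself.\<close>
  define C where "C = 1 + 3 * a"
  define E where "E s = exp (- C * s) * (y s * y s + z s * z s)" for s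
  have algebra: "x * (- C) * (Y * Y + Z * Z) + ((Z * Y + Z * Y) + (w * Z + w * Z)) * x =
      x * (2 * (Y * Z) + 2 * (Z * w) - C * (Y * Y + Z * Z))" for x Y Z w :: real
    by algebra
  have energy: "2 * (Y * Z) + 2 * (Z * w) - C * (Y * Y + Z * Z) \<le> 0"
    if w: "\<bar>w\<bar> \<le> a * (\<bar>Y\<bar> + \<bar>Z\<bar>)" for Y Z w :: real
  proof -
    have yz: "2 * (\<bar>Y\<bar> * \<bar>Z\<bar>) \<le> Y * Y + Z * Z"
      using sum_squares_bound[of "\<bar>Y\<bar>" "\<bar>Z\<bar>"] by (simp add: power2_eq_square)
    have "Z * w \<le> \<bar>Z\<bar> * \<bar>w\<bar>" by (metis abs_ge_self abs_mult)
    also have "\<dots> \<le> \<bar>Z\<bar> * (a * (\<bar>Y\<bar> + \<bar>Z\<bar>))"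
      using w by (intro mult_left_mono) auto
    also have "\<dots> = a * (\<bar>Y\<bar> * \<bar>Z\<bar> + \<bar>Z\<bar> * \<bar>Z\<bar>)" by algebra
    also have "\<bar>Z\<bar> * \<bar>Z\<bar> = Z * Z" by (rule abs_mult_self_eq)
    finally have zw: "Z * w \<le> a * (\<bar>Y\<bar> * \<bar>Z\<bar> + Z * Z)" .
    have "2 * (\<bar>Y\<bar> * \<bar>Z\<bar> + Z * Z) \<le> 3 * (Y * Y + Z * Z)"
      using yz zero_le_square[of Y] unfolding distrib_left by linarith
    then have "a * (2 * (\<bar>Y\<bar> * \<bar>Z\<bar> + Z * Z)) \<le> a * (3 * (Y * Y + Z * Z))"
      using \<open>a \<ge> 0\<close> by (rule mult_left_mono)
    moreover have "a * (2 * (\<bar>Y\<bar> * \<bar>Z\<bar> + Z * Z)) = 2 * (a * (\<bar>Y\<bar> * \<bar>Z\<bar> + Z * Z))" by algebra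
    moreover have "2 * (Y * Z) \<le> 2 * (\<bar>Y\<bar> * \<bar>Z\<bar>)" using abs_ge_self[of "Y * Z"] by (simp add: abs_mult)
    moreover have "C * (Y * Y + Z * Z) = (Y * Y + Z * Z) + a * (3 * (Y * Y + Z * Z))"
      unfolding C_def by algebra
    ultimately show ?thesis using zw yz by linarith
  qed
  have "E S \<le> E start"
  proof (rule DERIV_nonpos_imp_nonincreasing[OF \<open>start \<le> S\<close>])
    fix s assume s: "start \<le> s" "s \<le> S"
    have e: "((\<lambda>s. exp (- C * s)) has_real_derivative exp (- C * s) * (- C)) (at s)"
      by (rule DERIV_chain2[OF DERIV_exp]) (auto intro!: derivative_eq_intros)
    have q: "((\<lambda>s. y s * y s + z s * z s) has_real_derivative
        (z s * y s + z s * y s) + (z' s * z s + z' s * z s)) (at s)"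
      by (intro DERIV_add DERIV_mult y z s)
    have "(E has_real_derivative exp (- C * s) * (2 * (y s * z s) + 2 * (z s * z' s) - C * (y s * y s + z s * z s))) (at s)"
      using DERIV_mult[OF e q] unfolding E_def[abs_def] algebra .
    moreover have "exp (- C * s) * (2 * (y s * z s) + 2 * (z s * z' s) - C * (y s * y s + z s * z s)) \<le> 0"
      by (intro mult_nonneg_nonpos energy bound s) simp
    ultimately show "\<exists>d. (E has_real_derivative d) (at s) \<and> d \<le> 0" by blast
  qed
  then have "exp (- C * S) * (y S * y S + z S * z S) \<le> 0" by (simp add: E_def init)
  then have "y S * y S + z S * z S \<le> 0"
    using exp_gt_zero[of "- C * S"] by (metis mult_le_0_iff not_less)
  then show ?thesis by (simp add: sum_squares_le_zero_iff)
qed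

text \<open>
  On the sphere of radius \<open>r\<close> the weight is the constant \<open>k(r)\<close>.
\<close>

lemma integral_radial_weight_derivative:
  fixes u :: "'a::euclidean_space \<Rightarrow> real" and k :: "real \<Rightarrow> real"
  assumes u: "continuous_on UNIV u" and k: "continuous_on UNIV k" and r: "r > 0"
  shows "((\<lambda>r. LINT y:ball x r|lborel. u y * k (dist x y)) has_real_derivative
    k r * (real DIM('a) * r ^ (DIM('a) - 1) * (LINT y:ball 0 1|lborel. u (x + r *\<^sub>R sgn y)))) (at r)"
proof -
  have uk: "continuous_on UNIV (\<lambda>y. u y * k (dist x y))"
    using u by (intro continuous_intros continuous_on_compose2[OF k]) auto
  have um: "u \<in> borel_measurable borel" "k \<in> borel_measurable borel"
    using u k by (auto intro: borel_measurable_continuous_onI)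
  note um[measurable] sgn_borel_measurable[measurable]
  have "(LINT y:ball 0 1|lborel. u (x + r *\<^sub>R sgn y) * k (dist x (x + r *\<^sub>R sgn y))) =
      (LINT y:ball 0 1|lborel. k r * u (x + r *\<^sub>R sgn y))"
    unfolding set_lebesgue_integral_def
  proof (rule integral_cong_AE)
    show "AE y in lborel. indicat_real (ball 0 1) y *\<^sub>R (u (x + r *\<^sub>R sgn y) * k (dist x (x + r *\<^sub>R sgn y))) =
        indicat_real (ball 0 1) y *\<^sub>R (k r * u (x + r *\<^sub>R sgn y))"
      using AE_lborel_singleton[of "0::'a"]
      by eventually_elim (use r in \<open>simp add: dist_norm norm_sgn\<close>)
    show "(\<lambda>y. indicat_real (ball 0 1) y *\<^sub>R (u (x + r *\<^sub>R sgn y) * k (dist x (x + r *\<^sub>R sgn y)))) \<in> borel_measurable lborel"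
      by (measurable, auto)
    show "(\<lambda>y. indicat_real (ball 0 1) y *\<^sub>R (k r * u (x + r *\<^sub>R sgn y))) \<in> borel_measurable lborel"
      by (measurable, auto)
  qed
  also have "\<dots> = k r * (LINT y:ball 0 1|lborel. u (x + r *\<^sub>R sgn y))"
    by (rule set_integral_mult_right)
  finally have eq: "(LINT y:ball 0 1|lborel. u (x + r *\<^sub>R sgn y) * k (dist x (x + r *\<^sub>R sgn y))) =
      k r * (LINT y:ball 0 1|lborel. u (x + r *\<^sub>R sgn y))" .
  show ?thesis
    using has_derivative_ball_integral[OF uk r, of x] unfolding eq mult.left_commute[of _ "k r"] .
qed

text \<open>
  If the plain ball integrals about two points are proportional for all small radii, so are their
  derivatives, the sphere integrals, and therefore all integrals with a radial weight.
\<close>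

lemma radial_weight_proportional:
  fixes u :: "'a::euclidean_space \<Rightarrow> real" and k :: "real \<Rightarrow> real"
  assumes u: "continuous_on UNIV u" and k: "continuous_on UNIV k"
    and proportional: "\<And>r. 0 < r \<Longrightarrow> r < \<sigma> \<Longrightarrow>
      (LINT y:ball x r|lborel. u y) * b = (LINT y:ball x' r|lborel. u y) * a"
    and r: "0 < r" "r < \<sigma>"
  shows "(LINT y:ball x r|lborel. u y * k (dist x y)) * b = (LINT y:ball x' r|lborel. u y * k (dist x' y)) * a"
proof -
  define m where "m = DIM('a)"
  define S where "S x r = real m * r ^ (m - 1) * (LINT y:ball 0 1|lborel. u (x + r *\<^sub>R sgn y))" for x r
  define F where "F x r = (LINT y:ball x r|lborel. u y * k (dist x y))" for x r
  define D where "D r = F x r * b - F x' r * a" for r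
  have F': "(F x has_real_derivative k r * S x r) (at r)" if "r > 0" for x r
    unfolding F_def[abs_def] S_def m_def using u k that by (rule integral_radial_weight_derivative)
  have "(D has_real_derivative 0) (at r)" if r: "0 < r" "r < \<sigma>" for r
  proof -
    have V': "((\<lambda>r. LINT y:ball x r|lborel. u y) has_real_derivative S x r) (at r)" for x
      unfolding S_def m_def using u r(1) by (rule has_derivative_ball_integral)
    have "((\<lambda>r. (LINT y:ball x r|lborel. u y) * b - (LINT y:ball x' r|lborel. u y) * a)
        has_real_derivative (S x r * b - S x' r * a)) (at r)"
      by (intro DERIV_diff DERIV_cmult_right V')
    moreover have "((\<lambda>r. (LINT y:ball x r|lborel. u y) * b - (LINT y:ball x' r|lborel. u y) * a)
        has_real_derivative 0) (at r)"
    proof (rule has_field_derivative_transform_within_open[where f = "\<lambda>_. 0" and S = "{0<..<\<sigma>}"])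
      show "0 = (LINT y:ball x q|lborel. u y) * b - (LINT y:ball x' q|lborel. u y) * a" if "q \<in> {0<..<\<sigma>}" for q
        using proportional[of q] that by simp
    qed (use r in auto)
    ultimately have "S x r * b - S x' r * a = 0" by (rule DERIV_unique)
    then have "k r * S x r * b - k r * S x' r * a = 0"
      by (metis mult.assoc mult_zero_right right_diff_distrib)
    moreover have "(D has_real_derivative k r * S x r * b - k r * S x' r * a) (at r)"
      unfolding D_def[abs_def] by (intro DERIV_diff DERIV_cmult_right F' r(1))
    ultimately show ?thesis by (simp only:)
  qed
  then have "\<exists>c. \<forall>r\<in>{0<..<\<sigma>}. D r = c"
    by (intro has_field_derivative_zero_constant) (auto intro: has_field_derivative_at_within)
  then obtain c where c: "\<And>r. 0 < r \<Longrightarrow> r < \<sigma> \<Longrightarrow> D r = c" by auto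
  have uk: "continuous_on UNIV (\<lambda>y. u y * k (dist x y))" for x
    using u by (intro continuous_intros continuous_on_compose2[OF k]) auto
  have F0: "(F x \<longlongrightarrow> 0) (at_right 0)" for x
  proof -
    have "((\<lambda>r. F x r / r ^ m * r ^ m) \<longlongrightarrow> measure lborel (ball (0::'a) 1) * (u x * k (dist x x)) * 0 ^ m) (at_right 0)"
      unfolding F_def m_def by (intro tendsto_mult tendsto_ball_average[OF uk] tendsto_power tendsto_ident_at)
    moreover have "\<forall>\<^sub>F r in at_right 0. F x r / r ^ m * r ^ m = F x r"
      by (auto simp: eventually_at_filter)
    ultimately have "(F x \<longlongrightarrow> measure lborel (ball (0::'a) 1) * (u x * k (dist x x)) * 0 ^ m) (at_right 0)"
      by (rule Lim_transform_eventually)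
    then show ?thesis by (simp add: m_def zero_power)
  qed
  have "(D \<longlongrightarrow> 0 * b - 0 * a) (at_right 0)"
    unfolding D_def[abs_def] by (intro tendsto_diff tendsto_mult_right F0)
  then have "(D \<longlongrightarrow> 0) (at_right 0)" by simp
  moreover have "\<forall>\<^sub>F r in at_right 0. D r = c"
    unfolding eventually_at_right_field using c r by (intro exI[of _ \<sigma>]) auto
  then have "(D \<longlongrightarrow> c) (at_right 0)"
    by (rule tendsto_eventually)
  ultimately have "c = 0"
    by (intro tendsto_unique[OF trivial_limit_at_right_real, of D])
  with c[OF r] show ?thesis by (simp add: D_def F_def)
qed

section \<open>Integrals against truncated powers\<close>

lemma lborel_integral_eq_cbox_integral:
  fixes f :: "'a::euclidean_space \<Rightarrow> real"
  assumes "continuous_on UNIV f" "\<And>y. y \<notin> cbox a b \<Longrightarrow> f y = 0"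
  shows "(LINT y|lborel. f y) = integral (cbox a b) f"
proof -
  have "set_integrable lborel (cbox a b) f"
    unfolding set_integrable_def using assms(1)
    by (intro borel_integrable_compact) (auto intro: continuous_on_subset)
  then have "(LINT y:cbox a b|lborel. f y) = integral (cbox a b) f"
    by (rule set_borel_integral_eq_integral(2))
  moreover have "(\<lambda>y. indicator (cbox a b) y *\<^sub>R f y) = f"
    using assms(2) by (auto simp: indicator_def fun_eq_iff)
  ultimately show ?thesis by (simp add: set_lebesgue_integral_def)
qed

lemma cball_subset_cbox: "\<exists>a b. cball x R \<subseteq> cbox a (b::'a::euclidean_space)"
  using bounded_subset_cbox_symmetric[OF bounded_cball[of x R]] by blast

lemma has_derivative_parametric_integral:
  fixes f f' :: "real \<Rightarrow> 'a::euclidean_space \<Rightarrow> real"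
  assumes der: "\<And>t y. ((\<lambda>t. f t y) has_real_derivative f' t y) (at t)"
    and cont: "\<And>t. continuous_on UNIV (f t)" "continuous_on UNIV (\<lambda>(t, y). f' t y)"
    and supp: "\<And>t y. \<bar>t - t0\<bar> \<le> 1 \<Longrightarrow> y \<notin> cball x R \<Longrightarrow> f t y = 0 \<and> f' t y = 0"
  shows "((\<lambda>t. LINT y|lborel. f t y) has_real_derivative (LINT y|lborel. f' t0 y)) (at t0)"
proof -
  obtain a b where ab: "cball x R \<subseteq> cbox a b" using cball_subset_cbox by blast
  have c': "continuous_on UNIV (f' t)" for t
    using continuous_on_compose2[OF cont(2), of UNIV "\<lambda>y. (t, y)"] by (simp add: continuous_intros)
  have supp': "f t y = 0" "f' t y = 0" if "\<bar>t - t0\<bar> \<le> 1" "y \<notin> cbox a b" for t y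
    using supp[OF that(1), of y] that(2) ab by blast+
  have eq: "(LINT y|lborel. f t y) = integral (cbox a b) (f t)" if "\<bar>t - t0\<bar> \<le> 1" for t
    by (intro lborel_integral_eq_cbox_integral cont supp' that)
  have eq': "(LINT y|lborel. f' t0 y) = integral (cbox a b) (f' t0)"
    by (intro lborel_integral_eq_cbox_integral c' supp') simp
  have "((\<lambda>t. integral (cbox a b) (f t)) has_real_derivative integral (cbox a b) (f' t0)) (at t0 within UNIV)"
  proof (rule leibniz_rule_field_derivative)
    show "f t integrable_on cbox a b" for t
      by (rule integrable_continuous[OF continuous_on_subset[OF cont(1)]]) simp
    show "continuous_on (UNIV \<times> cbox a b) (\<lambda>(t, y). f' t y)"
      by (rule continuous_on_subset[OF cont(2)]) simp
  qed (simp_all add: der)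
  then show ?thesis
    unfolding eq'
    by (rule has_field_derivative_transform_within_open[where S = "ball t0 1"])
       (auto simp: eq dist_real_def abs_minus_commute)
qed

lemma has_derivative_positive_part_power:
  "((\<lambda>t. (max 0 t) ^ Suc (Suc n)) has_real_derivative real (Suc (Suc n)) * (max 0 t) ^ Suc n) (at t)"
proof -
  consider "t > 0" | "t < 0" | "t = 0" by linarith
  then show ?thesis
  proof cases
    case 1
    have "((\<lambda>t. t ^ Suc (Suc n)) has_real_derivative real (Suc (Suc n)) * t ^ Suc n) (at t)"
      by (auto intro!: derivative_eq_intros simp del: power_Suc)
    then have "((\<lambda>t. (max 0 t) ^ Suc (Suc n)) has_real_derivative real (Suc (Suc n)) * t ^ Suc n) (at t)"
      by (rule has_field_derivative_transform_within_open[where S = "{0<..}"]) (use 1 in \<open>auto simp del: power_Suc\<close>)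
    with 1 show ?thesis by (simp del: power_Suc)
  next
    case 2
    have "((\<lambda>t. (max 0 t) ^ Suc (Suc n)) has_real_derivative 0) (at t)"
      by (rule has_field_derivative_transform_within_open[where f = "\<lambda>_. 0" and S = "{..<0}"]) (use 2 in auto)
    with 2 show ?thesis by simp
  next
    case 3
    have "((\<lambda>h. (max 0 h) ^ Suc n) \<longlongrightarrow> (max 0 0) ^ Suc n) (at (0::real))"
      by (intro tendsto_intros)
    moreover have "\<forall>\<^sub>F h in at (0::real). (max 0 h) ^ Suc n = ((max 0 h) ^ Suc (Suc n) - (max 0 0) ^ Suc (Suc n)) / (h - 0)"
      by (auto simp: eventually_at_filter max_def)
    ultimately have "((\<lambda>h. ((max 0 h) ^ Suc (Suc n) - (max 0 0) ^ Suc (Suc n)) / (h - 0)) \<longlongrightarrow> (max 0 0) ^ Suc n) (at (0::real))"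
      by (rule Lim_transform_eventually)
    then show ?thesis unfolding has_field_derivative_iff 3 by simp
  qed
qed

definition cap_integral :: "('a::euclidean_space \<Rightarrow> real) \<Rightarrow> nat \<Rightarrow> 'a \<Rightarrow> real \<Rightarrow> real" where
  "cap_integral u p x s = (LINT y|lborel. u y * cap p s (y - x))"

lemma integrable_mult_cap:
  fixes u :: "'a::euclidean_space \<Rightarrow> real"
  assumes "continuous_on UNIV u" "p > 0"
  shows "integrable lborel (\<lambda>y. u y * cap p s (y - x))"
proof (rule integrable_continuous_compact_support[where x = x and R = "1 + \<bar>s\<bar>"])
  show "continuous_on UNIV (\<lambda>y. u y * cap p s (y - x))"
    using assms(1) by (intro continuous_intros)
  fix y assume "y \<notin> cball x (1 + \<bar>s\<bar>)"
  then have n: "norm (y - x) \<ge> 1 + \<bar>s\<bar>" by (simp add: dist_norm norm_minus_commute)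
  then have "(norm (y - x))\<^sup>2 \<ge> norm (y - x) * 1" unfolding power2_eq_square by (intro mult_left_mono) auto
  with n have "(norm (y - x))\<^sup>2 \<ge> s" by linarith
  then show "u y * cap p s (y - x) = 0" using assms(2) by (simp add: cap_eq_0)
qed

lemma has_derivative_cap_integral:
  fixes u :: "'a::euclidean_space \<Rightarrow> real"
  assumes u: "continuous_on UNIV u"
  shows "(cap_integral u (Suc (Suc n)) x has_real_derivative real (Suc (Suc n)) * cap_integral u (Suc n) x s) (at s)"
proof -
  define f where "f t y = u y * cap (Suc (Suc n)) t (y - x)" for t y
  define f' where "f' t y = u y * (real (Suc (Suc n)) * cap (Suc n) t (y - x))" for t y
  have "((\<lambda>t. LINT y|lborel. f t y) has_real_derivative (LINT y|lborel. f' s y)) (at s)"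
  proof (rule has_derivative_parametric_integral[where x = x and R = "2 + \<bar>s\<bar>"])
    show "((\<lambda>t. f t y) has_real_derivative f' t y) (at t)" for t y
    proof -
      have "((\<lambda>t. t - (norm (y - x))\<^sup>2) has_real_derivative 1) (at t)"
        by (auto intro!: derivative_eq_intros)
      from DERIV_chain2[OF has_derivative_positive_part_power this, of n]
      have "((\<lambda>t. cap (Suc (Suc n)) t (y - x)) has_real_derivative real (Suc (Suc n)) * cap (Suc n) t (y - x)) (at t)"
        unfolding cap_def by (simp only: mult_1_right)
      then show ?thesis unfolding f_def f'_def by (rule DERIV_cmult)
    qed
    show "continuous_on UNIV (f t)" for t
      unfolding f_def using u by (intro continuous_intros)
    show "continuous_on UNIV (\<lambda>(t, y). f' t y)"
      unfolding f'_def case_prod_beta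
      by (intro continuous_intros continuous_on_compose2[OF u]) auto
    show "f t y = 0 \<and> f' t y = 0" if t: "\<bar>t - s\<bar> \<le> 1" and y: "y \<notin> cball x (2 + \<bar>s\<bar>)" for t y
    proof -
      have n: "norm (y - x) \<ge> 2 + \<bar>s\<bar>" using y by (simp add: dist_norm norm_minus_commute)
      then have "(norm (y - x))\<^sup>2 \<ge> norm (y - x) * 1" unfolding power2_eq_square by (intro mult_left_mono) auto
      with n t have "(norm (y - x))\<^sup>2 \<ge> t" by linarith
      then show ?thesis by (simp add: f_def f'_def cap_eq_0)
    qed
  qed
  moreover have "(LINT y|lborel. f' s y) = real (Suc (Suc n)) * cap_integral u (Suc n) x s"
  proof -
    have "f' s y = real (Suc (Suc n)) * (u y * cap (Suc n) s (y - x))" for y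
      by (simp only: f'_def mult_ac)
    then show ?thesis unfolding cap_integral_def by simp
  qed
  moreover have "(\<lambda>t. LINT y|lborel. f t y) = cap_integral u (Suc (Suc n)) x"
    by (simp add: fun_eq_iff cap_integral_def f_def)
  ultimately show ?thesis by (simp only:)
qed

lemma cap_integral_eq_ball:
  fixes u :: "'a::euclidean_space \<Rightarrow> real"
  assumes "r > 0" "p > 0"
  shows "cap_integral u p x (r\<^sup>2) = (LINT y:ball x r|lborel. u y * (r\<^sup>2 - (dist x y)\<^sup>2) ^ p)"
  unfolding cap_integral_def set_lebesgue_integral_def
proof (rule Bochner_Integration.integral_cong)
  fix y
  show "u y * cap p (r\<^sup>2) (y - x) = indicat_real (ball x r) y *\<^sub>R (u y * (r\<^sup>2 - (dist x y)\<^sup>2) ^ p)"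
  proof (cases "dist x y < r")
    case True
    then have "(dist x y)\<^sup>2 \<le> r\<^sup>2" by (intro power_mono) auto
    then show ?thesis using True by (simp add: cap_def dist_norm norm_minus_commute max_def)
  next
    case False
    then have "r\<^sup>2 \<le> (dist x y)\<^sup>2" using assms(1) by (intro power_mono) auto
    then show ?thesis using False assms(2) by (simp add: cap_eq_0 dist_norm norm_minus_commute)
  qed
qed simp

text \<open>
  The first conclusion is the weak equation. For the second one, the local mean value property
  makes the integrals of \<open>u\<close> against any radial weight about \<open>x\<close> and about \<open>x'\<close> proportional to the
  central values, but only for radii that are small depending on \<open>x\<close> and \<open>x'\<close>. The weak equation
  is a linear ordinary differential equation in \<open>s\<close> and propagates this to all \<open>s\<close> up to \<open>R\<^sup>2\<close>.
\<close>

lemma cap_integral_of_mean_value: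
  fixes u :: "'a::euclidean_space \<Rightarrow> real" and A :: "real \<Rightarrow> real"
  defines "\<omega> \<equiv> measure lborel (ball (0::'a) 1)"
  assumes u: "continuous_on UNIV u" and M: "\<And>y. \<bar>u y\<bar> \<le> M"
    and mv: "\<And>y. y \<in> ball x0 (3 * R) \<Longrightarrow>
      \<exists>\<rho>>0. \<forall>r. 0 < r \<and> r < \<rho> \<longrightarrow> (LINT w:ball y r|lborel. u w) = \<omega> * r ^ DIM('a) * A r * u y"
    and A: "((\<lambda>r. (A r - 1) / r\<^sup>2) \<longlongrightarrow> \<kappa> / (2 * (real DIM('a) + 2))) (at_right 0)" and \<kappa>: "\<kappa> > 0"
    and R: "R > 0" and x: "x \<in> ball x0 R" "x' \<in> ball x0 R" and S: "0 < S" "S \<le> R\<^sup>2"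
  shows "\<kappa> * cap_integral u 3 x S = (LINT y|lborel. u y * cap_laplacian S (y - x))" (is ?P)
    and "cap_integral u 3 x S * u x' = cap_integral u 3 x' S * u x" (is ?Q)
proof -
  define m where "m = DIM('a)"
  define J where "J p x s = cap_integral u p x s" for p x s
  have Lint: "(LINT y|lborel. u y * cap_laplacian s (y - x)) = 24 * s * J 1 x s - (6 * real m + 24) * J 2 x s" for x s
  proof -
    have "u y * cap_laplacian s (y - x) = 24 * s * (u y * cap 1 s (y - x)) - (6 * real m + 24) * (u y * cap 2 s (y - x))" for y
      unfolding cap_laplacian_alt m_def by (simp add: algebra_simps)
    then show ?thesis
      using integrable_mult_cap[OF u, of 1 s x] integrable_mult_cap[OF u, of 2 s x]
      unfolding J_def cap_integral_def by simp
  qed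
  have weak: "\<kappa> * J 3 x s = (LINT y|lborel. u y * cap_laplacian s (y - x))"
    if "x \<in> ball x0 R" "0 < s" "s \<le> R\<^sup>2" for x s
  proof -
    have "(LINT y|lborel. u y * (cap_laplacian s (y - x) - \<kappa> * cap 3 s (y - x))) = 0"
      using weak_equation_of_mean_value[OF u M mv[unfolded \<omega>_def] A \<kappa> R that] by blast
    moreover have "u y * (cap_laplacian s (y - x) - \<kappa> * cap 3 s (y - x)) =
        (24 * s * (u y * cap 1 s (y - x)) - (6 * real m + 24) * (u y * cap 2 s (y - x))) - \<kappa> * (u y * cap 3 s (y - x))" for y
      unfolding cap_laplacian_alt m_def by (simp add: algebra_simps)
    ultimately show ?thesis
      using integrable_mult_cap[OF u, of 1 s x] integrable_mult_cap[OF u, of 2 s x] integrable_mult_cap[OF u, of 3 s x]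
      unfolding Lint unfolding J_def cap_integral_def by simp
  qed
  show ?P using weak[OF x(1) S] by (simp add: J_def)
  have ballR: "y \<in> ball x0 (3 * R)" if "y \<in> ball x0 R" for y using that R by auto
  obtain \<rho>1 where \<rho>1: "\<rho>1 > 0" "\<And>r. 0 < r \<Longrightarrow> r < \<rho>1 \<Longrightarrow> (LINT w:ball x r|lborel. u w) = \<omega> * r ^ DIM('a) * A r * u x"
    using mv[OF ballR[OF x(1)]] by auto
  obtain \<rho>2 where \<rho>2: "\<rho>2 > 0" "\<And>r. 0 < r \<Longrightarrow> r < \<rho>2 \<Longrightarrow> (LINT w:ball x' r|lborel. u w) = \<omega> * r ^ DIM('a) * A r * u x'"
    using mv[OF ballR[OF x(2)]] by auto
  define \<sigma> where "\<sigma> = min \<rho>1 \<rho>2"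
  have \<sigma>: "\<sigma> > 0" using \<rho>1(1) \<rho>2(1) by (simp add: \<sigma>_def)
  have small: "J p x (r\<^sup>2) * u x' = J p x' (r\<^sup>2) * u x" if "p > 0" and r: "0 < r" "r < \<sigma>" for p r
  proof -
    have "(LINT y:ball x r|lborel. u y * (r\<^sup>2 - (dist x y)\<^sup>2) ^ p) * u x' =
        (LINT y:ball x' r|lborel. u y * (r\<^sup>2 - (dist x' y)\<^sup>2) ^ p) * u x"
    proof (rule radial_weight_proportional[where k = "\<lambda>t. (r\<^sup>2 - t\<^sup>2) ^ p", OF u _ _ r])
      show "continuous_on UNIV (\<lambda>t. (r\<^sup>2 - t\<^sup>2) ^ p)" by (intro continuous_intros)
      show "(LINT y:ball x q|lborel. u y) * u x' = (LINT y:ball x' q|lborel. u y) * u x" if "0 < q" "q < \<sigma>" for q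
        using \<rho>1(2)[of q] \<rho>2(2)[of q] that by (simp add: \<sigma>_def)
    qed
    then show ?thesis using that by (simp add: J_def cap_integral_eq_ball)
  qed
  \<comment> \<open>The equation is singular at \<open>s = 0\<close>; start at \<open>r\<^sup>2\<close>, where the data vanish already.\<close>
  define r where "r = min (\<sigma> / 2) (sqrt S)"
  have r: "0 < r" "r < \<sigma>" "r\<^sup>2 \<le> S"
  proof -
    show "0 < r" "r < \<sigma>" using \<sigma> S by (auto simp: r_def)
    then have "r\<^sup>2 \<le> (sqrt S)\<^sup>2" by (intro power_mono) (auto simp: r_def)
    then show "r\<^sup>2 \<le> S" using S by simp
  qed
  define W where "W p s = J p x s * u x' - J p x' s * u x" for p s
  have W: "(W (Suc (Suc n)) has_real_derivative real (Suc (Suc n)) * W (Suc n) s) (at s)" for n s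
  proof -
    have "((\<lambda>s. J (Suc (Suc n)) x s * u x' - J (Suc (Suc n)) x' s * u x) has_real_derivative
        real (Suc (Suc n)) * J (Suc n) x s * u x' - real (Suc (Suc n)) * J (Suc n) x' s * u x) (at s)"
      unfolding J_def by (intro DERIV_diff DERIV_cmult_right has_derivative_cap_integral u)
    moreover have "real (Suc (Suc n)) * J (Suc n) x s * u x' - real (Suc (Suc n)) * J (Suc n) x' s * u x = real (Suc (Suc n)) * W (Suc n) s"
      unfolding W_def by (simp only: right_diff_distrib mult.assoc)
    ultimately show ?thesis unfolding W_def[abs_def] by (simp only:)
  qed
  have W3: "(W 3 has_real_derivative 3 * W 2 s) (at s)" for s
    using W[of 1 s] by (simp add: numeral_3_eq_3 numeral_2_eq_2)
  have W2: "((\<lambda>s. 3 * W 2 s) has_real_derivative 6 * W 1 s) (at s)" for s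
    using DERIV_cmult[OF W[of 0 s], of 3] by (simp add: numeral_2_eq_2)
  define a where "a = (\<kappa> + 2 * real m + 8) / (4 * r\<^sup>2)"
  have "W 3 S = 0"
  proof (rule second_order_ode_unique[where start = "r\<^sup>2" and z = "\<lambda>s. 3 * W 2 s" and z' = "\<lambda>s. 6 * W 1 s" and a = a, OF W3 W2])
    show "W 3 (r\<^sup>2) = 0" "3 * W 2 (r\<^sup>2) = 0" using small[OF _ r(1,2)] by (simp_all add: W_def)
    show "r\<^sup>2 \<le> S" by (rule r)
    show "a \<ge> 0" using \<kappa> by (simp add: a_def)
    fix s assume s: "r\<^sup>2 \<le> s" "s \<le> S"
    have s0: "0 < r\<^sup>2" "0 < s" using r(1) s less_le_trans[of 0 "r\<^sup>2" s] by auto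
    have sR: "s \<le> R\<^sup>2" using s S by simp
    have "24 * s * W 1 s = (24 * s * J 1 x s) * u x' - (24 * s * J 1 x' s) * u x"
      by (simp add: W_def algebra_simps)
    also have "24 * s * J 1 x s = \<kappa> * J 3 x s + (6 * real m + 24) * J 2 x s"
      using weak[OF x(1) s0(2) sR] unfolding Lint by linarith
    also have "24 * s * J 1 x' s = \<kappa> * J 3 x' s + (6 * real m + 24) * J 2 x' s"
      using weak[OF x(2) s0(2) sR] unfolding Lint by linarith
    also have "(\<kappa> * J 3 x s + (6 * real m + 24) * J 2 x s) * u x' - (\<kappa> * J 3 x' s + (6 * real m + 24) * J 2 x' s) * u x =
        \<kappa> * W 3 s + (6 * real m + 24) * W 2 s"
      unfolding W_def by algebra
    finally have eq: "4 * s * (6 * W 1 s) = \<kappa> * W 3 s + (2 * real m + 8) * (3 * W 2 s)" by (simp add: algebra_simps)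
    have "4 * r\<^sup>2 * \<bar>6 * W 1 s\<bar> \<le> 4 * s * \<bar>6 * W 1 s\<bar>"
      using s by (intro mult_right_mono) auto
    also have "\<dots> = \<bar>4 * s * (6 * W 1 s)\<bar>" using s0 by (simp add: abs_mult)
    also have "\<dots> \<le> \<bar>\<kappa> * W 3 s\<bar> + \<bar>(2 * real m + 8) * (3 * W 2 s)\<bar>" unfolding eq by (rule abs_triangle_ineq)
    also have "\<dots> = \<kappa> * \<bar>W 3 s\<bar> + (2 * real m + 8) * \<bar>3 * W 2 s\<bar>" using \<kappa> by (simp add: abs_mult)
    also have "\<dots> \<le> (\<kappa> + 2 * real m + 8) * \<bar>W 3 s\<bar> + (\<kappa> + 2 * real m + 8) * \<bar>3 * W 2 s\<bar>"
      using \<kappa> by (intro add_mono mult_right_mono) auto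
    finally have "4 * r\<^sup>2 * \<bar>6 * W 1 s\<bar> \<le> (\<kappa> + 2 * real m + 8) * (\<bar>W 3 s\<bar> + \<bar>3 * W 2 s\<bar>)" by (simp only: distrib_left)
    then show "\<bar>6 * W 1 s\<bar> \<le> a * (\<bar>W 3 s\<bar> + \<bar>3 * W 2 s\<bar>)"
      unfolding a_def using s0(1) by (simp only: times_divide_eq_left) (simp add: pos_le_divide_eq mult.commute)
  qed
  then show ?Q by (simp add: W_def J_def)
qed

section \<open>Regularity of integrals against truncated powers\<close>

definition kernel_integral :: "('a::euclidean_space \<Rightarrow> real) \<Rightarrow> ('a \<Rightarrow> real) \<Rightarrow> 'a \<Rightarrow> real" where
  "kernel_integral u g x = (LINT y|lborel. u y * g (y - x))"

lemma continuous_on_kernel_integral: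
  fixes u g :: "'a::euclidean_space \<Rightarrow> real"
  assumes u: "continuous_on UNIV u" and g: "continuous_on UNIV g" "\<And>z. z \<notin> cball 0 R \<Longrightarrow> g z = 0"
  shows "continuous_on UNIV (kernel_integral u g)"
proof -
  have "isCont (kernel_integral u g) x0" for x0
  proof -
    obtain a b where ab: "cball x0 (R + 1) \<subseteq> cbox a b" using cball_subset_cbox by blast
    have cont: "continuous_on S (\<lambda>p. u (snd p) * g (snd p - fst p))" for S
      by (intro continuous_on_mult continuous_on_compose2[OF u] continuous_on_compose2[OF g(1)] continuous_intros) auto
    have cont1: "continuous_on UNIV (\<lambda>y. u y * g (y - x))" for x
      by (intro continuous_on_mult continuous_on_compose2[OF u] continuous_on_compose2[OF g(1)] continuous_intros) auto
    have eq: "kernel_integral u g x = integral (cbox a b) (\<lambda>y. u y * g (y - x))" if x: "x \<in> ball x0 1" for x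
      unfolding kernel_integral_def
    proof (rule lborel_integral_eq_cbox_integral[OF cont1])
      fix y assume "y \<notin> cbox a b"
      then have "y \<notin> cball x0 (R + 1)" using ab by blast
      then have "y - x \<notin> cball 0 R"
        using x dist_triangle[of x0 y x] by (auto simp: dist_norm norm_minus_commute)
      then show "u y * g (y - x) = 0" by (simp add: g(2))
    qed
    have "continuous_on (ball x0 1) (\<lambda>x. integral (cbox a b) (\<lambda>y. u y * g (y - x)))"
      using cont by (intro integral_continuous_on_param) (simp add: case_prod_beta)
    then have "continuous_on (ball x0 1) (kernel_integral u g)"
      by (rule continuous_on_eq) (simp add: eq)
    then show ?thesis
      by (simp add: continuous_on_eq_continuous_at)
  qed
  then show ?thesis by (simp add: continuous_at_imp_continuous_on)
qed

text \<open>
  The direction \<open>b\<close> moves the kernel backwards, whence the sign.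
\<close>

lemma has_derivative_kernel_integral:
  fixes u g g' :: "'a::euclidean_space \<Rightarrow> real"
  assumes u: "continuous_on UNIV u"
    and g: "continuous_on UNIV g" "\<And>z. z \<notin> cball 0 R \<Longrightarrow> g z = 0"
    and g': "continuous_on UNIV g'" "\<And>z. z \<notin> cball 0 R \<Longrightarrow> g' z = 0"
    and der: "\<And>z. ((\<lambda>t. g (z + t *\<^sub>R b)) has_real_derivative g' z) (at 0)"
    and b: "norm b = 1"
  shows "((\<lambda>t. kernel_integral u g (x + t *\<^sub>R b)) has_real_derivative - kernel_integral u g' x) (at 0)"
proof -
  define f where "f t y = u y * g (y - (x + t *\<^sub>R b))" for t y
  define f' where "f' t y = u y * - g' (y - (x + t *\<^sub>R b))" for t y
  have "((\<lambda>t. LINT y|lborel. f t y) has_real_derivative (LINT y|lborel. f' 0 y)) (at 0)"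
  proof (rule has_derivative_parametric_integral[where x = x and R = "R + 1"])
    show "((\<lambda>t. f t y) has_real_derivative f' t y) (at t)" for t y
    proof -
      have "((\<lambda>\<tau>. t - \<tau>) has_real_derivative - 1) (at t)"
        by (auto intro!: derivative_eq_intros)
      moreover have "((\<lambda>\<tau>. g (y - (x + t *\<^sub>R b) + \<tau> *\<^sub>R b)) has_real_derivative g' (y - (x + t *\<^sub>R b))) (at (t - t))"
        using der by simp
      ultimately have "((\<lambda>\<tau>. g (y - (x + t *\<^sub>R b) + (t - \<tau>) *\<^sub>R b)) has_real_derivative g' (y - (x + t *\<^sub>R b)) * - 1) (at t)"
        by (rule DERIV_chain2[rotated])
      moreover have "y - (x + t *\<^sub>R b) + (t - \<tau>) *\<^sub>R b = y - (x + \<tau> *\<^sub>R b)" for \<tau>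
        by (simp add: algebra_simps)
      ultimately have "((\<lambda>\<tau>. g (y - (x + \<tau> *\<^sub>R b))) has_real_derivative - g' (y - (x + t *\<^sub>R b))) (at t)"
        by simp
      then show ?thesis unfolding f_def f'_def by (rule DERIV_cmult)
    qed
    show "continuous_on UNIV (f t)" for t
      unfolding f_def
      by (intro continuous_on_mult continuous_on_compose2[OF u] continuous_on_compose2[OF g(1)] continuous_intros) auto
    show "continuous_on UNIV (\<lambda>(t, y). f' t y)"
      unfolding f'_def case_prod_beta
      by (intro continuous_on_mult continuous_on_minus continuous_on_compose2[OF u] continuous_on_compose2[OF g'(1)] continuous_intros) auto
    show "f t y = 0 \<and> f' t y = 0" if t: "\<bar>t - 0\<bar> \<le> 1" and y: "y \<notin> cball x (R + 1)" for t y
    proof -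
      have "norm (y - x) \<le> norm (y - (x + t *\<^sub>R b)) + norm (t *\<^sub>R b)"
        using norm_triangle_ineq[of "y - (x + t *\<^sub>R b)" "t *\<^sub>R b"] by (simp add: algebra_simps)
      moreover have "norm (y - x) > R + 1" using y by (simp add: dist_norm norm_minus_commute)
      ultimately have "y - (x + t *\<^sub>R b) \<notin> cball 0 R" using t b by simp
      then show ?thesis by (simp add: f_def f'_def g(2) g'(2))
    qed
  qed
  moreover have "(LINT y|lborel. f' 0 y) = - kernel_integral u g' x"
    by (simp add: f'_def kernel_integral_def)
  moreover have "(\<lambda>t. LINT y|lborel. f t y) = (\<lambda>t. kernel_integral u g (x + t *\<^sub>R b))"
    by (simp add: fun_eq_iff f_def kernel_integral_def)
  ultimately show ?thesis by (simp only:)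
qed

lemma has_derivative_cap:
  fixes z b :: "'a::euclidean_space"
  shows "((\<lambda>t. cap (Suc (Suc n)) s (z + t *\<^sub>R b)) has_real_derivative
    real (Suc (Suc n)) * cap (Suc n) s z * (- (2 * (z \<bullet> b)))) (at 0)"
proof -
  have "s - (norm (z + t *\<^sub>R b))\<^sup>2 = s - (norm z)\<^sup>2 - 2 * (z \<bullet> b) * t - (norm b)\<^sup>2 * t\<^sup>2" for t
  proof -
    have "(norm (z + t *\<^sub>R b))\<^sup>2 = (norm z)\<^sup>2 + 2 * (z \<bullet> b) * t + (norm b)\<^sup>2 * t\<^sup>2"
      unfolding power2_norm_eq_inner by (simp add: inner_simps inner_commute power2_eq_square algebra_simps)
    then show ?thesis by simp
  qed
  moreover have "((\<lambda>t. s - (norm z)\<^sup>2 - 2 * (z \<bullet> b) * t - (norm b)\<^sup>2 * t\<^sup>2) has_real_derivative - (2 * (z \<bullet> b))) (at 0)"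
    by (auto intro!: derivative_eq_intros)
  ultimately have inner: "((\<lambda>t. s - (norm (z + t *\<^sub>R b))\<^sup>2) has_real_derivative - (2 * (z \<bullet> b))) (at 0)"
    by (simp only:)
  have "((\<lambda>t. (max 0 (s - (norm (z + t *\<^sub>R b))\<^sup>2)) ^ Suc (Suc n)) has_real_derivative
      real (Suc (Suc n)) * (max 0 (s - (norm (z + 0 *\<^sub>R b))\<^sup>2)) ^ Suc n * (- (2 * (z \<bullet> b)))) (at 0)"
    by (rule DERIV_chain2[OF has_derivative_positive_part_power inner])
  then show ?thesis unfolding cap_def by (simp only: scaleR_zero_left add_0_right)
qed

text \<open>
  The derivatives of \<open>cap 3 s\<close> in direction \<open>b\<close>, and in the directions \<open>b\<close> and \<open>c\<close>.
\<close>

definition cap_gradient :: "real \<Rightarrow> 'a::euclidean_space \<Rightarrow> 'a \<Rightarrow> real" where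
  "cap_gradient s b z = - 6 * (z \<bullet> b) * cap 2 s z"

definition cap_hessian :: "real \<Rightarrow> 'a::euclidean_space \<Rightarrow> 'a \<Rightarrow> 'a \<Rightarrow> real" where
  "cap_hessian s b c z = 24 * (z \<bullet> b) * (z \<bullet> c) * cap 1 s z - 6 * (c \<bullet> b) * cap 2 s z"

lemma has_derivative_cap_3:
  "((\<lambda>t. cap 3 s (z + t *\<^sub>R b)) has_real_derivative cap_gradient s b z) (at 0)"
  using has_derivative_cap[of 1 s z b]
  by (simp add: cap_gradient_def numeral_3_eq_3 numeral_2_eq_2 mult_ac)

lemma has_derivative_cap_gradient:
  "((\<lambda>t. cap_gradient s b (z + t *\<^sub>R c)) has_real_derivative cap_hessian s b c z) (at 0)"
proof -
  have lin: "((\<lambda>t. - 6 * ((z + t *\<^sub>R c) \<bullet> b)) has_real_derivative - 6 * (c \<bullet> b)) (at 0)"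
    by (simp add: inner_add_left) (auto intro!: derivative_eq_intros)
  have cap: "((\<lambda>t. cap 2 s (z + t *\<^sub>R c)) has_real_derivative - (4 * (z \<bullet> c) * cap 1 s z)) (at 0)"
    using has_derivative_cap[of 0 s z c] by (simp add: numeral_2_eq_2 mult_ac)
  have "((\<lambda>t. - 6 * ((z + t *\<^sub>R c) \<bullet> b) * cap 2 s (z + t *\<^sub>R c)) has_real_derivative
      - 6 * (c \<bullet> b) * cap 2 s (z + 0 *\<^sub>R c) + - (4 * (z \<bullet> c) * cap 1 s z) * (- 6 * ((z + 0 *\<^sub>R c) \<bullet> b))) (at 0)"
    by (rule DERIV_mult[OF lin cap])
  moreover have "- 6 * (c \<bullet> b) * cap 2 s (z + 0 *\<^sub>R c) + - (4 * (z \<bullet> c) * cap 1 s z) * (- 6 * ((z + 0 *\<^sub>R c) \<bullet> b)) = cap_hessian s b c z"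
    by (simp add: cap_hessian_def)
  ultimately show ?thesis unfolding cap_gradient_def by (simp only:)
qed

lemma cap_hessian_trace:
  fixes z :: "'a::euclidean_space"
  shows "(\<Sum>b\<in>Basis. cap_hessian s b b z) = cap_laplacian s z"
proof -
  have "(\<Sum>b\<in>Basis. cap_hessian s b b z) = (\<Sum>b\<in>Basis. 24 * cap 1 s z * ((z \<bullet> b) * (z \<bullet> b)) - 6 * cap 2 s z)"
    by (intro sum.cong) (auto simp: cap_hessian_def)
  also have "\<dots> = 24 * cap 1 s z * (\<Sum>b\<in>Basis. (z \<bullet> b) * (z \<bullet> b)) - real DIM('a) * (6 * cap 2 s z)"
    by (simp add: sum_subtractf sum_distrib_left)
  also have "(\<Sum>b\<in>Basis. (z \<bullet> b) * (z \<bullet> b)) = (norm z)\<^sup>2"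
    unfolding power2_norm_eq_inner by (rule euclidean_inner[symmetric])
  finally show ?thesis by (simp add: cap_laplacian_def)
qed

lemma cap_support:
  fixes z :: "'a::euclidean_space"
  assumes "z \<notin> cball 0 (1 + \<bar>s\<bar>)"
  shows "cap 3 s z = 0" "cap_gradient s b z = 0" "cap_hessian s b c z = 0"
proof -
  have n: "norm z \<ge> 1 + \<bar>s\<bar>" using assms by simp
  then have "(norm z)\<^sup>2 \<ge> norm z * 1" unfolding power2_eq_square by (intro mult_left_mono) auto
  with n have "s \<le> (norm z)\<^sup>2" by linarith
  then show "cap 3 s z = 0" "cap_gradient s b z = 0" "cap_hessian s b c z = 0"
    by (simp_all add: cap_gradient_def cap_hessian_def cap_eq_0)
qed

lemma C2_cap_integral:
  fixes u :: "'a::euclidean_space \<Rightarrow> real"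
  assumes u: "continuous_on UNIV u"
  shows "C_class_on 2 (\<lambda>x. cap_integral u 3 x s) D"
    and "laplacian (\<lambda>x. cap_integral u 3 x s) x = (LINT y|lborel. u y * cap_laplacian s (y - x))"
proof -
  have c0: "continuous_on UNIV (\<lambda>z::'a. cap 3 s z)" by (intro continuous_intros)
  have c1: "continuous_on UNIV (cap_gradient s b)" for b :: 'a
    unfolding cap_gradient_def by (intro continuous_intros)
  have c2: "continuous_on UNIV (cap_hessian s b c)" for b c :: 'a
    unfolding cap_hessian_def by (intro continuous_intros)
  have eq: "(\<lambda>x. cap_integral u 3 x s) = kernel_integral u (cap 3 s)"
    by (simp add: fun_eq_iff cap_integral_def kernel_integral_def)
  have d0: "((\<lambda>t. kernel_integral u (cap 3 s) (x + t *\<^sub>R b)) has_real_derivative - kernel_integral u (cap_gradient s b) x) (at 0)"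
    if "b \<in> Basis" for b x
    using that by (intro has_derivative_kernel_integral[OF u c0 cap_support(1) c1 cap_support(2) has_derivative_cap_3]) auto
  have p0: "partial_derivative b (kernel_integral u (cap 3 s)) = (\<lambda>x. - kernel_integral u (cap_gradient s b) x)"
    if "b \<in> Basis" for b
    unfolding partial_derivative_def using DERIV_imp_deriv[OF d0[OF that]] by blast
  have d1: "((\<lambda>t. - kernel_integral u (cap_gradient s b) (x + t *\<^sub>R c)) has_real_derivative kernel_integral u (cap_hessian s b c) x) (at 0)"
    if "c \<in> Basis" for b c x
  proof -
    have "((\<lambda>t. kernel_integral u (cap_gradient s b) (x + t *\<^sub>R c)) has_real_derivative - kernel_integral u (cap_hessian s b c) x) (at 0)"
      using that by (intro has_derivative_kernel_integral[OF u c1 cap_support(2) c2 cap_support(3) has_derivative_cap_gradient]) auto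
    from DERIV_minus[OF this] show ?thesis by simp
  qed
  have p1: "partial_derivative c (\<lambda>x. - kernel_integral u (cap_gradient s b) x) = kernel_integral u (cap_hessian s b c)"
    if "c \<in> Basis" for b c
    unfolding partial_derivative_def using DERIV_imp_deriv[OF d1[OF that]] by blast
  have k0: "continuous_on D (kernel_integral u (cap 3 s))"
    by (rule continuous_on_subset[OF continuous_on_kernel_integral[OF u c0 cap_support(1)]]) auto
  have k1: "continuous_on D (\<lambda>x. - kernel_integral u (cap_gradient s b) x)" for b
    by (intro continuous_on_minus, rule continuous_on_subset[OF continuous_on_kernel_integral[OF u c1 cap_support(2)]]) auto
  have k2: "continuous_on D (kernel_integral u (cap_hessian s b c))" for b c
    by (rule continuous_on_subset[OF continuous_on_kernel_integral[OF u c2 cap_support(3)]]) auto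
  have diff: "f differentiable (at 0)" if "(f has_real_derivative d) (at 0)" for f :: "real \<Rightarrow> real" and d
    using that real_differentiable_def by blast
  show "C_class_on 2 (\<lambda>x. cap_integral u 3 x s) D"
    unfolding eq numeral_2_eq_2 C_class_on.simps
    using k0 k1 k2 diff[OF d0] diff[OF d1] by (auto simp: p0 p1)
  have int: "integrable lborel (\<lambda>y. u y * cap_hessian s b b (y - x))" for b :: 'a
  proof (rule integrable_continuous_compact_support[where x = x and R = "1 + \<bar>s\<bar>"])
    show "continuous_on UNIV (\<lambda>y. u y * cap_hessian s b b (y - x))"
      unfolding cap_hessian_def using u by (intro continuous_intros)
    show "u y * cap_hessian s b b (y - x) = 0" if "y \<notin> cball x (1 + \<bar>s\<bar>)" for y
      using cap_support(3)[of "y - x" s b b] that by (simp add: dist_norm norm_minus_commute)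
  qed
  have "laplacian (\<lambda>x. cap_integral u 3 x s) x = (\<Sum>b\<in>Basis. kernel_integral u (cap_hessian s b b) x)"
    unfolding laplacian_def eq by (intro sum.cong) (simp_all add: p0 p1)
  also have "\<dots> = (LINT y|lborel. (\<Sum>b\<in>Basis. u y * cap_hessian s b b (y - x)))"
    unfolding kernel_integral_def using int by (intro Bochner_Integration.integral_sum[symmetric])
  also have "\<dots> = (LINT y|lborel. u y * cap_laplacian s (y - x))"
    by (simp only: sum_distrib_left[symmetric] cap_hessian_trace)
  finally show "laplacian (\<lambda>x. cap_integral u 3 x s) x = (LINT y|lborel. u y * cap_laplacian s (y - x))" .
qed

lemma eventually_open_line:
  fixes x b :: "'a::euclidean_space"
  assumes "open D" "x \<in> D"
  shows "\<forall>\<^sub>F t in nhds 0. x + t *\<^sub>R b \<in> D"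
proof -
  have "((\<lambda>t::real. x + t *\<^sub>R b) \<longlongrightarrow> x + 0 *\<^sub>R b) (nhds 0)"
    by (intro tendsto_intros filterlim_ident)
  then show ?thesis using assms by (auto dest: topological_tendstoD)
qed

lemma partial_derivative_cong_open:
  fixes f g :: "'a::euclidean_space \<Rightarrow> real"
  assumes "open D" "x \<in> D" "\<And>y. y \<in> D \<Longrightarrow> f y = g y"
  shows "partial_derivative b f x = partial_derivative b g x"
  unfolding partial_derivative_def
  by (rule deriv_cong_ev[OF eventually_mono[OF eventually_open_line[OF assms(1,2)]] refl]) (rule assms(3))

lemma C_class_on_cong_open:
  fixes f g :: "'a::euclidean_space \<Rightarrow> real"
  assumes "open D" "\<And>y. y \<in> D \<Longrightarrow> f y = g y" "C_class_on k f D"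
  shows "C_class_on k g D"
  using assms(2,3)
proof (induction k arbitrary: f g)
  case 0
  then show ?case by (auto intro: continuous_on_eq)
next
  case (Suc k)
  have "continuous_on D g" using Suc.prems by (auto intro: continuous_on_eq)
  moreover have "(\<lambda>t. g (x + t *\<^sub>R b)) differentiable (at 0)" if "b \<in> Basis" "x \<in> D" for b x
  proof -
    have "(\<lambda>t. f (x + t *\<^sub>R b)) differentiable (at 0)" using Suc.prems that by simp
    then obtain d where "((\<lambda>t. f (x + t *\<^sub>R b)) has_real_derivative d) (at 0)"
      by (auto simp: real_differentiable_def)
    moreover have "\<forall>\<^sub>F t in nhds 0. f (x + t *\<^sub>R b) = g (x + t *\<^sub>R b)"
      using eventually_open_line[OF assms(1) that(2)] by eventually_elim (rule Suc.prems)
    ultimately have "((\<lambda>t. g (x + t *\<^sub>R b)) has_real_derivative d) (at 0)"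
      by (rule iffD1[OF DERIV_cong_ev[OF refl _ refl], rotated])
    then show ?thesis by (auto simp: real_differentiable_def)
  qed
  moreover have "C_class_on k (partial_derivative b g) D" if "b \<in> Basis" for b
  proof (rule Suc.IH[of "partial_derivative b f"])
    show "partial_derivative b f y = partial_derivative b g y" if "y \<in> D" for y
      using assms(1) that Suc.prems(1) by (rule partial_derivative_cong_open)
    show "C_class_on k (partial_derivative b f) D" using Suc.prems(2) that by simp
  qed
  ultimately show ?case by simp
qed

lemma C_class_on_local:
  fixes f :: "'a::euclidean_space \<Rightarrow> real"
  assumes "\<And>x. x \<in> D \<Longrightarrow> \<exists>U. open U \<and> x \<in> U \<and> C_class_on k f U"
  shows "C_class_on k f D"
  using assms
proof (induction k arbitrary: f)
  case 0
  have "isCont f x" if "x \<in> D" for x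
    using 0[OF that] by (auto simp: continuous_on_eq_continuous_at)
  then show ?case by (simp add: continuous_at_imp_continuous_on)
next
  case (Suc k)
  have "isCont f x" if "x \<in> D" for x
    using Suc.prems[OF that] by (auto simp: continuous_on_eq_continuous_at)
  moreover have "C_class_on k (partial_derivative b f) D" if b: "b \<in> Basis" for b
  proof (rule Suc.IH)
    fix x assume "x \<in> D"
    then obtain U where "open U" "x \<in> U" "C_class_on (Suc k) f U" using Suc.prems by blast
    then show "\<exists>U. open U \<and> x \<in> U \<and> C_class_on k (partial_derivative b f) U" using b by auto
  qed
  moreover have "(\<lambda>t. f (x + t *\<^sub>R b)) differentiable (at 0)" if "b \<in> Basis" "x \<in> D" for b x
    using Suc.prems[OF that(2)] that(1) by auto
  ultimately show ?case by (simp add: continuous_at_imp_continuous_on)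
qed

lemma laplacian_cong_open:
  fixes f g :: "'a::euclidean_space \<Rightarrow> real"
  assumes "open D" "x \<in> D" "\<And>y. y \<in> D \<Longrightarrow> f y = g y"
  shows "laplacian f x = laplacian g x"
  unfolding laplacian_def
  by (intro sum.cong partial_derivative_cong_open[OF assms(1,2)] partial_derivative_cong_open[OF assms(1) _ assms(3)]) auto

text \<open>
  For small \<open>S\<close> the weight is concentrated where \<open>u\<close> has the sign of \<open>u x\<close>.
\<close>

lemma cap_integral_nonzero:
  fixes u :: "'a::euclidean_space \<Rightarrow> real"
  assumes u: "continuous_on UNIV u" and x: "u x \<noteq> 0" and T: "T > 0"
  obtains S where "0 < S" "S \<le> T" "cap_integral u 3 x S \<noteq> 0"
proof -
  have "isCont u x" using u by (simp add: continuous_on_eq_continuous_at)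
  moreover have "\<bar>u x\<bar> / 2 > 0" using x by simp
  ultimately obtain d where d: "d > 0" "\<And>y. dist y x < d \<Longrightarrow> dist (u y) (u x) < \<bar>u x\<bar> / 2"
    unfolding continuous_at_eps_delta by blast
  define S where "S = min T (d\<^sup>2)"
  have S: "S > 0" "S \<le> T" "S \<le> d\<^sup>2" using T d(1) by (auto simp: S_def)
  define q where "q = sqrt (S / 2)"
  have q: "q > 0" "q\<^sup>2 = S / 2" using S(1) by (auto simp: q_def)
  define c where "c = (u x)\<^sup>2 / 2 * (S / 2) ^ 3"
  have c: "c > 0" using x S(1) by (simp add: c_def)
  have low: "indicator (ball x q) y * c \<le> u x * (u y * cap 3 S (y - x))" for y
  proof (cases "(norm (y - x))\<^sup>2 < S")
    case False
    have "\<not> dist x y < q"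
    proof
      assume "dist x y < q"
      then have "(dist x y)\<^sup>2 \<le> q\<^sup>2" by (intro power_mono) auto
      then show False using False q S(1) by (simp add: dist_norm norm_minus_commute)
    qed
    then show ?thesis using False by (simp add: cap_eq_0)
  next
    case True
    then have "norm (y - x) < d"
      using S(3) d(1) by (intro power_less_imp_less_base[of _ 2 d]) auto
    then have "\<bar>u y - u x\<bar> \<le> \<bar>u x\<bar> / 2" using d(2)[of y] by (simp add: dist_norm)
    then have "\<bar>u x\<bar> * \<bar>u y - u x\<bar> \<le> \<bar>u x\<bar> * (\<bar>u x\<bar> / 2)" by (intro mult_left_mono) auto
    then have "\<bar>u x * (u y - u x)\<bar> \<le> (u x)\<^sup>2 / 2" by (simp add: abs_mult power2_eq_square)
    moreover have "u x * u y = (u x)\<^sup>2 + u x * (u y - u x)" by (simp add: power2_eq_square algebra_simps)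
    ultimately have uu: "(u x)\<^sup>2 / 2 \<le> u x * u y" by linarith
    then have uu0: "0 \<le> u x * u y" using zero_le_power2[of "u x"] by linarith
    show ?thesis
    proof (cases "dist x y < q")
      case True
      then have "(dist x y)\<^sup>2 \<le> q\<^sup>2" by (intro power_mono) auto
      then have "S / 2 \<le> S - (norm (y - x))\<^sup>2" using q by (simp add: dist_norm norm_minus_commute)
      then have "S / 2 \<le> max 0 (S - (norm (y - x))\<^sup>2)" by (rule order_trans) simp
      then have capb: "(S / 2) ^ 3 \<le> cap 3 S (y - x)" unfolding cap_def by (rule power_mono) (use S(1) in simp)
      have "c \<le> (u x * u y) * cap 3 S (y - x)"
        unfolding c_def by (rule mult_mono[OF uu capb uu0]) (use S(1) in simp)
      then show ?thesis using True by (simp add: mult.assoc)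
    next
      case False
      have "0 \<le> (u x * u y) * cap 3 S (y - x)"
        by (rule mult_nonneg_nonneg[OF uu0 cap_nonneg])
      then show ?thesis using False by (simp add: mult.assoc)
    qed
  qed
  have fin: "emeasure lborel (ball x q) < \<infinity>" by (rule emeasure_lborel_ball_finite)
  have "0 < c * measure lborel (ball x q)"
    using c q(1) content_ball_pos[of q x] by simp
  also have "\<dots> = (LINT y|lborel. indicator (ball x q) y * c)" using fin by simp
  also have "\<dots> \<le> (LINT y|lborel. u x * (u y * cap 3 S (y - x)))"
    using fin integrable_mult_cap[OF u, of 3 S x]
    by (intro integral_mono low integrable_mult_left integrable_mult_right integrable_real_indicator) auto
  also have "\<dots> = u x * cap_integral u 3 x S" by (simp add: cap_integral_def)
  finally have "cap_integral u 3 x S \<noteq> 0" by auto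
  with S show ?thesis using that by blast
qed

section \<open>Panharmonicity\<close>

lemma volume_mean_cong:
  assumes "\<And>y. y \<in> ball x r \<Longrightarrow> f y = g y"
  shows "volume_mean f x r = volume_mean g x r"
proof -
  have "(\<lambda>y. indicator (ball x r) y *\<^sub>R f y) = (\<lambda>y. indicator (ball x r) y *\<^sub>R g y)"
    using assms by (auto simp: indicator_def fun_eq_iff)
  then show ?thesis by (simp only: volume_mean_def set_lebesgue_integral_def)
qed

lemma spherical_mean_cong:
  assumes "\<And>y. y \<in> sphere x r \<Longrightarrow> f y = g y"
  shows "spherical_mean f x r = spherical_mean g x r"
proof -
  have "(\<lambda>y. indicator (sphere x r) y *\<^sub>R f y) = (\<lambda>y. indicator (sphere x r) y *\<^sub>R g y)"
    using assms by (auto simp: indicator_def fun_eq_iff)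
  then show ?thesis by (simp only: spherical_mean_def set_lebesgue_integral_def)
qed

text \<open>
  If \<open>u\<close> does not vanish identically on the ball, proportionality with a point where it does not vanish
  represents it as a multiple of an integral against the truncated cube with fixed \<open>S\<close>, a \<open>C\<^sup>2\<close> function
  whose Laplacian is given by the weak equation.
\<close>

lemma panharmonic_near_center:
  fixes u :: "'a::euclidean_space \<Rightarrow> real" and A :: "real \<Rightarrow> real"
  defines "\<omega> \<equiv> measure lborel (ball (0::'a) 1)"
  assumes u: "continuous_on UNIV u" and M: "\<And>y. \<bar>u y\<bar> \<le> M"
    and mv: "\<And>y. y \<in> ball x0 (3 * R) \<Longrightarrow>
      \<exists>\<rho>>0. \<forall>r. 0 < r \<and> r < \<rho> \<longrightarrow> (LINT w:ball y r|lborel. u w) = \<omega> * r ^ DIM('a) * A r * u y"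
    and A: "((\<lambda>r. (A r - 1) / r\<^sup>2) \<longlongrightarrow> \<mu>\<^sup>2 / (2 * (real DIM('a) + 2))) (at_right 0)" and \<mu>: "\<mu> \<noteq> 0"
    and R: "R > 0"
  shows "panharmonic_on \<mu> u (ball x0 R)"
proof -
  let ?B = "ball x0 R"
  have \<kappa>: "\<mu>\<^sup>2 > 0" using \<mu> by simp
  note properties = cap_integral_of_mean_value[where ?x0.0 = x0, OF u M mv[unfolded \<omega>_def] A \<kappa> R]
  have eigen: "\<mu>\<^sup>2 * cap_integral u 3 x S = (LINT y|lborel. u y * cap_laplacian S (y - x))"
    if "x \<in> ?B" "0 < S" "S \<le> R\<^sup>2" for x S
    using properties(1)[OF _ that(1) that(1) that(2,3)] by blast
  have proportional: "cap_integral u 3 x S * u x' = cap_integral u 3 x' S * u x"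
    if "x \<in> ?B" "x' \<in> ?B" "0 < S" "S \<le> R\<^sup>2" for x x' S
    using properties(2)[OF _ that] by blast
  have "\<exists>c S. 0 < S \<and> S \<le> R\<^sup>2 \<and> (\<forall>x\<in>?B. u x = c * cap_integral u 3 x S)"
  proof (cases "\<exists>x1\<in>?B. u x1 \<noteq> 0")
    case False
    then show ?thesis using R by (intro exI[of _ 0] exI[of _ "R\<^sup>2"]) auto
  next
    case True
    then obtain x1 where x1: "x1 \<in> ?B" "u x1 \<noteq> 0" by blast
    obtain S where S: "0 < S" "S \<le> R\<^sup>2" "cap_integral u 3 x1 S \<noteq> 0"
      using cap_integral_nonzero[OF u x1(2), of "R\<^sup>2"] R by auto
    have "u x = u x1 / cap_integral u 3 x1 S * cap_integral u 3 x S" if "x \<in> ?B" for x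
      using proportional[OF that x1(1) S(1,2)] S(3) by (simp add: field_simps)
    then show ?thesis using S(1,2) by blast
  qed
  then obtain c S where S: "0 < S" "S \<le> R\<^sup>2" and rep: "\<And>x. x \<in> ?B \<Longrightarrow> u x = c * cap_integral u 3 x S" by blast
  define w where "w x = cap_integral (\<lambda>y. c * u y) 3 x S" for x
  have cu: "continuous_on UNIV (\<lambda>y. c * u y)" using u by (intro continuous_intros)
  have w: "w x = u x" if "x \<in> ?B" for x
    using rep[OF that] by (simp add: w_def cap_integral_def mult.assoc)
  have "C_class_on 2 w ?B" unfolding w_def[abs_def] by (rule C2_cap_integral(1)[OF cu])
  then have "C_class_on 2 u ?B" by (rule C_class_on_cong_open[OF open_ball, of x0 R w, rotated]) (rule w)
  moreover have "laplacian u x - \<mu>\<^sup>2 * u x = 0" if x: "x \<in> ?B" for x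
  proof -
    have "laplacian u x = laplacian w x"
      by (rule laplacian_cong_open[OF open_ball x]) (simp add: w)
    also have "\<dots> = (LINT y|lborel. c * (u y * cap_laplacian S (y - x)))"
      unfolding w_def[abs_def] C2_cap_integral(2)[OF cu] by (simp only: mult.assoc)
    also have "\<dots> = c * (\<mu>\<^sup>2 * cap_integral u 3 x S)"
      unfolding integral_mult_right_zero eigen[OF x S, symmetric] ..
    also have "\<dots> = \<mu>\<^sup>2 * u x" by (simp only: rep[OF x] mult.left_commute)
    finally show ?thesis by simp
  qed
  ultimately show ?thesis by (simp add: panharmonic_on_def)
qed

lemma panharmonic_on_local:
  fixes u :: "'a::euclidean_space \<Rightarrow> real"
  assumes "\<And>x. x \<in> D \<Longrightarrow> \<exists>U v. open U \<and> x \<in> U \<and> (\<forall>y\<in>U. v y = u y) \<and> panharmonic_on \<mu> v U"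
  shows "panharmonic_on \<mu> u D"
  unfolding panharmonic_on_def
proof (intro conjI ballI)
  show "C_class_on 2 u D"
  proof (rule C_class_on_local)
    fix x assume "x \<in> D"
    from assms[OF this] obtain U v where U: "open U" "x \<in> U" "\<forall>y\<in>U. v y = u y" "panharmonic_on \<mu> v U"
      by blast
    have "C_class_on 2 u U"
      by (rule C_class_on_cong_open[OF U(1), of v]) (use U(3,4) in \<open>simp_all add: panharmonic_on_def\<close>)
    with U(1,2) show "\<exists>U. open U \<and> x \<in> U \<and> C_class_on 2 u U" by blast
  qed
  fix x assume "x \<in> D"
  from assms[OF this] obtain U v where U: "open U" "x \<in> U" "\<forall>y\<in>U. v y = u y" "panharmonic_on \<mu> v U"
    by blast
  have "laplacian u x = laplacian v x"
    by (rule laplacian_cong_open[OF U(1,2)]) (use U(3) in simp)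
  moreover have "laplacian v x - \<mu>\<^sup>2 * v x = 0" "v x = u x"
    using U(2-4) by (simp_all add: panharmonic_on_def)
  ultimately show "laplacian u x - \<mu>\<^sup>2 * u x = 0" by (simp only:)
qed

theorem theorem3p2:
  fixes \<mu> :: real and D :: "(real ^ 'm) set" and u :: "real ^ 'm \<Rightarrow> real"
  assumes "CARD('m) \<ge> 2"
    and "\<mu> \<noteq> 0"
    and "open D" and "connected D" and "bounded D"
    and "continuous_on D u"
    and "\<forall>x\<in>D. \<exists>\<rho>>0. cball x \<rho> \<subseteq> D \<and>
          (\<forall>r\<in>{0<..<\<rho>}. a_spherical CARD('m) (\<mu> * r) * volume_mean u x r =
                         a_volume CARD('m) (\<mu> * r) * spherical_mean u x r)"
  shows "panharmonic_on \<mu> u D"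
proof (rule panharmonic_on_local)
  fix x0 assume "x0 \<in> D"
  then obtain e where e: "e > 0" "cball x0 e \<subseteq> D"
    using \<open>open D\<close> open_contains_cball by blast
  \<comment> \<open>The local argument uses radii up to \<open>3R\<close>, and balls of radius below \<open>R\<close> about those points.\<close>
  define R where "R = e / 4"
  have R: "R > 0" "4 * R = e" using e(1) by (auto simp: R_def)
  have uK: "continuous_on (cball x0 e) u"
    using \<open>continuous_on D u\<close> e(2) by (rule continuous_on_subset)
  have "bounded (u ` cball x0 e)"
    using uK by (intro compact_imp_bounded compact_continuous_image) auto
  then obtain M where M: "\<And>y. y \<in> cball x0 e \<Longrightarrow> norm (u y) \<le> M"
    unfolding bounded_iff by blast
  have "M \<ge> 0" using M[of x0] e(1) norm_ge_zero[of "u x0"] by simp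
  \<comment> \<open>A bounded continuous extension lets all integrals be taken over the whole space.\<close>
  obtain v where v: "continuous_on UNIV v" "\<And>y. y \<in> cball x0 e \<Longrightarrow> v y = u y" "\<And>y. norm (v y) \<le> M"
  proof (rule Tietze[OF uK _ \<open>M \<ge> 0\<close> M, of UNIV])
    show "closedin (top_of_set UNIV) (cball x0 e)" by simp
  qed (use that in auto)
  have card: "CARD('m) = DIM(real ^ 'm)" by simp
  have mv: "\<exists>\<rho>>0. \<forall>r. 0 < r \<and> r < \<rho> \<longrightarrow> (LINT w:ball y r|lborel. v w) =
      measure lborel (ball (0::real ^ 'm) 1) * r ^ DIM(real ^ 'm) * a_volume DIM(real ^ 'm) (\<mu> * r) * v y"
    if y: "y \<in> ball x0 (3 * R)" for y
  proof -
    have "y \<in> D" using y e R by auto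
    then obtain \<rho> where \<rho>: "\<rho> > 0" "\<And>r. 0 < r \<Longrightarrow> r < \<rho> \<Longrightarrow>
        a_spherical CARD('m) (\<mu> * r) * volume_mean u y r = a_volume CARD('m) (\<mu> * r) * spherical_mean u y r"
      using assms(7) by force
    have "a_spherical DIM(real ^ 'm) (\<mu> * r) * volume_mean v y r =
        a_volume DIM(real ^ 'm) (\<mu> * r) * spherical_mean v y r" if r: "0 < r" "r < min \<rho> R" for r
    proof -
      have sub: "w \<in> cball x0 e" if "dist y w \<le> r" for w
        using dist_triangle[of x0 w y] y that r R by simp
      have "volume_mean v y r = volume_mean u y r"
        by (rule volume_mean_cong[OF v(2)[OF sub]]) simp
      moreover have "spherical_mean v y r = spherical_mean u y r"
        by (rule spherical_mean_cong[OF v(2)[OF sub]]) simp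
      ultimately show ?thesis using \<rho>(2)[of r] r unfolding card by simp
    qed
    from volume_mean_from_quotient[where \<rho> = "min \<rho> R", OF v(1) this] show ?thesis
      using \<rho>(1) R(1) by (intro exI[of _ "min \<rho> R"]) auto
  qed
  have "((\<lambda>r. (a_volume DIM(real ^ 'm) (\<mu> * r) - 1) / r\<^sup>2) \<longlongrightarrow> \<mu>\<^sup>2 / (2 * (real DIM(real ^ 'm) + 2))) (at_right 0)"
    by (rule a_volume_second_order) (simp add: Suc_leI)
  from panharmonic_near_center[OF v(1) v(3)[unfolded real_norm_def] mv this \<open>\<mu> \<noteq> 0\<close> R(1)]
  have "panharmonic_on \<mu> v (ball x0 R)" .
  moreover have "\<forall>y\<in>ball x0 R. v y = u y" using v(2) R by auto
  ultimately show "\<exists>U v. open U \<and> x0 \<in> U \<and> (\<forall>y\<in>U. v y = u y) \<and> panharmonic_on \<mu> v U"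
    using R(1) by (intro exI[of _ "ball x0 R"] exI[of _ v]) simp
qed

end
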